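(* Let $d\ge 1$ and let $M\subseteq\mathbb{R}^d$ be a nonempty multirectangle. For $f\in\operatorname{Rec}_d(M)$ and $i\in\{1,\dots,d\}$ define $$T_i(f)=\sum_{x\in\mathbb{R}^d}\operatorname{vol}^\otimes_{d,i}\big(\{y\in M: f(y)-y=x\}\big)\otimes x_i\ \in\mathbb{R}^{\otimes(d+1)}$$ (the sets $\{y\in M:f(y)-y=x\}$ are multirectangles, empty for all but finitely many $x$, and $x_i$ denotes the $i$-th coordinate of $x$), and $T(f)=(T_1(f),\dots,T_d(f))$. Then $T$ is a group homomorphism from $\operatorname{Rec}_d(M)$ onto $\big(\mathbb{R}^{\otimes(d-1)}\otimes\textstyle\bigwedge^2_{\mathbb{Q}}\mathbb{R}\big)^d\subseteq(\mathbb{R}^{\otimes(d+1)})^d$, and its kernel is exactly the derived subgroup $D(\operatorname{Rec}_d(M))$. Consequently the abelianization of $\operatorname{Rec}_d(M)$ is isomorphic to $\big(\mathbb{R}^{\otimes(d-1)}\otimes\bigwedge^2_{\mathbb{Q}}\mathbb{R}\big)^d$.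
   Context: A rectangle in $\mathbb{R}^d$ is a set $\prod_{i=1}^d[a_i,b_i)$ with $a_i<b_i$ real numbers. A multirectangle is a finite union of rectangles. For a multirectangle $M\subseteq\mathbb{R}^d$, $\operatorname{Rec}_d(M)$ denotes the group, under composition, of all bijections $f:M\to M$ for which there exists a finite partition of $M$ into rectangles such that the restriction of $f$ to each piece is a translation. All tensor products are over $\mathbb{Q}$, and $\mathbb{R}^{\otimes k}$ is the $k$-th tensor power of $\mathbb{R}$ over $\mathbb{Q}$. The tensor volume $\operatorname{vol}^\otimes_d$ is the unique map from multirectangles of $\mathbb{R}^d$ to $\mathbb{R}^{\otimes d}$, additive on disjoint unions, with $\operatorname{vol}^\otimes_d(\prod_{j=1}^d[a_j,a_j+t_j))=t_1\otimes\cdots\otimes t_d$. Letting $\sigma_i$ be the $\mathbb{Q}$-linear automorphism of $\mathbb{R}^{\otimes d}$ exchanging the $i$-th and $d$-th tensor factors, $\operatorname{vol}^\otimes_{d,i}=\sigma_i\circ\operatorname{vol}^\otimes_d$; thus $\operatorname{vol}^\otimes_{d,i}(\prod_j[a_j,a_j+t_j))=t_1\otimes\cdots\otimes t_{i-1}\otimes t_{i+1}\otimes\cdots\otimes t_d\otimes t_i$. Here $\bigwedge^2_{\mathbb{Q}}\mathbb{R}$ is identified with the $\mathbb{Q}$-subspace of $\mathbb{R}^{\otimes2}$ spanned by the elements $a\otimes b-b\otimes a$ (with $a\wedge b=a\otimes b-b\otimes a$), so that $\mathbb{R}^{\otimes(d-1)}\otimes\bigwedge^2_{\mathbb{Q}}\mathbb{R}\subseteq\mathbb{R}^{\otimes(d+1)}$.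 $D(G)$ is the derived subgroup of $G$. *)

theory Defs
  imports "HOL-Algebra.Algebra"
begin

section \<open>Points of R^d as real lists of length d (coordinates indexed 0..d-1)\<close>

definition vadd :: "real list \<Rightarrow> real list \<Rightarrow> real list" where
  "vadd x v = map2 (+) x v"

definition vdiff :: "real list \<Rightarrow> real list \<Rightarrow> real list" where
  "vdiff x y = map2 (-) x y"

definition box_d :: "nat \<Rightarrow> real list \<Rightarrow> real list \<Rightarrow> real list set" where
  "box_d d a b = {x. length x = d \<and> (\<forall>i<d. a ! i \<le> x ! i \<and> x ! i < b ! i)}"

definition rect_data :: "nat \<Rightarrow> real list \<Rightarrow> real list \<Rightarrow> bool" where
  "rect_data d a b \<longleftrightarrow> length a = d \<and> length b = d \<and> (\<forall>i<d. a ! i < b ! i)"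

definition rectangle :: "nat \<Rightarrow> real list set \<Rightarrow> bool" where
  "rectangle d R \<longleftrightarrow> (\<exists>a b. rect_data d a b \<and> R = box_d d a b)"

definition multirectangle :: "nat \<Rightarrow> real list set \<Rightarrow> bool" where
  "multirectangle d M \<longleftrightarrow> (\<exists>F. finite F \<and> (\<forall>R\<in>F. rectangle d R) \<and> M = \<Union>F)"

text \<open>Bijections of M are encoded as total functions that are the identity outside M.\<close>
definition rec_map :: "nat \<Rightarrow> real list set \<Rightarrow> (real list \<Rightarrow> real list) \<Rightarrow> bool" where
  "rec_map d M f \<longleftrightarrow> bij_betw f M M \<and> (\<forall>x. x \<notin> M \<longrightarrow> f x = x) \<and>
     (\<exists>P. finite P \<and> (\<forall>R\<in>P. rectangle d R) \<and> \<Union>P = M \<and> pairwise disjnt P \<and>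
          (\<forall>R\<in>P. \<exists>v. length v = d \<and> (\<forall>y\<in>R. f y = vadd y v)))"

definition Rec_group :: "nat \<Rightarrow> real list set \<Rightarrow> (real list \<Rightarrow> real list) monoid" where
  "Rec_group d M = \<lparr>carrier = {f. rec_map d M f}, monoid.mult = (\<circ>), one = id\<rparr>"

definition FreeQ :: "nat \<Rightarrow> (real list \<Rightarrow> rat) monoid" where
  "FreeQ k = \<lparr>carrier = {u. finite {ts. u ts \<noteq> 0} \<and> (\<forall>ts. u ts \<noteq> 0 \<longrightarrow> length ts = k)},
              monoid.mult = (\<lambda>u v. (\<lambda>ts. u ts + v ts)), one = (\<lambda>_. 0)\<rparr>"

definition delta :: "real list \<Rightarrow> (real list \<Rightarrow> rat)" where
  "delta ts = (\<lambda>s. if s = ts then 1 else 0)"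

text \<open>Rational multiples of the additivity relations in each slot; the subgroup they generate
  is the Q-span of the multilinearity relations.\<close>
definition tensor_gens :: "nat \<Rightarrow> (real list \<Rightarrow> rat) set" where
  "tensor_gens k = {(\<lambda>s. c * (delta (us @ [a + b] @ vs) s - delta (us @ [a] @ vs) s
                               - delta (us @ [b] @ vs) s))
                    | c us vs a b. length us + length vs + 1 = k}"

definition tensor_rel :: "nat \<Rightarrow> (real list \<Rightarrow> rat) set" where
  "tensor_rel k = generate (FreeQ k) (tensor_gens k)"

definition TP :: "nat \<Rightarrow> (real list \<Rightarrow> rat) set monoid" where
  "TP k = FreeQ k Mod tensor_rel k"

definition ptensor :: "real list \<Rightarrow> (real list \<Rightarrow> rat) set" where
  "ptensor ts = tensor_rel (length ts) #>\<^bsub>FreeQ (length ts)\<^esub> delta ts"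

definition ext_right :: "real \<Rightarrow> (real list \<Rightarrow> rat) \<Rightarrow> (real list \<Rightarrow> rat)" where
  "ext_right r u = (\<lambda>s. if s \<noteq> [] \<and> last s = r then u (butlast s) else 0)"

definition tensor_right :: "nat \<Rightarrow> (real list \<Rightarrow> rat) set \<Rightarrow> real \<Rightarrow> (real list \<Rightarrow> rat) set" where
  "tensor_right k c r = (\<Union>u\<in>c. tensor_rel (Suc k) #>\<^bsub>FreeQ (Suc k)\<^esub> ext_right r u)"

text \<open>Generic tensor volume where the side-length list (t_1,...,t_d) of each rectangle is
  transformed by sigma before forming the pure tensor; defined as the common value of the
  sum over any finite partition into rectangles.\<close>
definition tvol_gen :: "nat \<Rightarrow> (real list \<Rightarrow> real list) \<Rightarrow> real list set \<Rightarrow> (real list \<Rightarrow> rat) set" where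
  "tvol_gen d \<sigma> S = (THE t. \<exists>(I :: nat set) a b. finite I \<and> (\<forall>j\<in>I. rect_data d (a j) (b j)) \<and>
      S = (\<Union>j\<in>I. box_d d (a j) (b j)) \<and>
      (\<forall>j\<in>I. \<forall>j'\<in>I. j \<noteq> j' \<longrightarrow> box_d d (a j) (b j) \<inter> box_d d (a j') (b j') = {}) \<and>
      t = finprod (TP d) (\<lambda>j. ptensor (\<sigma> (vdiff (b j) (a j)))) I)"

definition tvol :: "nat \<Rightarrow> real list set \<Rightarrow> (real list \<Rightarrow> rat) set" where
  "tvol d S = tvol_gen d id S"

definition swap_fac :: "nat \<Rightarrow> nat \<Rightarrow> real list \<Rightarrow> real list" where
  "swap_fac d i ts = ts[i := ts ! (d - 1), d - 1 := ts ! i]"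

definition tvol_i :: "nat \<Rightarrow> nat \<Rightarrow> real list set \<Rightarrow> (real list \<Rightarrow> rat) set" where
  "tvol_i d i S = tvol_gen d (swap_fac d i) S"

definition disp :: "(real list \<Rightarrow> real list) \<Rightarrow> real list \<Rightarrow> real list" where
  "disp f y = vdiff (f y) y"

definition T_comp :: "nat \<Rightarrow> real list set \<Rightarrow> (real list \<Rightarrow> real list) \<Rightarrow> nat \<Rightarrow> (real list \<Rightarrow> rat) set" where
  "T_comp d M f i = finprod (TP (Suc d))
      (\<lambda>x. tensor_right d (tvol_i d i {y \<in> M. disp f y = x}) (x ! i)) (disp f ` M)"

definition T_map :: "nat \<Rightarrow> real list set \<Rightarrow> (real list \<Rightarrow> real list) \<Rightarrow> nat \<Rightarrow> (real list \<Rightarrow> rat) set" where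
  "T_map d M f = (\<lambda>i\<in>{..<d}. T_comp d M f i)"

text \<open>R^{\<otimes>(d-1)} \<otimes> \<Lambda>^2_Q R inside R^{\<otimes>(d+1)}: generated by t \<otimes> (a \<otimes> b - b \<otimes> a).\<close>
definition wedge_sub :: "nat \<Rightarrow> (real list \<Rightarrow> rat) set set" where
  "wedge_sub d = generate (TP (Suc d))
     {ptensor (ts @ [a, b]) \<otimes>\<^bsub>TP (Suc d)\<^esub> inv\<^bsub>TP (Suc d)\<^esub> ptensor (ts @ [b, a])
      | ts a b. length ts = d - 1}"

end

theory Submission
  imports Defs "HOL-Library.Function_Algebras"
begin

text \<open>
  Finitely many positive reals lie in the \<open>\<nat>\<close>-span of a finite set \<open>E\<close> of arbitrarily small,
  rationally independent positive reals. Given a rectangle exchange \<open>f\<close>, choose a grid that contains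
  all coordinates occurring in \<open>f\<close> and whose gaps all belong to such an \<open>E\<close>. By independence a
  rectangle and its translate are cut by the grid into intervals with the same multiset of lengths
  along each axis, so after composing \<open>f\<close> with shuffles of two adjacent cells it permutes the grid
  cells by translations, that is, it becomes a product of swaps of two translates of a box.
  A swap is a product of two conjugate involutions (halve the box), hence lies in the derived
  subgroup, and the class of a small shuffle in the abelianization depends only on the lengths
  involved, since two positions can be exchanged by swaps through a third, disjoint one. So the
  class of \<open>f\<close> is a monomial in finitely many shuffle classes, indexed by tuples from \<open>E\<close>.
  On a shuffle \<open>T\<close> takes the value \<open>t \<otimes> (a \<otimes> b - b \<otimes> a)\<close>, and products of functionals dual to \<open>E\<close>
  recover the exponents from \<open>T f\<close>; hence \<open>T f = 0\<close> forces \<open>f\<close> into the derived subgroup.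
\<close>

section \<open>Grids\<close>

text \<open>The tensor power is a rational vector space, whereas nothing is known beforehand about
  torsion or divisibility of the abelianization. So the class of \<open>f\<close> is written as a
  monomial with integer exponents, and the functionals have to return these same integers. For this
  each generator may occur only once. A shuffle and its inverse interchange the two lengths, and
  equal lengths give a swap, so only the types with \<open>ts ! i < t\<close> are kept.

  The elements of \<open>E\<close> must be small because two boxes compared in the abelianization
  may overlap. The third position is sought in a fixed cube inside \<open>M\<close>, which holds
  five boxes side by side, and two given boxes cannot obstruct all of them.

  Surjectivity starts from shuffles in the same kind of cube, which give the wedges with small
  positive entries. Since small positive reals generate the additive group of the reals,
  multiadditivity extends this to all entries, one slot at a time.\<close>

lemma length_vadd [simp]: "length (vadd x v) = min (length x) (length v)"
  by (simp add: vadd_def)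

lemma nth_vadd [simp]: "i < length x \<Longrightarrow> i < length v \<Longrightarrow> vadd x v ! i = x ! i + v ! i"
  by (simp add: vadd_def)

lemma length_vdiff [simp]: "length (vdiff x v) = min (length x) (length v)"
  by (simp add: vdiff_def)

lemma nth_vdiff [simp]: "i < length x \<Longrightarrow> i < length v \<Longrightarrow> vdiff x v ! i = x ! i - v ! i"
  by (simp add: vdiff_def)

lemma set_nthD: "set a \<subseteq> C \<Longrightarrow> i < length a \<Longrightarrow> a ! i \<in> C"
  using nth_mem by blast

text \<open>
  One finite set \<open>C\<close> of coordinates serves all axes, and a \<open>gridset\<close> is a union of bounded cells of
  this grid. The successor \<open>nx C t\<close> and the predecessor \<open>fl C t\<close> are junk outside the range of \<open>C\<close>.
\<close>
definition nx :: "real set \<Rightarrow> real \<Rightarrow> real" where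
  "nx C t = Min {c \<in> C. t < c}"

definition fl :: "real set \<Rightarrow> real \<Rightarrow> real" where
  "fl C t = Max {c \<in> C. c \<le> t}"

definition gap :: "real set \<Rightarrow> real \<Rightarrow> real" where
  "gap C t = nx C t - t"

text \<open>Being in the same cell, bounded or not, without naming the cell: the comparison
  \<open>c \<le> x ! i\<close> fits boxes closed on the left and open on the right.\<close>

definition ceq :: "real set \<Rightarrow> real list \<Rightarrow> real list \<Rightarrow> bool" where
  "ceq C x y \<longleftrightarrow> length x = length y \<and> (\<forall>i<length x. \<forall>c\<in>C. c \<le> x ! i \<longleftrightarrow> c \<le> y ! i)"

definition gridset :: "nat \<Rightarrow> real set \<Rightarrow> real list set \<Rightarrow> bool" where
  "gridset d C S \<longleftrightarrow> finite C \<and> (\<forall>x\<in>S. length x = d \<and> (\<forall>y. ceq C x y \<longrightarrow> y \<in> S) \<and>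
      (\<forall>i<d. (\<exists>c\<in>C. c \<le> x ! i) \<and> (\<exists>c\<in>C. x ! i < c)))"

text \<open>For a gridset these are the lower corners of its cells, so sums over cells become sums
  over \<open>pts C S\<close>.\<close>

definition pts :: "real set \<Rightarrow> real list set \<Rightarrow> real list set" where
  "pts C S = {p \<in> S. set p \<subseteq> C}"

definition cell :: "nat \<Rightarrow> real set \<Rightarrow> real list \<Rightarrow> real list set" where
  "cell d C p = box_d d p (map (nx C) p)"

lemma ceq_sym: "ceq C x y \<Longrightarrow> ceq C y x"
  by (auto simp: ceq_def)

lemma ceq_trans: "ceq C x y \<Longrightarrow> ceq C y z \<Longrightarrow> ceq C x z"
  by (auto simp: ceq_def)

lemma ceq_refl [simp]: "ceq C x x"
  by (auto simp: ceq_def)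

lemma ceq_mono: "ceq C x y \<Longrightarrow> C' \<subseteq> C \<Longrightarrow> ceq C' x y"
  by (auto simp: ceq_def)

lemma gridset_len: "gridset d C S \<Longrightarrow> x \<in> S \<Longrightarrow> length x = d"
  by (auto simp: gridset_def)

lemma gridset_finite: "gridset d C S \<Longrightarrow> finite C"
  by (auto simp: gridset_def)

lemma gridset_ceq: "gridset d C S \<Longrightarrow> x \<in> S \<Longrightarrow> ceq C x y \<Longrightarrow> y \<in> S"
  by (auto simp: gridset_def)

lemma gridset_bounds:
  assumes "gridset d C S" "x \<in> S" "i < d"
  obtains c c' where "c \<in> C" "c \<le> x ! i" "c' \<in> C" "x ! i < c'"
proof -
  have "(\<exists>c\<in>C. c \<le> x ! i) \<and> (\<exists>c\<in>C. x ! i < c)" using assms unfolding gridset_def by blast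
  thus thesis using that by auto
qed

lemma gridset_mono:
  assumes "gridset d C S" "C \<subseteq> C'" "finite C'"
  shows "gridset d C' S"
  unfolding gridset_def
proof (intro conjI ballI allI impI)
  fix x y assume x: "x \<in> S" and "ceq C' x y"
  thus "y \<in> S" using assms ceq_mono[OF _ assms(2)] by (auto simp: gridset_def)
next
  fix x i assume x: "x \<in> S" "i < d"
  hence "(\<exists>c\<in>C. c \<le> x ! i) \<and> (\<exists>c\<in>C. x ! i < c)" using assms by (auto simp: gridset_def)
  thus "\<exists>c\<in>C'. c \<le> x ! i" "\<exists>c\<in>C'. x ! i < c" using assms(2) by auto
qed (use assms in \<open>auto simp: gridset_def\<close>)

lemma gridset_Union:
  assumes "finite C" "\<And>S. S \<in> F \<Longrightarrow> gridset d C S"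
  shows "gridset d C (\<Union>F)"
  unfolding gridset_def
proof (intro conjI ballI)
  fix x assume "x \<in> \<Union>F"
  then obtain S where S: "x \<in> S" "S \<in> F" by auto
  note x = bspec[OF conjunct2[OF assms(2)[OF S(2), unfolded gridset_def]] S(1)]
  show "length x = d" using x by (rule conjunct1)
  show "\<forall>y. ceq C x y \<longrightarrow> y \<in> \<Union>F" using conjunct1[OF conjunct2[OF x]] S(2) by blast
  show "\<forall>i<d. (\<exists>c\<in>C. c \<le> x ! i) \<and> (\<exists>c\<in>C. x ! i < c)"
    using conjunct2[OF conjunct2[OF x]] .
qed fact

lemma gridset_UN: "finite C \<Longrightarrow> (\<And>j. j \<in> J \<Longrightarrow> gridset d C (S j)) \<Longrightarrow> gridset d C (\<Union>j\<in>J. S j)"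
  by (rule gridset_Union) auto

lemma gridset_box:
  assumes "finite C" "rect_data d a b" "set a \<subseteq> C" "set b \<subseteq> C"
  shows "gridset d C (box_d d a b)"
proof -
  have l: "length a = d" "length b = d" using assms(2) by (auto simp: rect_data_def)
  have C: "a ! i \<in> C" "b ! i \<in> C" if "i < d" for i
    using that set_nthD[OF assms(3)] set_nthD[OF assms(4)] l by simp_all
  show ?thesis unfolding gridset_def
  proof (intro conjI ballI allI impI)
    fix x y assume x: "x \<in> box_d d a b" and e: "ceq C x y"
    show "y \<in> box_d d a b"
    proof -
      have "a ! i \<le> y ! i \<and> y ! i < b ! i" if i: "i < d" for i
      proof -
        have xi: "a ! i \<le> x ! i" "\<not> b ! i \<le> x ! i" using x i by (auto simp: box_d_def)
        show ?thesis using e xi C[OF i] i x by (fastforce simp: ceq_def box_d_def)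
      qed
      thus ?thesis using e x by (auto simp: box_d_def ceq_def)
    qed
  qed (use assms C in \<open>auto simp: box_d_def\<close>)
qed

lemma nx_props:
  assumes "finite C" "c \<in> C" "t < c"
  shows "nx C t \<in> C" "t < nx C t" "nx C t \<le> c" "\<And>c'. c' \<in> C \<Longrightarrow> t < c' \<Longrightarrow> nx C t \<le> c'"
proof -
  have "nx C t \<in> {c \<in> C. t < c}" unfolding nx_def by (rule Min_in) (use assms in auto)
  thus "nx C t \<in> C" "t < nx C t" by auto
  show *: "nx C t \<le> c'" if "c' \<in> C" "t < c'" for c'
    unfolding nx_def by (rule Min_le) (use assms that in auto)
  show "nx C t \<le> c" using * assms by auto
qed

lemma fl_props:
  assumes "finite C" "c \<in> C" "c \<le> t"
  shows "fl C t \<in> C" "fl C t \<le> t" "\<And>c'. c' \<in> C \<Longrightarrow> c' \<le> t \<Longrightarrow> c' \<le> fl C t"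
proof -
  have "fl C t \<in> {c \<in> C. c \<le> t}" unfolding fl_def by (rule Max_in) (use assms in auto)
  thus "fl C t \<in> C" "fl C t \<le> t" by auto
  show *: "c' \<le> fl C t" if "c' \<in> C" "c' \<le> t" for c'
    unfolding fl_def by (rule Max_ge) (use assms that in auto)
qed

lemma finite_pts:
  assumes "gridset d C S" shows "finite (pts C S)"
proof -
  have "pts C S \<subseteq> {p. set p \<subseteq> C \<and> length p = d}"
    using assms by (auto simp: pts_def gridset_def)
  thus ?thesis using finite_lists_length_eq[of C d] gridset_finite[OF assms] finite_subset by blast
qed

lemma pts_nth_nx:
  assumes "gridset d C S" "p \<in> pts C S" "i < d"
  shows "p ! i \<in> C" "nx C (p ! i) \<in> C" "p ! i < nx C (p ! i)"
    "\<And>c. c \<in> C \<Longrightarrow> p ! i < c \<Longrightarrow> nx C (p ! i) \<le> c"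
proof -
  have p: "p \<in> S" "set p \<subseteq> C" "length p = d" using assms by (auto simp: pts_def gridset_def)
  show "p ! i \<in> C" using set_nthD[OF p(2)] p(3) assms(3) by simp
  obtain c where "c \<in> C" "p ! i < c" using gridset_bounds[OF assms(1) p(1) assms(3)] .
  note * = nx_props[OF gridset_finite[OF assms(1)] this]
  show "nx C (p ! i) \<in> C" "p ! i < nx C (p ! i)"
    "\<And>c. c \<in> C \<Longrightarrow> p ! i < c \<Longrightarrow> nx C (p ! i) \<le> c" using * by auto
qed

lemma pts_length: "gridset d C S \<Longrightarrow> p \<in> pts C S \<Longrightarrow> length p = d"
  by (auto simp: pts_def gridset_def)

lemma cell_rect:
  assumes "gridset d C S" "p \<in> pts C S"
  shows "rect_data d p (map (nx C) p)" "set p \<subseteq> C" "set (map (nx C) p) \<subseteq> C"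
  using pts_nth_nx[OF assms] pts_length[OF assms]
  by (auto simp: rect_data_def pts_def set_conv_nth)

lemma cell_ceq:
  assumes "gridset d C S" "p \<in> pts C S"
  shows "cell d C p = {y. ceq C p y}"
proof (intro Set.set_eqI iffI)
  note l = pts_length[OF assms]
  fix y assume y: "y \<in> cell d C p"
  have "c \<le> p ! i \<longleftrightarrow> c \<le> y ! i" if "i < d" "c \<in> C" for i c
    using y that pts_nth_nx(3,4)[OF assms, of i] l
    by (force simp: cell_def box_d_def)
  thus "y \<in> {y. ceq C p y}" using y l by (auto simp: ceq_def cell_def box_d_def)
next
  note l = pts_length[OF assms]
  fix y assume y: "y \<in> {y. ceq C p y}"
  hence y: "length y = d" "\<And>i c. i < d \<Longrightarrow> c \<in> C \<Longrightarrow> c \<le> p ! i \<longleftrightarrow> c \<le> y ! i"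
    using l by (auto simp: ceq_def)
  show "y \<in> cell d C p"
    unfolding cell_def box_d_def
  proof (intro CollectI conjI allI impI)
    fix i assume i: "i < d"
    note n = pts_nth_nx[OF assms i]
    show "p ! i \<le> y ! i" using y(2)[OF i n(1)] by simp
    show "y ! i < map (nx C) p ! i" using y(2)[OF i n(2)] n(3) i l by (simp add: not_le[symmetric])
  qed (use y in simp)
qed

lemma cell_subset:
  assumes "gridset d C S" "p \<in> pts C S"
  shows "cell d C p \<subseteq> S"
  using cell_ceq[OF assms] gridset_ceq[OF assms(1), of p] assms(2) by (auto simp: pts_def)

lemma self_in_cell: "gridset d C S \<Longrightarrow> p \<in> pts C S \<Longrightarrow> p \<in> cell d C p"
  by (simp add: cell_ceq)

lemma cell_eq:
  assumes "gridset d C S" "p \<in> pts C S" "gridset d C S'" "q \<in> pts C S'" "y \<in> cell d C p" "y \<in> cell d C q"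
  shows "p = q"
proof -
  have e: "ceq C p q" using assms cell_ceq[OF assms(1,2)] cell_ceq[OF assms(3,4)] ceq_sym ceq_trans by blast
  show ?thesis
  proof (rule nth_equalityI)
    show "length p = length q" using e by (auto simp: ceq_def)
    fix i assume i: "i < length p"
    have "p ! i \<in> set p" "q ! i \<in> set q" using i e by (auto simp: ceq_def)
    hence C: "p ! i \<in> C" "q ! i \<in> C" using assms(2,4) by (auto simp: pts_def)
    have "\<And>c. c \<in> C \<Longrightarrow> c \<le> p ! i \<longleftrightarrow> c \<le> q ! i" using e i by (auto simp: ceq_def)
    thus "p ! i = q ! i" using C by (intro antisym) auto
  qed
qed

lemma fl_pts:
  assumes "gridset d C S" "x \<in> S"
  shows "map (fl C) x \<in> pts C S" "x \<in> cell d C (map (fl C) x)" "ceq C (map (fl C) x) x"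
proof -
  have l: "length x = d" using assms gridset_len by auto
  have f: "fl C (x ! i) \<in> C \<and> fl C (x ! i) \<le> x ! i \<and> (\<forall>c'\<in>C. c' \<le> x ! i \<longrightarrow> c' \<le> fl C (x ! i))"
    if i: "i < d" for i
  proof -
    obtain c where "c \<in> C" "c \<le> x ! i" using gridset_bounds[OF assms i] .
    from fl_props[OF gridset_finite[OF assms(1)] this] show ?thesis by auto
  qed
  show e: "ceq C (map (fl C) x) x"
    using f l by (force simp: ceq_def)
  have "set (map (fl C) x) \<subseteq> C" using f l by (auto simp: in_set_conv_nth)
  thus p: "map (fl C) x \<in> pts C S"
    using gridset_ceq[OF assms ceq_sym[OF e]] by (auto simp: pts_def)
  show "x \<in> cell d C (map (fl C) x)" using cell_ceq[OF assms(1) p] e by simp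
qed

lemma gridset_cells:
  assumes "gridset d C S" shows "S = (\<Union>p\<in>pts C S. cell d C p)"
proof
  show "S \<subseteq> (\<Union>p\<in>pts C S. cell d C p)" using fl_pts[OF assms] by auto
  show "(\<Union>p\<in>pts C S. cell d C p) \<subseteq> S" using cell_subset[OF assms] by auto
qed

text \<open>Downward induction along the grid points of an interval, from \<open>nx C a\<close> to
  \<open>a\<close>. The equation among the premises of the step splits off the first term of a sum
  over \<open>C \<inter> {a..<b}\<close>.\<close>

lemma grid_induct [consumes 4, case_names base step]:
  assumes "finite C" "b \<in> C" "a \<le> b" "a \<in> C"
  assumes base: "P b"
  assumes step: "\<And>a. a \<in> C \<Longrightarrow> a < b \<Longrightarrow> nx C a \<in> C \<Longrightarrow> a < nx C a \<Longrightarrow> nx C a \<le> b \<Longrightarrow>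
     C \<inter> {a..<b} = insert a (C \<inter> {nx C a..<b}) \<Longrightarrow> P (nx C a) \<Longrightarrow> P a"
  shows "P a"
  using \<open>a \<le> b\<close> \<open>a \<in> C\<close>
proof (induction "card (C \<inter> {a..<b})" arbitrary: a rule: less_induct)
  case less
  show ?case
  proof (cases "a = b")
    case True thus ?thesis using base by simp
  next
    case False
    hence ab: "a < b" using less by simp
    note n = nx_props[OF assms(1,2) ab]
    have e: "C \<inter> {a..<b} = insert a (C \<inter> {nx C a..<b})"
      using n ab less.prems by force
    have "card (C \<inter> {nx C a..<b}) < card (C \<inter> {a..<b})"
      unfolding e using n assms(1) by (subst card_insert_disjoint) auto
    thus ?thesis using less.hyps[of "nx C a"] step[of a] n ab e less.prems by auto
  qed
qed

section \<open>Multiadditive maps\<close>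

text \<open>Subgroups of a type class group. Formal sums are functions into the rationals, so
  relations between them can be handled with \<open>+\<close> and \<open>sum\<close> instead of the
  operations of a group record.\<close>

definition asub :: "'a::ab_group_add set \<Rightarrow> bool" where
  "asub H \<longleftrightarrow> 0 \<in> H \<and> (\<forall>x\<in>H. \<forall>y\<in>H. x - y \<in> H)"

lemma asub_0: "asub H \<Longrightarrow> 0 \<in> H" by (simp add: asub_def)
lemma asub_diff: "asub H \<Longrightarrow> x \<in> H \<Longrightarrow> y \<in> H \<Longrightarrow> x - y \<in> H" by (simp add: asub_def)
lemma asub_uminus: "asub H \<Longrightarrow> x \<in> H \<Longrightarrow> - x \<in> H" using asub_diff[of H 0 x] asub_0 by auto
lemma asub_add: "asub H \<Longrightarrow> x \<in> H \<Longrightarrow> y \<in> H \<Longrightarrow> x + y \<in> H"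
  using asub_diff[of H x "- y"] asub_uminus by auto
lemma asub_sum: "asub H \<Longrightarrow> (\<And>i. i \<in> I \<Longrightarrow> f i \<in> H) \<Longrightarrow> sum f I \<in> H"
  by (induction I rule: infinite_finite_induct) (auto intro: asub_add asub_0)
lemma asub_trans: "asub H \<Longrightarrow> x - y \<in> H \<Longrightarrow> y - z \<in> H \<Longrightarrow> x - z \<in> H"
  using asub_add[of H "x - y" "y - z"] by simp
lemma asub_sym: "asub H \<Longrightarrow> x - y \<in> H \<Longrightarrow> y - x \<in> H"
  using asub_uminus[of H "x - y"] by simp
lemma asub_sum_diff: "asub H \<Longrightarrow> (\<And>i. i \<in> I \<Longrightarrow> f i - g i \<in> H) \<Longrightarrow> sum f I - sum g I \<in> H"
  using asub_sum[of H I "\<lambda>i. f i - g i"] by (simp add: sum_subtractf)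

text \<open>Additivity in each slot only modulo \<open>H\<close>. The choices of \<open>H\<close>
  used below are the tensor relations (formal sums), \<open>{0}\<close> (functionals with rational
  values) and the set of values attained by exchanges (surjectivity).\<close>

definition madd :: "nat \<Rightarrow> 'a::ab_group_add set \<Rightarrow> (real list \<Rightarrow> 'a) \<Rightarrow> bool" where
  "madd k H m \<longleftrightarrow> (\<forall>us vs a b. length us + length vs + 1 = k \<longrightarrow>
     m (us @ [a + b] @ vs) - m (us @ [a] @ vs) - m (us @ [b] @ vs) \<in> H)"

lemma additive_grid:
  fixes g :: "real \<Rightarrow> 'a::ab_group_add"
  assumes H: "asub H" and g: "\<And>x y. g (x + y) - g x - g y \<in> H"
  assumes C: "finite C" "b \<in> C" "a \<le> b" "a \<in> C"
  shows "g (b - a) - (\<Sum>x\<in>C \<inter> {a..<b}. g (gap C x)) \<in> H"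
  using C
proof (induction rule: grid_induct)
  case base
  \<comment> \<open>Additivity at \<open>0 + 0\<close> puts \<open>- g 0\<close> into
    \<open>H\<close>.\<close>
  have "g 0 \<in> H" using asub_uminus[OF H g[of 0 0]] by simp
  thus ?case by simp
next
  case (step a)
  let ?s = "\<Sum>x\<in>C \<inter> {nx C a..<b}. g (gap C x)"
  have "(\<Sum>x\<in>C \<inter> {a..<b}. g (gap C x)) = g (gap C a) + ?s"
    unfolding step(6) by (subst sum.insert) (use step C in auto)
  moreover have A: "g (b - a) - g (b - nx C a) - g (gap C a) \<in> H"
    using g[of "b - nx C a" "gap C a"] by (simp add: gap_def)
  moreover have "(x - y - z) + (y - s) = x - (z + s)" for x y z s :: 'a
    by simp
  ultimately show ?case using asub_add[OF H A step(7)] by (simp only:)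
qed

lemma pts_box_Cons:
  assumes "length as = d" "length bs = d"
  shows "pts C (box_d (Suc d) (a # as) (b # bs)) =
     (\<lambda>(x, p). x # p) ` ((C \<inter> {a..<b}) \<times> pts C (box_d d as bs))"
proof (intro Set.set_eqI iffI)
  fix q assume q: "q \<in> pts C (box_d (Suc d) (a # as) (b # bs))"
  then obtain x p where qq: "q = x # p" by (cases q) (auto simp: pts_def box_d_def)
  have "x \<in> C \<inter> {a..<b}" "p \<in> pts C (box_d d as bs)"
    using q qq by (auto simp: pts_def box_d_def All_less_Suc2)
  thus "q \<in> (\<lambda>(x, p). x # p) ` ((C \<inter> {a..<b}) \<times> pts C (box_d d as bs))" using qq by auto
next
  fix q assume "q \<in> (\<lambda>(x, p). x # p) ` ((C \<inter> {a..<b}) \<times> pts C (box_d d as bs))"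
  thus "q \<in> pts C (box_d (Suc d) (a # as) (b # bs))"
    by (auto simp: pts_def box_d_def less_Suc_eq_0_disj)
qed

text \<open>The axes are split one after the other. The list \<open>us\<close> holds the gaps chosen
  on the axes already split, and the induction runs over the number of remaining axes.\<close>

lemma madd_box_aux:
  fixes m :: "real list \<Rightarrow> 'a::ab_group_add"
  assumes H: "asub H" and C: "finite C"
  shows "madd k H m \<Longrightarrow> length us + d = k \<Longrightarrow> rect_data d a b \<Longrightarrow> set a \<subseteq> C \<Longrightarrow> set b \<subseteq> C \<Longrightarrow>
    m (us @ vdiff b a) - (\<Sum>p\<in>pts C (box_d d a b). m (us @ map (gap C) p)) \<in> H"
proof (induction d arbitrary: us a b)
  case 0
  hence e: "a = []" "b = []" by (auto simp: rect_data_def)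
  have "pts C (box_d 0 [] []) = {[]}" by (auto simp: pts_def box_d_def)
  thus ?case using asub_0[OF H] e by (simp add: vdiff_def)
next
  case (Suc d)
  obtain x as where a: "a = x # as" "length as = d" using Suc.prems by (cases a) (auto simp: rect_data_def)
  obtain y bs where b: "b = y # bs" "length bs = d" using Suc.prems by (cases b) (auto simp: rect_data_def)
  have r: "rect_data d as bs" "x < y" using Suc.prems a b by (auto simp: rect_data_def)
  have v: "vdiff b a = (y - x) # vdiff bs as" using a b by (simp add: vdiff_def)
  have 1: "m (us @ vdiff b a) - (\<Sum>t\<in>C \<inter> {x..<y}. m (us @ gap C t # vdiff bs as)) \<in> H"
    unfolding v
    using additive_grid[OF H _ C, of "\<lambda>t. m (us @ t # vdiff bs as)" y x] Suc.prems a b r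
    by (auto simp: madd_def)
  have 2: "(\<Sum>t\<in>C \<inter> {x..<y}. m (us @ gap C t # vdiff bs as)) -
      (\<Sum>t\<in>C \<inter> {x..<y}. \<Sum>p\<in>pts C (box_d d as bs). m (us @ gap C t # map (gap C) p)) \<in> H"
  proof (rule asub_sum_diff[OF H])
    fix t assume "t \<in> C \<inter> {x..<y}"
    have "m ((us @ [gap C t]) @ vdiff bs as) - (\<Sum>p\<in>pts C (box_d d as bs). m ((us @ [gap C t]) @ map (gap C) p)) \<in> H"
      by (rule Suc.IH) (use Suc.prems a b r in auto)
    thus "m (us @ gap C t # vdiff bs as) - (\<Sum>p\<in>pts C (box_d d as bs). m (us @ gap C t # map (gap C) p)) \<in> H"
      by simp
  qed
  have 3: "(\<Sum>p\<in>pts C (box_d (Suc d) a b). m (us @ map (gap C) p)) =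
     (\<Sum>t\<in>C \<inter> {x..<y}. \<Sum>p\<in>pts C (box_d d as bs). m (us @ gap C t # map (gap C) p))"
    unfolding a(1) b(1) pts_box_Cons[OF a(2) b(2)]
    by (subst sum.reindex) (auto simp: inj_on_def sum.cartesian_product case_prod_unfold)
  show ?case unfolding 3 using asub_trans[OF H 1 2] .
qed

lemma madd_box:
  fixes m :: "real list \<Rightarrow> 'a::ab_group_add"
  assumes "asub H" "finite C" "madd d H m" "rect_data d a b" "set a \<subseteq> C" "set b \<subseteq> C"
  shows "m (vdiff b a) - (\<Sum>p\<in>pts C (box_d d a b). m (map (gap C) p)) \<in> H"
  using madd_box_aux[OF assms(1,2,3), of "[]" d a b] assms by simp

lemma pts_disjoint_Union:
  assumes "finite I" "S = (\<Union>j\<in>I. B j)" "\<And>j j'. j \<in> I \<Longrightarrow> j' \<in> I \<Longrightarrow> j \<noteq> j' \<Longrightarrow> B j \<inter> B j' = {}"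
    "\<And>j. j \<in> I \<Longrightarrow> gridset d C (B j)"
  shows "(\<Sum>p\<in>pts C S. F p) = (\<Sum>j\<in>I. \<Sum>p\<in>pts C (B j). (F p :: 'a::ab_group_add))"
proof -
  have e: "pts C S = (\<Union>j\<in>I. pts C (B j))" using assms(2) by (auto simp: pts_def)
  show ?thesis unfolding e
    using assms(1,3) finite_pts[OF assms(4)]
    by (intro sum.UNION_disjoint) (simp_all, auto simp: pts_def)
qed

text \<open>Both sides are compared with the sum over the grid that contains all coordinates.\<close>
lemma grid_sum_eq_box_sum:
  fixes m :: "'b \<Rightarrow> real list \<Rightarrow> 'a::ab_group_add"
  assumes H: "asub H" and S: "gridset d C S"
    and \<phi>: "\<And>x y. x \<in> S \<Longrightarrow> ceq C x y \<Longrightarrow> \<phi> x = \<phi> y"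
    and m: "\<And>x. x \<in> S \<Longrightarrow> madd d H (m (\<phi> x))"
    and I: "finite I" "\<And>j. j \<in> I \<Longrightarrow> rect_data d (a j) (b j)" "S = (\<Union>j\<in>I. box_d d (a j) (b j))"
      "\<And>j j'. j \<in> I \<Longrightarrow> j' \<in> I \<Longrightarrow> j \<noteq> j' \<Longrightarrow> box_d d (a j) (b j) \<inter> box_d d (a j') (b j') = {}"
    and r: "\<And>j x. j \<in> I \<Longrightarrow> x \<in> box_d d (a j) (b j) \<Longrightarrow> \<phi> x = r j"
  shows "(\<Sum>p\<in>pts C S. m (\<phi> p) (map (gap C) p)) - (\<Sum>j\<in>I. m (r j) (vdiff (b j) (a j))) \<in> H"
proof -
  define C' where "C' = C \<union> (\<Union>j\<in>I. set (a j) \<union> set (b j))"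
  have fC: "finite C'" using S I(1) by (auto simp: C'_def gridset_def)
  have S': "gridset d C' S" by (rule gridset_mono[OF S _ fC]) (auto simp: C'_def)
  let ?F = "\<lambda>p. m (\<phi> p) (map (gap C') p)"
  have ne: "a j \<in> box_d d (a j) (b j)" if "j \<in> I" for j
    using I(2)[OF that] by (auto simp: rect_data_def box_d_def)
  have 1: "(\<Sum>p\<in>pts C' S. ?F p) = (\<Sum>j\<in>I. \<Sum>p\<in>pts C' (box_d d (a j) (b j)). ?F p)"
    by (rule pts_disjoint_Union[OF I(1,3,4), where d = d])
      (auto intro!: gridset_box[OF fC] I(2), auto simp: C'_def)
  have 2: "(\<Sum>j\<in>I. m (r j) (vdiff (b j) (a j))) - (\<Sum>j\<in>I. \<Sum>p\<in>pts C' (box_d d (a j) (b j)). ?F p) \<in> H"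
  proof (rule asub_sum_diff[OF H])
    fix j assume j: "j \<in> I"
    have "m (r j) (vdiff (b j) (a j)) - (\<Sum>p\<in>pts C' (box_d d (a j) (b j)). m (r j) (map (gap C') p)) \<in> H"
      using r[OF j ne[OF j]] m[of "a j"] ne[OF j] j I(3)
      by (intro madd_box[OF H fC _ I(2)[OF j]]) (auto simp: C'_def)
    moreover have "(\<Sum>p\<in>pts C' (box_d d (a j) (b j)). m (r j) (map (gap C') p)) = (\<Sum>p\<in>pts C' (box_d d (a j) (b j)). ?F p)"
      by (rule sum.cong) (use r[OF j] in \<open>auto simp: pts_def\<close>)
    ultimately show "m (r j) (vdiff (b j) (a j)) - (\<Sum>p\<in>pts C' (box_d d (a j) (b j)). ?F p) \<in> H" by simp
  qed
  have g: "gridset d C' (cell d C p)" if "p \<in> pts C S" for p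
    unfolding cell_def using cell_rect[OF S that] by (intro gridset_box fC) (auto simp: C'_def)
  have 3: "(\<Sum>p\<in>pts C' S. ?F p) = (\<Sum>q\<in>pts C S. \<Sum>p\<in>pts C' (cell d C q). ?F p)"
    by (rule pts_disjoint_Union[OF finite_pts[OF S] gridset_cells[OF S] _ g])
       (use cell_eq[OF S _ S] in blast)+
  have 4: "(\<Sum>q\<in>pts C S. m (\<phi> q) (map (gap C) q)) - (\<Sum>q\<in>pts C S. \<Sum>p\<in>pts C' (cell d C q). ?F p) \<in> H"
  proof (rule asub_sum_diff[OF H])
    fix q assume q: "q \<in> pts C S"
    have v: "vdiff (map (nx C) q) q = map (gap C) q"
      by (rule nth_equalityI) (auto simp: gap_def)
    have "m (\<phi> q) (vdiff (map (nx C) q) q) - (\<Sum>p\<in>pts C' (cell d C q). m (\<phi> q) (map (gap C') p)) \<in> H"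
      unfolding cell_def using q cell_rect[OF S q] m[of q]
      by (intro madd_box[OF H fC]) (auto simp: C'_def pts_def)
    moreover have "(\<Sum>p\<in>pts C' (cell d C q). m (\<phi> q) (map (gap C') p)) = (\<Sum>p\<in>pts C' (cell d C q). ?F p)"
      by (rule sum.cong) (use \<phi>[of q] q cell_ceq[OF S q] in \<open>auto simp: pts_def\<close>)
    ultimately show "m (\<phi> q) (map (gap C) q) - (\<Sum>p\<in>pts C' (cell d C q). ?F p) \<in> H" using v by simp
  qed
  show ?thesis using asub_trans[OF H 4] asub_sym[OF H 2] 1 3 by (metis (no_types, lifting))
qed

section \<open>Tensor powers\<close>

text \<open>The form by position is the one that combines well with a permutation of the slots such
  as \<open>swap_fac\<close>.\<close>

lemma madd_upd:
  "madd k H m \<longleftrightarrow> (\<forall>xs j a b. length xs = k \<longrightarrow> j < k \<longrightarrow>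
     m (xs[j := a + b]) - m (xs[j := a]) - m (xs[j := b]) \<in> H)"
proof safe
  fix xs :: "real list" and j a b assume m: "madd (length xs) H m" and j: "j < length xs"
  have "xs[j := t] = take j xs @ [t] @ drop (Suc j) xs" for t using upd_conv_take_nth_drop[OF j] by simp
  thus "m (xs[j := a + b]) - m (xs[j := a]) - m (xs[j := b]) \<in> H"
    using m j by (simp add: madd_def)
next
  assume *: "\<forall>xs j a b. length xs = k \<longrightarrow> j < k \<longrightarrow>
     m (xs[j := a + b]) - m (xs[j := a]) - m (xs[j := b]) \<in> H"
  show "madd k H m" unfolding madd_def
  proof (intro allI impI)
    fix us vs :: "real list" and a b assume "length us + length vs + 1 = k"
    thus "m (us @ [a + b] @ vs) - m (us @ [a] @ vs) - m (us @ [b] @ vs) \<in> H"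
      using *[rule_format, of "us @ [0] @ vs" "length us" a b] by simp
  qed
qed

lemma madd_updD:
  "madd k H m \<Longrightarrow> length xs = k \<Longrightarrow> j < k \<Longrightarrow> m (xs[j := a + b]) - m (xs[j := a]) - m (xs[j := b]) \<in> H"
  by (simp add: madd_upd)

lemma swap_fac_length [simp]: "length (swap_fac d i ts) = length ts"
  by (simp add: swap_fac_def)

lemma swap_fac_upd:
  assumes "i < d" "j < d" "length xs = d"
  shows "swap_fac d i (xs[j := a]) = (swap_fac d i xs)[(if j = i then d - 1 else if j = d - 1 then i else j) := a]"
  by (rule nth_equalityI) (use assms in \<open>auto simp: swap_fac_def nth_list_update\<close>)

lemma swap_fac_swap_fac [simp]:
  assumes "i < d" "length xs = d"
  shows "swap_fac d i (swap_fac d i xs) = xs"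
  by (rule nth_equalityI) (use assms in \<open>auto simp: swap_fac_def nth_list_update\<close>)

lemma madd_swap_fac:
  assumes "madd d H m" "i < d"
  shows "madd d H (\<lambda>ts. m (swap_fac d i ts))"
  unfolding madd_upd using assms by (auto simp: swap_fac_upd intro!: madd_updD)

lemma madd_suffix:
  assumes "madd (k + length rs) H m"
  shows "madd k H (\<lambda>ts. m (ts @ rs))"
  unfolding madd_def
proof (intro allI impI)
  fix us vs :: "real list" and a b assume "length us + length vs + 1 = k"
  thus "m ((us @ [a + b] @ vs) @ rs) - m ((us @ [a] @ vs) @ rs) - m ((us @ [b] @ vs) @ rs) \<in> H"
    using assms[unfolded madd_def, rule_format, of us "vs @ rs" a b] by simp
qed

section \<open>The free rational module on lists and its relations\<close>

lemma FreeQ_simps [simp]: "u \<otimes>\<^bsub>FreeQ k\<^esub> v = u + v" "\<one>\<^bsub>FreeQ k\<^esub> = 0"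
  by (auto simp: FreeQ_def plus_fun_def zero_fun_def)

lemma FreeQ_mem: "u \<in> carrier (FreeQ k) \<longleftrightarrow> finite {ts. u ts \<noteq> 0} \<and> (\<forall>ts. u ts \<noteq> 0 \<longrightarrow> length ts = k)"
  by (simp add: FreeQ_def)

lemma FreeQ_asub: "asub (carrier (FreeQ k))"
  unfolding asub_def
proof (intro conjI ballI)
  show "0 \<in> carrier (FreeQ k)" by (simp add: FreeQ_mem)
  fix u v assume u: "u \<in> carrier (FreeQ k)" and v: "v \<in> carrier (FreeQ k)"
  have "{ts. (u - v) ts \<noteq> 0} \<subseteq> {ts. u ts \<noteq> 0} \<union> {ts. v ts \<noteq> 0}" by auto
  moreover have "(u - v) ts \<noteq> 0 \<Longrightarrow> length ts = k" for ts using u v by (cases "u ts = 0") (auto simp: FreeQ_mem)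
  ultimately show "u - v \<in> carrier (FreeQ k)" using u v
    unfolding FreeQ_mem by (meson finite_UnI finite_subset)
qed

lemma FreeQ_comm_group: "comm_group (FreeQ k)"
proof (rule comm_groupI, unfold FreeQ_simps)
  fix x assume "x \<in> carrier (FreeQ k)"
  thus "\<exists>y\<in>carrier (FreeQ k). y + x = 0" using asub_uminus[OF FreeQ_asub] by (intro bexI[of _ "-x"]) auto
qed (auto intro: asub_add[OF FreeQ_asub] asub_0[OF FreeQ_asub] simp: add.assoc add.commute)

lemma FreeQ_inv [simp]: "u \<in> carrier (FreeQ k) \<Longrightarrow> inv\<^bsub>FreeQ k\<^esub> u = - u"
proof -
  interpret comm_group "FreeQ k" by (rule FreeQ_comm_group)
  assume "u \<in> carrier (FreeQ k)"
  thus ?thesis using asub_uminus[OF FreeQ_asub] by (intro inv_equality) auto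
qed

lemma delta_carrier [simp]: "length ts = k \<Longrightarrow> delta ts \<in> carrier (FreeQ k)"
  by (auto simp: FreeQ_mem delta_def)

lemma scale_carrier: "u \<in> carrier (FreeQ k) \<Longrightarrow> (\<lambda>s. c * u s) \<in> carrier (FreeQ k)"
  unfolding FreeQ_mem by (auto elim: rev_finite_subset)

lemma tensor_gens_eq: "tensor_gens k = {(\<lambda>s. c * (delta (us @ [a + b] @ vs) - delta (us @ [a] @ vs) - delta (us @ [b] @ vs)) s)
    | c us vs a b. length us + length vs + 1 = k}"
  by (simp add: tensor_gens_def)

lemma tensor_gens_carrier: "tensor_gens k \<subseteq> carrier (FreeQ k)"
proof
  fix h assume "h \<in> tensor_gens k"
  then obtain c us vs a b where "h = (\<lambda>s. c * (delta (us @ [a + b] @ vs) - delta (us @ [a] @ vs) - delta (us @ [b] @ vs)) s)"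
      and l: "length us + length vs + 1 = k" unfolding tensor_gens_eq by blast
  moreover have "delta (us @ [a + b] @ vs) - delta (us @ [a] @ vs) - delta (us @ [b] @ vs) \<in> carrier (FreeQ k)"
    using l by (intro asub_diff[OF FreeQ_asub] delta_carrier) auto
  ultimately show "h \<in> carrier (FreeQ k)" using scale_carrier by blast
qed

lemma tensor_rel_subgroup: "subgroup (tensor_rel k) (FreeQ k)"
proof -
  interpret comm_group "FreeQ k" by (rule FreeQ_comm_group)
  show ?thesis unfolding tensor_rel_def by (rule generate_is_subgroup[OF tensor_gens_carrier])
qed

lemma tensor_rel_carrier: "u \<in> tensor_rel k \<Longrightarrow> u \<in> carrier (FreeQ k)"
  using subgroup.subset[OF tensor_rel_subgroup] by auto

lemma tensor_rel_asub: "asub (tensor_rel k)"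
  unfolding asub_def
proof (intro conjI ballI)
  show "0 \<in> tensor_rel k" using subgroup.one_closed[OF tensor_rel_subgroup] by simp
  fix x y assume x: "x \<in> tensor_rel k" and y: "y \<in> tensor_rel k"
  have "- y \<in> tensor_rel k" using subgroup.m_inv_closed[OF tensor_rel_subgroup y] tensor_rel_carrier[OF y] by simp
  from subgroup.m_closed[OF tensor_rel_subgroup x this] show "x - y \<in> tensor_rel k" by simp
qed

lemma madd_delta: "madd k (tensor_rel k) delta"
  unfolding madd_def
proof (intro allI impI)
  fix us vs :: "real list" and a b :: real assume "length us + length vs + 1 = k"
  hence "(\<lambda>s. 1 * (delta (us @ [a + b] @ vs) s - delta (us @ [a] @ vs) s - delta (us @ [b] @ vs) s)) \<in> tensor_gens k"
    unfolding tensor_gens_def by blast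
  hence "(\<lambda>s. 1 * (delta (us @ [a + b] @ vs) s - delta (us @ [a] @ vs) s - delta (us @ [b] @ vs) s)) \<in> tensor_rel k"
    unfolding tensor_rel_def by (rule generate.incl)
  moreover have "(\<lambda>s. 1 * (delta (us @ [a + b] @ vs) s - delta (us @ [a] @ vs) s - delta (us @ [b] @ vs) s)) =
     delta (us @ [a + b] @ vs) - delta (us @ [a] @ vs) - delta (us @ [b] @ vs)" by auto
  ultimately show "delta (us @ [a + b] @ vs) - delta (us @ [a] @ vs) - delta (us @ [b] @ vs) \<in> tensor_rel k" by simp
qed

text \<open>Tensors are always handled through a representing formal sum, so that an equation in
  \<open>TP k\<close> becomes membership of a difference in \<open>tensor_rel k\<close>.\<close>

definition cl :: "nat \<Rightarrow> (real list \<Rightarrow> rat) \<Rightarrow> (real list \<Rightarrow> rat) set" where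
  "cl k u = tensor_rel k #>\<^bsub>FreeQ k\<^esub> u"

lemma cl_mem: "v \<in> cl k u \<longleftrightarrow> v - u \<in> tensor_rel k"
proof
  assume "v \<in> cl k u"
  thus "v - u \<in> tensor_rel k" by (auto simp: cl_def r_coset_def)
next
  assume "v - u \<in> tensor_rel k"
  moreover have "v = (v - u) + u" by simp
  ultimately show "v \<in> cl k u" unfolding cl_def r_coset_def FreeQ_simps by blast
qed

lemma cl_eq_iff: "cl k u = cl k v \<longleftrightarrow> u - v \<in> tensor_rel k"
proof
  assume "cl k u = cl k v"
  moreover have "u \<in> cl k u" using asub_0[OF tensor_rel_asub] by (simp add: cl_mem)
  ultimately show "u - v \<in> tensor_rel k" using cl_mem by blast
next
  assume uv: "u - v \<in> tensor_rel k"
  show "cl k u = cl k v"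
    using asub_trans[OF tensor_rel_asub _ uv] asub_trans[OF tensor_rel_asub _ asub_sym[OF tensor_rel_asub uv]]
    by (auto simp: cl_mem)
qed

lemma TP_normal: "tensor_rel k \<lhd> FreeQ k"
  using comm_group.normal_iff_subgroup[OF FreeQ_comm_group] tensor_rel_subgroup by blast

lemma TP_comm_group: "comm_group (TP k)"
  unfolding TP_def by (rule comm_group.abelian_FactGroup[OF FreeQ_comm_group tensor_rel_subgroup])

lemma TP_carrier: "carrier (TP k) = cl k ` carrier (FreeQ k)"
  by (auto simp: TP_def FactGroup_def RCOSETS_def cl_def)

lemma cl_carrier [simp]: "u \<in> carrier (FreeQ k) \<Longrightarrow> cl k u \<in> carrier (TP k)"
  by (simp add: TP_carrier)

lemma cl_mult: "u \<in> carrier (FreeQ k) \<Longrightarrow> v \<in> carrier (FreeQ k) \<Longrightarrow> cl k u \<otimes>\<^bsub>TP k\<^esub> cl k v = cl k (u + v)"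
  using normal.rcos_sum[OF TP_normal] by (simp add: TP_def cl_def)

lemma cl_one: "\<one>\<^bsub>TP k\<^esub> = cl k 0"
proof -
  have "\<one>\<^bsub>TP k\<^esub> = tensor_rel k" by (simp add: TP_def FactGroup_def)
  also have "\<dots> = cl k 0" by (auto simp: cl_mem)
  finally show ?thesis .
qed

lemma cl_inv:
  assumes "u \<in> carrier (FreeQ k)" shows "inv\<^bsub>TP k\<^esub> cl k u = cl k (- u)"
proof -
  interpret comm_group "TP k" by (rule TP_comm_group)
  show ?thesis using assms asub_uminus[OF FreeQ_asub assms] by (intro inv_equality) (auto simp: cl_mult cl_one)
qed

lemma cl_finprod:
  assumes "\<And>j. j \<in> I \<Longrightarrow> u j \<in> carrier (FreeQ k)"
  shows "finprod (TP k) (\<lambda>j. cl k (u j)) I = cl k (sum u I)"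
proof -
  interpret comm_group "TP k" by (rule TP_comm_group)
  show ?thesis using assms
  proof (induction I rule: infinite_finite_induct)
    case (insert x F)
    have "sum u F \<in> carrier (FreeQ k)" using insert by (intro asub_sum[OF FreeQ_asub]) auto
    thus ?case using insert by (subst finprod_insert) (auto simp: cl_mult Pi_def)
  qed (auto simp: cl_one)
qed

section \<open>Pure tensors and appending a factor\<close>

lemma ptensor_cl: "length ts = k \<Longrightarrow> ptensor ts = cl k (delta ts)"
  by (auto simp: ptensor_def cl_def)

lemma ext_right_diff: "ext_right r (u - v) = ext_right r u - ext_right r v"
  by (auto simp: ext_right_def)

lemma ext_right_add: "ext_right r (u + v) = ext_right r u + ext_right r v"
  by (auto simp: ext_right_def)

lemma ext_right_uminus: "ext_right r (- u) = - ext_right r u"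
  by (auto simp: ext_right_def)

lemma ext_right_sum: "ext_right r (sum f I) = (\<Sum>i\<in>I. ext_right r (f i))"
proof -
  have "ext_right r 0 = 0" by (auto simp: ext_right_def)
  thus ?thesis by (induction I rule: infinite_finite_induct) (auto simp: ext_right_add)
qed

lemma ext_right_delta: "ext_right r (delta ts) = delta (ts @ [r])"
proof
  fix s show "ext_right r (delta ts) s = delta (ts @ [r]) s"
    by (cases s rule: rev_cases) (auto simp: ext_right_def delta_def)
qed

text \<open>Appending a factor respects the relations; hence \<open>tensor_right\<close> does not
  depend on the representative.\<close>

lemma ext_right_rel:
  assumes "u \<in> tensor_rel k" shows "ext_right r u \<in> tensor_rel (Suc k)"
  using assms unfolding tensor_rel_def[of k]
proof (induction u rule: generate.induct)
  case one
  have "ext_right r 0 = 0" by (auto simp: ext_right_def)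
  thus ?case unfolding FreeQ_simps using asub_0[OF tensor_rel_asub] by metis
next
  case (incl h)
  have *: "ext_right r h \<in> tensor_rel (Suc k)" if "h \<in> tensor_gens k" for h
  proof -
    obtain c us vs a b where h: "h = (\<lambda>s. c * (delta (us @ [a + b] @ vs) s - delta (us @ [a] @ vs) s - delta (us @ [b] @ vs) s))"
      "length us + length vs + 1 = k" using \<open>h \<in> tensor_gens k\<close> unfolding tensor_gens_def by blast
    have "ext_right r h = (\<lambda>s. c * (ext_right r (delta (us @ [a + b] @ vs)) s - ext_right r (delta (us @ [a] @ vs)) s - ext_right r (delta (us @ [b] @ vs)) s))"
      unfolding h by (auto simp: ext_right_def)
    also have "\<dots> \<in> tensor_gens (Suc k)"
      unfolding ext_right_delta tensor_gens_def using h(2)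
      by (intro CollectI exI[of _ c] exI[of _ us] exI[of _ "vs @ [r]"] exI[of _ a] exI[of _ b]) simp
    finally show ?thesis unfolding tensor_rel_def by (rule generate.incl)
  qed
  show ?case by (rule *[OF incl])
  case (inv h)
  have "h \<in> carrier (FreeQ k)" using inv tensor_gens_carrier by auto
  show ?case unfolding FreeQ_inv[OF \<open>h \<in> carrier (FreeQ k)\<close>] ext_right_uminus
    by (rule asub_uminus[OF tensor_rel_asub *[OF inv]])
next
  case (eng h1 h2)
  thus ?case unfolding FreeQ_simps ext_right_add using asub_add[OF tensor_rel_asub] by blast
qed

lemma tensor_right_cl: "tensor_right k (cl k u) r = cl (Suc k) (ext_right r u)"
proof -
  have "tensor_right k (cl k u) r = (\<Union>v\<in>cl k u. cl (Suc k) (ext_right r v))"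
    by (simp add: tensor_right_def cl_def)
  also have "\<dots> = (\<Union>v\<in>cl k u. cl (Suc k) (ext_right r u))"
    by (intro SUP_cong refl) (simp add: cl_eq_iff flip: ext_right_diff, intro ext_right_rel, simp add: cl_mem)
  also have "\<dots> = cl (Suc k) (ext_right r u)"
    using asub_0[OF tensor_rel_asub] cl_mem[of u k u] by auto
  finally show ?thesis .
qed

text \<open>The linear extension of \<open>\<Phi>\<close> from lists to formal sums. It descends to
  the tensor power when \<open>\<Phi>\<close> is multiadditive, since it then kills the generating
  relations.\<close>

definition eval_functional :: "(real list \<Rightarrow> rat) \<Rightarrow> (real list \<Rightarrow> rat) \<Rightarrow> rat" where
  "eval_functional \<Phi> u = (\<Sum>ts | u ts \<noteq> 0. u ts * \<Phi> ts)"

lemma eval_functional_superset: "finite A \<Longrightarrow> {ts. u ts \<noteq> 0} \<subseteq> A \<Longrightarrow> eval_functional \<Phi> u = (\<Sum>ts\<in>A. u ts * \<Phi> ts)"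
  unfolding eval_functional_def by (rule sum.mono_neutral_left) auto

lemma eval_functional_add:
  assumes "u \<in> carrier (FreeQ k)" "v \<in> carrier (FreeQ k)"
  shows "eval_functional \<Phi> (u + v) = eval_functional \<Phi> u + eval_functional \<Phi> v"
proof -
  let ?A = "{ts. u ts \<noteq> 0} \<union> {ts. v ts \<noteq> 0}"
  have A: "finite ?A" using assms by (auto simp: FreeQ_mem)
  show ?thesis
    by (subst (1 2 3) eval_functional_superset[OF A]) (auto simp: sum.distrib distrib_right)
qed

lemma eval_functional_uminus: "eval_functional \<Phi> (- u) = - eval_functional \<Phi> u"
  by (simp add: eval_functional_def sum_negf)

lemma eval_functional_diff:
  assumes "u \<in> carrier (FreeQ k)" "v \<in> carrier (FreeQ k)"
  shows "eval_functional \<Phi> (u - v) = eval_functional \<Phi> u - eval_functional \<Phi> v"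
  using eval_functional_add[OF assms(1) asub_uminus[OF FreeQ_asub assms(2)]] by (simp add: eval_functional_uminus)

lemma eval_functional_delta [simp]: "eval_functional \<Phi> (delta ts) = \<Phi> ts"
proof -
  have "{s. delta ts s \<noteq> 0} = {ts}" by (auto simp: delta_def)
  thus ?thesis by (simp add: eval_functional_def delta_def)
qed

lemma eval_functional_scale: "eval_functional \<Phi> (\<lambda>s. c * u s) = c * eval_functional \<Phi> u"
  by (cases "c = 0") (auto simp: eval_functional_def sum_distrib_left mult.assoc)

lemma eval_functional_rel:
  assumes "madd k {0} \<Phi>" "u \<in> tensor_rel k" shows "eval_functional \<Phi> u = 0"
  using assms(2) tensor_gens_carrier[of k] unfolding tensor_rel_def
proof (induction u rule: generate.induct)
  case one show ?case by (simp add: eval_functional_def)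
next
  case (incl h)
  have *: "eval_functional \<Phi> h = 0" if "h \<in> tensor_gens k" for h
  proof -
    obtain c us vs a b where h: "h = (\<lambda>s. c * (delta (us @ [a + b] @ vs) - delta (us @ [a] @ vs) - delta (us @ [b] @ vs)) s)"
      and l: "length us + length vs + 1 = k" using \<open>h \<in> tensor_gens k\<close> unfolding tensor_gens_eq by blast
    have "eval_functional \<Phi> (delta (us @ [a + b] @ vs) - delta (us @ [a] @ vs) - delta (us @ [b] @ vs)) =
       \<Phi> (us @ [a + b] @ vs) - \<Phi> (us @ [a] @ vs) - \<Phi> (us @ [b] @ vs)"
      using l eval_functional_diff[of "delta (us @ [a + b] @ vs) - delta (us @ [a] @ vs)" k "delta (us @ [b] @ vs)" \<Phi>]
        eval_functional_diff[of "delta (us @ [a + b] @ vs)" k "delta (us @ [a] @ vs)" \<Phi>]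
        asub_diff[OF FreeQ_asub, of "delta (us @ [a + b] @ vs)" k "delta (us @ [a] @ vs)"] by simp
    also have "\<dots> = 0" using assms(1) l by (simp add: madd_def)
    finally show ?thesis unfolding h by (subst eval_functional_scale) simp
  qed
  show ?case by (rule *) fact
  case (inv h)
  have "h \<in> carrier (FreeQ k)" using inv tensor_gens_carrier by auto
  thus ?case unfolding FreeQ_inv[OF \<open>h \<in> carrier (FreeQ k)\<close>] eval_functional_uminus using *[of h] inv by simp
next
  case (eng h1 h2)
  have "h1 \<in> carrier (FreeQ k)" "h2 \<in> carrier (FreeQ k)"
    using eng(1,2) tensor_rel_carrier by (auto simp: tensor_rel_def)
  have "eval_functional \<Phi> h1 = 0" "eval_functional \<Phi> h2 = 0" using eng(3,4,5) by blast+
  with eval_functional_add[OF \<open>h1 \<in> carrier (FreeQ k)\<close> \<open>h2 \<in> carrier (FreeQ k)\<close>] show ?case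
    unfolding FreeQ_simps by (simp only: add_0)
qed

lemma eval_functional_cl: "madd k {0} \<Phi> \<Longrightarrow> u \<in> carrier (FreeQ k) \<Longrightarrow> v \<in> carrier (FreeQ k) \<Longrightarrow> cl k u = cl k v \<Longrightarrow> eval_functional \<Phi> u = eval_functional \<Phi> v"
  using eval_functional_rel[of k \<Phi> "u - v"] by (simp add: cl_eq_iff eval_functional_diff)

section \<open>The tensor volume\<close>

text \<open>Evaluates the definite description. Uniqueness comes from comparing an arbitrary
  partition with the grid. For existence the cells themselves are used, enumerated by natural
  numbers because the definition indexes partitions that way.\<close>

lemma tvol_i_grid:
  assumes S: "gridset d C S" and i: "i < d"
  shows "tvol_i d i S = cl d (\<Sum>p\<in>pts C S. delta (swap_fac d i (map (gap C) p)))"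
  unfolding tvol_i_def tvol_gen_def
proof (rule the_equality)
  let ?u = "\<Sum>p\<in>pts C S. delta (swap_fac d i (map (gap C) p))"
  \<comment> \<open>No displacement is involved here, so the data attached to a cell is of type
    unit.\<close>
  let ?m = "\<lambda>(_::unit) ts. delta (swap_fac d i ts)"
  let ?ex = "\<lambda>t. \<exists>(I :: nat set) a b. finite I \<and> (\<forall>j\<in>I. rect_data d (a j) (b j)) \<and>
      S = (\<Union>j\<in>I. box_d d (a j) (b j)) \<and>
      (\<forall>j\<in>I. \<forall>j'\<in>I. j \<noteq> j' \<longrightarrow> box_d d (a j) (b j) \<inter> box_d d (a j') (b j') = {}) \<and>
      t = finprod (TP d) (\<lambda>j. ptensor (swap_fac d i (vdiff (b j) (a j)))) I"
  have fin: "finprod (TP d) (\<lambda>j. ptensor (swap_fac d i (vdiff (b j) (a j)))) I =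
      cl d (\<Sum>j\<in>I. delta (swap_fac d i (vdiff (b j) (a j))))"
    if "\<forall>j\<in>I. rect_data d (a j) (b j)" for I :: "nat set" and a b
  proof -
    interpret comm_group "TP d" by (rule TP_comm_group)
    have "finprod (TP d) (\<lambda>j. ptensor (swap_fac d i (vdiff (b j) (a j)))) I =
      finprod (TP d) (\<lambda>j. cl d (delta (swap_fac d i (vdiff (b j) (a j))))) I"
      using that by (intro finprod_cong) (auto simp: ptensor_cl simp_implies_def rect_data_def)
    also have "\<dots> = cl d (\<Sum>j\<in>I. delta (swap_fac d i (vdiff (b j) (a j))))"
      by (rule cl_finprod) (use that in \<open>auto simp: rect_data_def\<close>)
    finally show ?thesis .
  qed
  have eq: "cl d ?u = cl d (\<Sum>j\<in>I. delta (swap_fac d i (vdiff (b j) (a j))))"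
    if "finite I" "\<forall>j\<in>I. rect_data d (a j) (b j)" "S = (\<Union>j\<in>I. box_d d (a j) (b j))"
      "\<forall>j\<in>I. \<forall>j'\<in>I. j \<noteq> j' \<longrightarrow> box_d d (a j) (b j) \<inter> box_d d (a j') (b j') = {}" for I :: "nat set" and a b
    unfolding cl_eq_iff
    by (rule grid_sum_eq_box_sum[OF tensor_rel_asub S, where m = ?m and \<phi> = "\<lambda>_. ()" and r = "\<lambda>_. ()"])
       (use that i in \<open>auto intro!: madd_swap_fac madd_delta\<close>)
  {
    obtain e where e: "bij_betw e {..<card (pts C S)} (pts C S)"
      using ex_bij_betw_nat_finite[OF finite_pts[OF S]] by (auto simp: atLeast0LessThan)
    let ?I = "{..<card (pts C S)}"
    have eI: "e j \<in> pts C S" if "j \<in> ?I" for j using e that by (auto simp: bij_betw_def)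
    have r: "\<forall>j\<in>?I. rect_data d (e j) (map (nx C) (e j))" using cell_rect[OF S eI] by blast
    have img: "e ` ?I = pts C S" using e by (simp add: bij_betw_def)
    have "(\<Union>j\<in>?I. box_d d (e j) (map (nx C) (e j))) = (\<Union>p\<in>e ` ?I. cell d C p)" by (simp add: cell_def)
    also have "\<dots> = S" unfolding img using gridset_cells[OF S, symmetric] .
    finally have U: "S = (\<Union>j\<in>?I. box_d d (e j) (map (nx C) (e j)))" by (rule sym)
    have D: "\<forall>j\<in>?I. \<forall>j'\<in>?I. j \<noteq> j' \<longrightarrow> box_d d (e j) (map (nx C) (e j)) \<inter> box_d d (e j') (map (nx C) (e j')) = {}"
    proof (intro ballI impI)
      fix j j' assume j: "j \<in> ?I" "j' \<in> ?I" "j \<noteq> j'"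
      hence "e j \<noteq> e j'" using e by (auto simp: bij_betw_def inj_on_def)
      thus "box_d d (e j) (map (nx C) (e j)) \<inter> box_d d (e j') (map (nx C) (e j')) = {}"
        using cell_eq[OF S eI[OF j(1)] S eI[OF j(2)]] unfolding cell_def by blast
    qed
    show "?ex (cl d ?u)"
      by (intro exI[of _ ?I] exI[of _ e] exI[of _ "\<lambda>j. map (nx C) (e j)"] conjI r U D)
        (simp, subst fin[OF r], rule eq[OF _ r U D], simp)
  }
  fix t assume "?ex t"
  then obtain I :: "nat set" and a b where *: "finite I" "\<forall>j\<in>I. rect_data d (a j) (b j)"
      "S = (\<Union>j\<in>I. box_d d (a j) (b j))"
      "\<forall>j\<in>I. \<forall>j'\<in>I. j \<noteq> j' \<longrightarrow> box_d d (a j) (b j) \<inter> box_d d (a j') (b j') = {}"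
      "t = finprod (TP d) (\<lambda>j. ptensor (swap_fac d i (vdiff (b j) (a j)))) I" by blast
  show "t = cl d ?u" using eq[OF *(1-4)] fin[OF *(2)] *(5) by simp
qed

text \<open>A formal sum representing \<open>T_comp\<close>, organised by cells instead of by
  displacements.\<close>

definition Tsum :: "nat \<Rightarrow> real set \<Rightarrow> real list set \<Rightarrow> (real list \<Rightarrow> real list) \<Rightarrow> nat \<Rightarrow> (real list \<Rightarrow> rat)" where
  "Tsum d C M f i = (\<Sum>p\<in>pts C M. delta (swap_fac d i (map (gap C) p) @ [disp f p ! i]))"

lemma Tsum_carrier: "gridset d C M \<Longrightarrow> Tsum d C M f i \<in> carrier (FreeQ (Suc d))"
  unfolding Tsum_def by (intro asub_sum[OF FreeQ_asub] delta_carrier) (auto dest: pts_length)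

text \<open>Each level set of \<open>disp f\<close> is itself a gridset for \<open>C\<close>, so its
  tensor volume is a sum over its cells; collecting the level sets gives the sum over all cells of
  \<open>M\<close>.\<close>

lemma T_comp_grid:
  assumes M: "gridset d C M" and i: "i < d"
    and f: "\<And>x y. x \<in> M \<Longrightarrow> ceq C x y \<Longrightarrow> disp f x = disp f y"
  shows "T_comp d M f i = cl (Suc d) (Tsum d C M f i)"
proof -
  interpret comm_group "TP (Suc d)" by (rule TP_comm_group)
  let ?S = "\<lambda>x. {y \<in> M. disp f y = x}"
  let ?u = "\<lambda>x. \<Sum>p\<in>pts C (?S x). delta (swap_fac d i (map (gap C) p) @ [x ! i])"
  have S: "gridset d C (?S x)" for x
    unfolding gridset_def
  proof (intro conjI ballI allI impI gridset_finite[OF M])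
    fix y assume y: "y \<in> ?S x"
    show "length y = d" using gridset_len[OF M] y by simp
    show "z \<in> ?S x" if "ceq C y z" for z using gridset_ceq[OF M _ that] f[OF _ that] y by auto
    fix j assume "j < d"
    with gridset_bounds[OF M, of y j] y show "\<exists>c\<in>C. c \<le> y ! j" "\<exists>c\<in>C. y ! j < c" by blast+
  qed
  have c: "?u x \<in> carrier (FreeQ (Suc d))" for x
    by (intro asub_sum[OF FreeQ_asub] delta_carrier) (auto dest: pts_length[OF S])
  have t: "tensor_right d (tvol_i d i (?S x)) (x ! i) = cl (Suc d) (?u x)" for x
    unfolding tvol_i_grid[OF S i] tensor_right_cl ext_right_sum ext_right_delta ..
  have "T_comp d M f i = finprod (TP (Suc d)) (\<lambda>x. cl (Suc d) (?u x)) (disp f ` M)"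
    unfolding T_comp_def t ..
  also have "\<dots> = cl (Suc d) (sum ?u (disp f ` M))" by (rule cl_finprod[OF c])
  also have "sum ?u (disp f ` M) = Tsum d C M f i"
  proof -
    have img: "disp f ` M = disp f ` pts C M"
    proof
      show "disp f ` M \<subseteq> disp f ` pts C M"
        using f fl_pts[OF M] ceq_sym by (smt (verit) image_iff subsetI)
    qed (auto simp: pts_def)
    have "sum ?u (disp f ` M) = (\<Sum>x\<in>disp f ` pts C M. \<Sum>p\<in>{p \<in> pts C M. disp f p = x}. delta (swap_fac d i (map (gap C) p) @ [disp f p ! i]))"
      unfolding img by (intro sum.cong) (auto simp: pts_def)
    also have "\<dots> = Tsum d C M f i" unfolding Tsum_def
      by (rule sum.image_gen[symmetric, OF finite_pts[OF M]])
    finally show ?thesis .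
  qed
  finally show ?thesis .
qed

section \<open>Rectangle exchanges\<close>

lemma ceq_nth: "ceq C x y \<Longrightarrow> c \<in> C \<Longrightarrow> i < length x \<Longrightarrow> c \<le> x ! i \<longleftrightarrow> c \<le> y ! i"
  by (auto simp: ceq_def)

lemma ceq_length: "ceq C x y \<Longrightarrow> length x = length y"
  by (simp add: ceq_def)

lemma asub_split: "asub H \<Longrightarrow> x = s + t \<Longrightarrow> t \<in> H \<Longrightarrow> s - c \<in> H \<Longrightarrow> x - c \<in> H"
  using asub_add[of H t "s - c"] by (simp add: algebra_simps)

text \<open>Comparing \<open>x ! i + v ! i\<close> with \<open>c\<close> amounts to comparing
  \<open>x ! i\<close> with \<open>c - v ! i\<close>, so the finer grid has to contain the shifted
  coordinates.\<close>

lemma ceq_vadd: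
  assumes "ceq C' x y" "length x = d" "length v = d" "\<And>c i. c \<in> C \<Longrightarrow> i < d \<Longrightarrow> c - v ! i \<in> C'"
  shows "ceq C (vadd x v) (vadd y v)"
proof -
  have l: "length y = d" using assms by (simp add: ceq_def)
  have "c \<le> x ! i + v ! i \<longleftrightarrow> c \<le> y ! i + v ! i" if "c \<in> C" "i < d" for c i
    using ceq_nth[OF assms(1) assms(4)[OF that]] that assms(2) by (simp add: algebra_simps)
  thus ?thesis using l assms by (auto simp: ceq_def)
qed

lemma vadd_vdiff: "length x = length y \<Longrightarrow> vadd x (vdiff y x) = y"
  by (rule nth_equalityI) auto

lemma vdiff_vadd: "length x = length v \<Longrightarrow> vdiff (vadd x v) x = v"
  by (rule nth_equalityI) auto

lemma box_vadd:
  assumes "length v = d" "rect_data d a b"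
  shows "box_d d (vadd a v) (vadd b v) = (\<lambda>y. vadd y v) ` box_d d a b"
proof (intro Set.set_eqI iffI)
  fix y assume y: "y \<in> box_d d (vadd a v) (vadd b v)"
  hence "y = vadd (vdiff y v) v" using assms by (intro nth_equalityI) (auto simp: box_d_def)
  moreover have "vdiff y v \<in> box_d d a b"
    using y assms by (force simp: box_d_def rect_data_def)
  ultimately show "y \<in> (\<lambda>y. vadd y v) ` box_d d a b" by blast
next
  fix y assume "y \<in> (\<lambda>y. vadd y v) ` box_d d a b"
  thus "y \<in> box_d d (vadd a v) (vadd b v)" using assms by (auto simp: box_d_def rect_data_def)
qed

locale mrect =
  fixes d :: nat and M :: "real list set"
  assumes d1: "d \<ge> 1" and mM: "multirectangle d M" and M_ne: "M \<noteq> {}"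
begin

definition adapted :: "real set \<Rightarrow> (real list \<Rightarrow> real list) \<Rightarrow> bool" where
  "adapted C f \<longleftrightarrow> gridset d C M \<and> (\<forall>x\<in>M. \<forall>y. ceq C x y \<longrightarrow> disp f x = disp f y)"

text \<open>The grid version of \<open>rec_map\<close>; \<open>rec_map_iff\<close> shows the
  equivalence. Finite sets of coordinates are easier to unite, refine and translate than partitions
  into rectangles.\<close>

definition is_rec :: "(real list \<Rightarrow> real list) \<Rightarrow> bool" where
  "is_rec f \<longleftrightarrow> bij_betw f M M \<and> (\<forall>x. x \<notin> M \<longrightarrow> f x = x) \<and> (\<exists>C. adapted C f)"

lemma adaptedD: "adapted C f \<Longrightarrow> x \<in> M \<Longrightarrow> ceq C x y \<Longrightarrow> disp f x = disp f y"
  by (auto simp: adapted_def)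

lemma adapted_grid: "adapted C f \<Longrightarrow> gridset d C M"
  by (auto simp: adapted_def)

lemma adapted_mono: "adapted C f \<Longrightarrow> C \<subseteq> C' \<Longrightarrow> finite C' \<Longrightarrow> adapted C' f"
  unfolding adapted_def using gridset_mono[of d C M C'] ceq_mono[of C' _ _ C] by blast

lemma M_grid: obtains C where "gridset d C M"
proof -
  obtain F where F: "finite F" "\<forall>R\<in>F. rectangle d R" "M = \<Union>F" using mM by (auto simp: multirectangle_def)
  then obtain a b where ab: "\<And>R. R \<in> F \<Longrightarrow> rect_data d (a R) (b R) \<and> R = box_d d (a R) (b R)"
    unfolding rectangle_def by metis
  let ?C = "\<Union>R\<in>F. set (a R) \<union> set (b R)"
  have fin: "finite ?C" using F by auto
  have "gridset d ?C (\<Union>F)"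
  proof (rule gridset_Union[OF fin])
    fix R assume R: "R \<in> F"
    have "gridset d ?C (box_d d (a R) (b R))" by (rule gridset_box[OF fin]) (use ab R in auto)
    thus "gridset d ?C R" using ab[OF R] by simp
  qed
  thus thesis using that F by simp
qed

lemma M_len: "x \<in> M \<Longrightarrow> length x = d"
  using M_grid gridset_len by metis

lemma is_rec_bij: "is_rec f \<Longrightarrow> bij_betw f M M" by (simp add: is_rec_def)
lemma is_rec_out: "is_rec f \<Longrightarrow> x \<notin> M \<Longrightarrow> f x = x" by (simp add: is_rec_def)
lemma is_rec_in: "is_rec f \<Longrightarrow> x \<in> M \<Longrightarrow> f x \<in> M" using bij_betwE is_rec_bij by blast
lemma is_rec_inj: "is_rec f \<Longrightarrow> f x = f y \<Longrightarrow> x = y"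
proof -
  assume f: "is_rec f" and e: "f x = f y"
  show "x = y"
  proof (cases "x \<in> M"; cases "y \<in> M")
    assume "x \<in> M" "y \<in> M" thus ?thesis using is_rec_bij[OF f] e by (auto simp: bij_betw_def inj_on_def)
  qed (use e f is_rec_in is_rec_out in metis)+
qed

lemma disp_len: "is_rec f \<Longrightarrow> x \<in> M \<Longrightarrow> length (disp f x) = d"
  by (simp add: disp_def M_len is_rec_in)

lemma is_rec_disp: "is_rec f \<Longrightarrow> x \<in> M \<Longrightarrow> f x = vadd x (disp f x)"
  by (simp add: disp_def M_len is_rec_in vadd_vdiff)

lemma disp_cell:
  assumes "adapted C f" "p \<in> pts C M" "y \<in> cell d C p" shows "disp f y = disp f p"
  using adaptedD[OF assms(1), of p y] assms cell_ceq[OF adapted_grid[OF assms(1)] assms(2)]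
  by (auto simp: pts_def)

lemma disp_image: "adapted C f \<Longrightarrow> disp f ` M = disp f ` pts C M"
proof -
  assume a: "adapted C f"
  have "disp f x \<in> disp f ` pts C M" if "x \<in> M" for x
    using fl_pts[OF adapted_grid[OF a] that] disp_cell[OF a] by force
  thus ?thesis by (auto simp: pts_def)
qed

lemma disp_finite: "adapted C f \<Longrightarrow> finite (disp f ` M)"
  using disp_image finite_pts adapted_grid by (metis finite_imageI)

lemma disp_coords_finite: "adapted C f \<Longrightarrow> finite (\<Union>(set ` disp f ` M))"
  by (rule finite_Union) (use disp_finite in auto)

lemma rec_map_iff: "rec_map d M f \<longleftrightarrow> is_rec f"
proof
  assume f: "rec_map d M f"
  then obtain P where P: "finite P" "\<forall>R\<in>P. rectangle d R" "\<Union>P = M"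
    "\<And>R. R \<in> P \<Longrightarrow> \<exists>v. length v = d \<and> (\<forall>y\<in>R. f y = vadd y v)" unfolding rec_map_def by blast
  then obtain a b where ab: "\<And>R. R \<in> P \<Longrightarrow> rect_data d (a R) (b R) \<and> R = box_d d (a R) (b R)"
    unfolding rectangle_def by metis
  let ?C = "\<Union>R\<in>P. set (a R) \<union> set (b R)"
  have fin: "finite ?C" using P by auto
  have R: "gridset d ?C R" if R: "R \<in> P" for R
  proof -
    have "gridset d ?C (box_d d (a R) (b R))" by (rule gridset_box[OF fin]) (use ab R in auto)
    thus "gridset d ?C R" using ab[OF R] by simp
  qed
  have "adapted ?C f" unfolding adapted_def
  proof (intro conjI ballI allI impI)
    show "gridset d ?C M" using gridset_Union[OF fin R] P(3) by metis
    fix x y assume x: "x \<in> M" and e: "ceq ?C x y"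
    then obtain Q where Q: "Q \<in> P" "x \<in> Q" using P(3) by blast
    obtain v where v: "length v = d" "\<forall>y\<in>Q. f y = vadd y v" using P(4)[OF Q(1)] by blast
    have y: "y \<in> Q" using gridset_ceq[OF R[OF Q(1)] Q(2) e] .
    have l: "length x = d" "length y = d" using gridset_len[OF R[OF Q(1)]] y Q by auto
    show "disp f x = disp f y" using v y Q l by (simp add: disp_def vdiff_vadd)
  qed
  thus "is_rec f" using f unfolding is_rec_def rec_map_def by blast
next
  assume f: "is_rec f"
  then obtain C where C: "adapted C f" by (auto simp: is_rec_def)
  note M = adapted_grid[OF C]
  show "rec_map d M f" unfolding rec_map_def
  proof (intro conjI exI[of _ "cell d C ` pts C M"])
    show "bij_betw f M M" "\<forall>x. x \<notin> M \<longrightarrow> f x = x" using f by (auto simp: is_rec_def)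
    show "finite (cell d C ` pts C M)" using finite_pts[OF M] by simp
    show "\<forall>R\<in>cell d C ` pts C M. rectangle d R"
      using cell_rect[OF M] by (auto simp: rectangle_def cell_def)
    show "\<Union>(cell d C ` pts C M) = M" using gridset_cells[OF M] by simp
    show "pairwise disjnt (cell d C ` pts C M)"
    proof (rule pairwiseI)
      fix R R' assume "R \<in> cell d C ` pts C M" "R' \<in> cell d C ` pts C M" and n: "R \<noteq> R'"
      then obtain p q where p: "p \<in> pts C M" "q \<in> pts C M" "R = cell d C p" "R' = cell d C q" by blast
      thus "disjnt R R'" using cell_eq[OF M p(1) M p(2)] n unfolding disjnt_def by blast
    qed
    show "\<forall>R\<in>cell d C ` pts C M. \<exists>v. length v = d \<and> (\<forall>y\<in>R. f y = vadd y v)"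
    proof
      fix R assume "R \<in> cell d C ` pts C M"
      then obtain p where p: "p \<in> pts C M" "R = cell d C p" by blast
      have "f y = vadd y (disp f p)" if "y \<in> R" for y
      proof -
        have "y \<in> M" using cell_subset[OF M p(1)] that p by auto
        thus ?thesis using is_rec_disp[OF f] disp_cell[OF C p(1)] that p by metis
      qed
      moreover have "length (disp f p) = d" using disp_len[OF f] p by (auto simp: pts_def)
      ultimately show "\<exists>v. length v = d \<and> (\<forall>y\<in>R. f y = vadd y v)" by blast
    qed
  qed
qed

section \<open>The group structure\<close>

lemma is_rec_id: "is_rec id"
proof -
  obtain C where C: "gridset d C M" using M_grid by blast
  have "disp id x = disp id y" if "length x = length y" for x y
    by (rule nth_equalityI) (use that in \<open>auto simp: disp_def\<close>)
  hence "adapted C id" using C ceq_length unfolding adapted_def by blast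
  thus ?thesis by (auto simp: is_rec_def)
qed

lemma disp_comp:
  assumes "is_rec f" "is_rec g" "x \<in> M"
  shows "disp (f \<circ> g) x = vadd (disp f (g x)) (disp g x)"
  using M_len[OF assms(3)] M_len[OF is_rec_in[OF assms(2,3)]] M_len[OF is_rec_in[OF assms(1) is_rec_in[OF assms(2,3)]]]
  by (intro nth_equalityI) (auto simp: disp_def)

lemma is_rec_comp:
  assumes f: "is_rec f" and g: "is_rec g" shows "is_rec (f \<circ> g)"
proof -
  obtain C1 where C1: "adapted C1 f" using f by (auto simp: is_rec_def)
  obtain C2 where C2: "adapted C2 g" using g by (auto simp: is_rec_def)
  let ?T = "\<Union>(set ` disp g ` M)"
  \<comment> \<open>Pulling the coordinates in \<open>C1\<close> back by every displacement of
    \<open>g\<close> ensures that \<open>g\<close> maps each new cell into a single cell of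
    \<open>C1\<close>.\<close>
  let ?C = "C1 \<union> C2 \<union> (\<lambda>(c, t). c - t) ` (C1 \<times> ?T)"
  have fC: "finite C1" "finite C2" using C1 C2 adapted_grid gridset_finite by blast+
  have fin: "finite ?C" using fC disp_coords_finite[OF C2] by (intro finite_UnI finite_imageI finite_cartesian_product)
  have "adapted ?C (f \<circ> g)" unfolding adapted_def
  proof (intro conjI ballI allI impI)
    show "gridset d ?C M" by (rule gridset_mono[OF adapted_grid[OF C1] _ fin]) blast
    fix x y assume x: "x \<in> M" and e: "ceq ?C x y"
    have e2: "ceq C2 x y" using ceq_mono[OF e] by blast
    have y: "y \<in> M" using gridset_ceq[OF adapted_grid[OF C2] x e2] .
    have v: "disp g y = disp g x" using adaptedD[OF C2 x e2] by simp
    have "ceq C1 (vadd x (disp g x)) (vadd y (disp g x))"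
    proof (rule ceq_vadd[OF e M_len[OF x] disp_len[OF g x]])
      fix c i assume "c \<in> C1" "i < d"
      hence "disp g x ! i \<in> set (disp g x)" using disp_len[OF g x] by simp
      hence "disp g x ! i \<in> ?T" using x by blast
      hence "(\<lambda>(c, t). c - t) (c, disp g x ! i) \<in> (\<lambda>(c, t). c - t) ` (C1 \<times> ?T)" using \<open>c \<in> C1\<close> by blast
      thus "c - disp g x ! i \<in> ?C" by simp
    qed
    hence "ceq C1 (g x) (g y)" using is_rec_disp[OF g x] is_rec_disp[OF g y] v by simp
    hence "disp f (g x) = disp f (g y)" using adaptedD[OF C1 is_rec_in[OF g x]] by blast
    thus "disp (f \<circ> g) x = disp (f \<circ> g) y" using disp_comp[OF f g] x y v by simp
  qed
  moreover have "bij_betw (f \<circ> g) M M" using bij_betw_trans[OF is_rec_bij[OF g] is_rec_bij[OF f]] .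
  ultimately show ?thesis using f g unfolding is_rec_def by auto
qed

lemma is_rec_inverse:
  assumes f: "is_rec f" shows "\<exists>g. is_rec g \<and> g \<circ> f = id"
proof -
  define g where "g x = (if x \<in> M then inv_into M f x else x)" for x
  have bij: "bij_betw g M M"
    using bij_betw_inv_into[OF is_rec_bij[OF f]] by (rule bij_betw_cong[THEN iffD1, rotated]) (simp add: g_def)
  have fg: "f (g x) = x" for x
    using is_rec_bij[OF f] is_rec_out[OF f] by (auto simp: g_def bij_betw_def f_inv_into_f)
  have gf: "g (f x) = x" for x using is_rec_inj[OF f] fg by blast
  have gM: "g x \<in> M" if "x \<in> M" for x using bij that by (auto simp: bij_betw_def)
  obtain C where C: "adapted C f" using f by (auto simp: is_rec_def)
  let ?T = "\<Union>(set ` disp f ` M)"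
  \<comment> \<open>The coordinates are now shifted forward, because \<open>g\<close> moves points
    by the negatives of the displacements of \<open>f\<close>.\<close>
  let ?C = "C \<union> (\<lambda>(c, t). c + t) ` (C \<times> ?T)"
  have fin: "finite ?C" using gridset_finite[OF adapted_grid[OF C]] disp_coords_finite[OF C]
    by (intro finite_UnI finite_imageI finite_cartesian_product)
  have dg: "disp g x = map uminus (disp f (g x))" if "x \<in> M" for x
    using M_len[OF that] M_len[OF gM[OF that]] by (intro nth_equalityI) (auto simp: disp_def fg)
  have "adapted ?C g" unfolding adapted_def
  proof (intro conjI ballI allI impI)
    show "gridset d ?C M" by (rule gridset_mono[OF adapted_grid[OF C] _ fin]) blast
    fix x y assume x: "x \<in> M" and e: "ceq ?C x y"
    have "ceq C x y" using ceq_mono[OF e] by blast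
    hence y: "y \<in> M" using gridset_ceq[OF adapted_grid[OF C] x] by blast
    let ?v = "disp f (g x)"
    have lv: "length ?v = d" using disp_len[OF f gM[OF x]] .
    have "ceq C (vadd x (map uminus ?v)) (vadd y (map uminus ?v))"
    proof (rule ceq_vadd[OF e M_len[OF x]])
      fix c i assume "c \<in> C" "i < d"
      hence "?v ! i \<in> set ?v" using lv by simp
      hence "?v ! i \<in> ?T" using gM[OF x] by blast
      hence "(\<lambda>(c, t). c + t) (c, ?v ! i) \<in> (\<lambda>(c, t). c + t) ` (C \<times> ?T)" using \<open>c \<in> C\<close> by blast
      thus "c - map uminus ?v ! i \<in> ?C" using \<open>i < d\<close> lv by simp
    qed (use lv in simp)
    moreover have "vadd x (map uminus ?v) = g x"
      using dg[OF x] M_len[OF x] M_len[OF gM[OF x]] vadd_vdiff[of x "g x"] by (simp add: disp_def)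
    \<comment> \<open>The candidate for \<open>g y\<close>, computed with the displacement that
      belongs to \<open>x\<close>, lies in the cell of \<open>g x\<close>. Hence \<open>f\<close>
      moves it by that displacement and brings it to \<open>y\<close>.\<close>
    ultimately have c: "ceq C (g x) (vadd y (map uminus ?v))" by simp
    have y': "vadd y (map uminus ?v) \<in> M" using gridset_ceq[OF adapted_grid[OF C] gM[OF x] c] .
    have "f (vadd y (map uminus ?v)) = vadd (vadd y (map uminus ?v)) ?v"
      using is_rec_disp[OF f y'] adaptedD[OF C gM[OF x] c] by simp
    also have "\<dots> = y" using lv M_len[OF y] by (intro nth_equalityI) auto
    finally have "f (vadd y (map uminus ?v)) = y" .
    hence "g y = vadd y (map uminus ?v)" using gf by metis
    hence "disp g y = map uminus ?v" using vdiff_vadd[of y] M_len[OF y] lv by (simp add: disp_def)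
    thus "disp g x = disp g y" using dg[OF x] by simp
  qed
  hence "is_rec g" using bij by (auto simp: is_rec_def g_def)
  moreover have "g \<circ> f = id" using gf by auto
  ultimately show ?thesis by blast
qed

abbreviation G where "G \<equiv> Rec_group d M"

lemma G_carrier [simp]: "f \<in> carrier G \<longleftrightarrow> is_rec f"
  by (simp add: Rec_group_def rec_map_iff)

lemma G_mult [simp]: "f \<otimes>\<^bsub>G\<^esub> g = f \<circ> g"
  by (simp add: Rec_group_def)

lemma G_one [simp]: "\<one>\<^bsub>G\<^esub> = id"
  by (simp add: Rec_group_def)

lemma G_group: "group G"
proof (rule groupI)
  fix f assume "f \<in> carrier G"
  thus "\<exists>g\<in>carrier G. g \<otimes>\<^bsub>G\<^esub> f = \<one>\<^bsub>G\<^esub>" using is_rec_inverse[of f] by auto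
qed (auto simp: is_rec_comp is_rec_id comp_assoc)

section \<open>T is a homomorphism\<close>

lemma delta_zero: "length ts = k \<Longrightarrow> delta (ts @ [0]) \<in> tensor_rel (Suc k)"
proof -
  assume "length ts = k"
  hence "delta (ts @ [0 + 0] @ []) - delta (ts @ [0] @ []) - delta (ts @ [0] @ []) \<in> tensor_rel (Suc k)"
    using madd_delta[of "Suc k", unfolded madd_def, rule_format, of ts "[]" 0 0] by simp
  from asub_uminus[OF tensor_rel_asub this] show ?thesis by (simp del: fun_Compl_def)
qed

lemma madd_swap_delta: "i < d \<Longrightarrow> madd d (tensor_rel (Suc d)) (\<lambda>ts. delta (swap_fac d i ts @ [r]))"
  using madd_swap_fac[OF madd_suffix[of d "[r]" _ delta]] madd_delta[of "Suc d"] by simp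

text \<open>Allows \<open>T_comp\<close> to be computed from any finite family of disjoint boxes
  that carries all the movement: the fixed points contribute tensors with last factor
  \<open>0\<close>.\<close>

lemma T_comp_boxes:
  assumes f: "is_rec f" and i: "i < d" and I: "finite I" "\<And>j. j \<in> I \<Longrightarrow> rect_data d (a j) (b j)"
      "\<And>j. j \<in> I \<Longrightarrow> box_d d (a j) (b j) \<subseteq> M"
      "\<And>j j'. j \<in> I \<Longrightarrow> j' \<in> I \<Longrightarrow> j \<noteq> j' \<Longrightarrow> box_d d (a j) (b j) \<inter> box_d d (a j') (b j') = {}"
    and r: "\<And>j x. j \<in> I \<Longrightarrow> x \<in> box_d d (a j) (b j) \<Longrightarrow> disp f x = r j"
    and out: "\<And>x. x \<in> M \<Longrightarrow> \<forall>j\<in>I. x \<notin> box_d d (a j) (b j) \<Longrightarrow> f x = x"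
  shows "T_comp d M f i = cl (Suc d) (\<Sum>j\<in>I. delta (swap_fac d i (vdiff (b j) (a j)) @ [r j ! i]))"
proof -
  obtain C0 where C0: "adapted C0 f" using f by (auto simp: is_rec_def)
  define C where "C = C0 \<union> (\<Union>j\<in>I. set (a j) \<union> set (b j))"
  have fC: "finite C" using C0 I(1) adapted_grid[OF C0] by (auto simp: C_def gridset_def)
  have C: "adapted C f" by (rule adapted_mono[OF C0 _ fC]) (auto simp: C_def)
  note M = adapted_grid[OF C]
  define S where "S = (\<Union>j\<in>I. box_d d (a j) (b j))"
  have S: "gridset d C S" unfolding S_def
    by (rule gridset_UN[OF fC], rule gridset_box[OF fC]) (use I(2) in \<open>auto simp: C_def\<close>)
  have SM: "S \<subseteq> M" using I(3) by (auto simp: S_def)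
  let ?F = "\<lambda>p. delta (swap_fac d i (map (gap C) p) @ [disp f p ! i])"
  have "pts C M = pts C S \<union> pts C (M - S)" using SM by (auto simp: pts_def)
  moreover have "finite (pts C (M - S))" using finite_pts[OF M] by (rule rev_finite_subset) (auto simp: pts_def)
  ultimately have "Tsum d C M f i = (\<Sum>p\<in>pts C S. ?F p) + (\<Sum>p\<in>pts C (M - S). ?F p)"
    unfolding Tsum_def using finite_pts[OF S] by (simp only:) (rule sum.union_disjoint, auto simp: pts_def)
  moreover have "(\<Sum>p\<in>pts C (M - S). ?F p) \<in> tensor_rel (Suc d)"
  proof (rule asub_sum[OF tensor_rel_asub])
    fix p assume p: "p \<in> pts C (M - S)"
    hence "f p = p" using out[of p] by (auto simp: pts_def S_def)
    moreover have "length p = d" using p M_len by (auto simp: pts_def)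
    ultimately have "disp f p ! i = 0" using i by (simp add: disp_def)
    thus "?F p \<in> tensor_rel (Suc d)" using delta_zero[of "swap_fac d i (map (gap C) p)" d] \<open>length p = d\<close> by simp
  qed
  moreover have "(\<Sum>p\<in>pts C S. ?F p) - (\<Sum>j\<in>I. delta (swap_fac d i (vdiff (b j) (a j)) @ [r j ! i])) \<in> tensor_rel (Suc d)"
  proof (rule grid_sum_eq_box_sum[OF tensor_rel_asub S, where \<phi> = "disp f" and m = "\<lambda>v ts. delta (swap_fac d i ts @ [v ! i])" and r = r])
    show "disp f x = disp f y" if "x \<in> S" "ceq C x y" for x y using adaptedD[OF C _ that(2)] that(1) SM by blast
  qed (use I r in \<open>auto simp: S_def intro: madd_swap_delta[OF i]\<close>)
  ultimately have "Tsum d C M f i - (\<Sum>j\<in>I. delta (swap_fac d i (vdiff (b j) (a j)) @ [r j ! i])) \<in> tensor_rel (Suc d)"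
    by (rule asub_split[OF tensor_rel_asub])
  thus ?thesis using T_comp_grid[OF M i adaptedD[OF C]] by (simp add: cl_eq_iff)
qed

text \<open>The displacement of \<open>f \<circ> g\<close> at \<open>p\<close> is the sum of those
  of \<open>f\<close> at \<open>g p\<close> and of \<open>g\<close> at \<open>p\<close>, and the
  last slot is additive. The images under \<open>g\<close> of the cells again partition
  \<open>M\<close> and have the same sides, so \<open>T_comp\<close> of \<open>f\<close> may be
  computed on them.\<close>

lemma T_comp_mult:
  assumes f: "is_rec f" and g: "is_rec g" and i: "i < d"
  shows "T_comp d M (f \<circ> g) i = T_comp d M f i \<otimes>\<^bsub>TP (Suc d)\<^esub> T_comp d M g i"
proof -
  have fg: "is_rec (f \<circ> g)" using is_rec_comp f g by blast
  \<comment> \<open>The grid is adapted to \<open>g\<close> and \<open>f \<circ> g\<close>;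
    subtracting the two constant displacements shows that \<open>disp f\<close> is constant on the
    image under \<open>g\<close> of each cell.\<close>
  obtain C1 C2 where C12: "adapted C1 g" "adapted C2 (f \<circ> g)" using g fg by (auto simp: is_rec_def)
  define C where "C = C1 \<union> C2"
  have fC: "finite C" using C12 adapted_grid gridset_finite unfolding C_def by blast
  have C: "adapted C g" "adapted C (f \<circ> g)" using C12 adapted_mono[OF _ _ fC] by (auto simp: C_def)
  note M = adapted_grid[OF C(1)]
  let ?a = "\<lambda>p. vadd p (disp g p)" and ?b = "\<lambda>p. vadd (map (nx C) p) (disp g p)"
  have pM: "p \<in> M" if "p \<in> pts C M" for p using that by (simp add: pts_def)
  have l: "length (disp g p) = d" if "p \<in> pts C M" for p using disp_len[OF g pM[OF that]] .
  have box: "box_d d (?a p) (?b p) = g ` cell d C p" if p: "p \<in> pts C M" for p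
  proof -
    have "box_d d (?a p) (?b p) = (\<lambda>y. vadd y (disp g p)) ` cell d C p"
      unfolding cell_def using box_vadd[OF l[OF p] cell_rect(1)[OF M p]] .
    also have "\<dots> = g ` cell d C p"
      using is_rec_disp[OF g] disp_cell[OF C(1) p] cell_subset[OF M p] by (intro image_cong) auto
    finally show ?thesis .
  qed
  have 1: "T_comp d M f i = cl (Suc d) (\<Sum>p\<in>pts C M. delta (swap_fac d i (vdiff (?b p) (?a p)) @ [disp f (g p) ! i]))"
  proof (rule T_comp_boxes[OF f i finite_pts[OF M]])
    fix p assume p: "p \<in> pts C M"
    show "rect_data d (?a p) (?b p)" using cell_rect(1)[OF M p] l[OF p] by (auto simp: rect_data_def)
    show "box_d d (?a p) (?b p) \<subseteq> M" unfolding box[OF p] using cell_subset[OF M p] is_rec_in[OF g] by auto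
    show "box_d d (?a p) (?b p) \<inter> box_d d (?a q) (?b q) = {}" if q: "q \<in> pts C M" and n: "p \<noteq> q" for q
      unfolding box[OF p] box[OF q] using cell_eq[OF M p M q] n is_rec_inj[OF g] by blast
    show "disp f x = disp f (g p)" if x: "x \<in> box_d d (?a p) (?b p)" for x
    proof -
      obtain y where y: "y \<in> cell d C p" "x = g y" using x unfolding box[OF p] by blast
      have yM: "y \<in> M" using cell_subset[OF M p] y by auto
      have "vadd (disp f (g y)) (disp g p) = vadd (disp f (g p)) (disp g p)"
        using disp_comp[OF f g yM] disp_comp[OF f g pM[OF p]] disp_cell[OF C(1) p y(1)] disp_cell[OF C(2) p y(1)] by simp
      moreover have "length (disp f (g y)) = d" "length (disp f (g p)) = d"
        using disp_len[OF f] is_rec_in[OF g] yM pM[OF p] by blast+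
      ultimately show ?thesis unfolding y(2) using l[OF p]
        by (intro nth_equalityI) (auto simp: list_eq_iff_nth_eq)
    qed
  next
    fix x assume x: "x \<in> M" "\<forall>p\<in>pts C M. x \<notin> box_d d (?a p) (?b p)"
    obtain y where y: "y \<in> M" "x = g y" using is_rec_bij[OF g] x(1) by (auto simp: bij_betw_def)
    have "x \<in> box_d d (?a (map (fl C) y)) (?b (map (fl C) y))"
      unfolding box[OF fl_pts(1)[OF M y(1)]] y(2) using fl_pts(2)[OF M y(1)] by blast
    thus "f x = x" using x(2) fl_pts(1)[OF M y(1)] by blast
  qed
  have 2: "vdiff (?b p) (?a p) = map (gap C) p" if "p \<in> pts C M" for p
    using l[OF that] pts_length[OF M that] by (intro nth_equalityI) (auto simp: gap_def)
  let ?u = "\<Sum>p\<in>pts C M. delta (swap_fac d i (map (gap C) p) @ [disp f (g p) ! i])"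
  have 3: "T_comp d M f i = cl (Suc d) ?u" unfolding 1 by (intro arg_cong[of _ _ "cl (Suc d)"] sum.cong) (simp_all add: 2)
  have u: "?u \<in> carrier (FreeQ (Suc d))"
    by (intro asub_sum[OF FreeQ_asub] delta_carrier) (auto dest: pts_length[OF M])
  have "Tsum d C M (f \<circ> g) i - (?u + Tsum d C M g i) \<in> tensor_rel (Suc d)"
    unfolding Tsum_def sum.distrib[symmetric]
  proof (rule asub_sum_diff[OF tensor_rel_asub])
    fix p assume p: "p \<in> pts C M"
    let ?t = "swap_fac d i (map (gap C) p)"
    have "disp (f \<circ> g) p ! i = disp f (g p) ! i + disp g p ! i"
      using disp_comp[OF f g pM[OF p]] l[OF p] disp_len[OF f is_rec_in[OF g pM[OF p]]] i by simp
    moreover have "delta (?t @ [disp f (g p) ! i + disp g p ! i] @ []) - delta (?t @ [disp f (g p) ! i] @ []) - delta (?t @ [disp g p ! i] @ []) \<in> tensor_rel (Suc d)"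
      using madd_delta[of "Suc d", unfolded madd_def, rule_format, of ?t "[]"] pts_length[OF M p] by simp
    ultimately show "delta (?t @ [disp (f \<circ> g) p ! i]) - (delta (?t @ [disp f (g p) ! i]) + delta (?t @ [disp g p ! i])) \<in> tensor_rel (Suc d)"
      by (simp only: append_Nil2 diff_diff_add)
  qed
  hence "T_comp d M (f \<circ> g) i = cl (Suc d) (?u + Tsum d C M g i)"
    using T_comp_grid[OF M i adaptedD[OF C(2)]] by (simp add: cl_eq_iff)
  also have "\<dots> = cl (Suc d) ?u \<otimes>\<^bsub>TP (Suc d)\<^esub> cl (Suc d) (Tsum d C M g i)"
    by (rule cl_mult[symmetric, OF u Tsum_carrier[OF M]])
  also have "cl (Suc d) (Tsum d C M g i) = T_comp d M g i"
    by (rule T_comp_grid[OF M i adaptedD[OF C(1)], symmetric])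
  also have "cl (Suc d) ?u = T_comp d M f i" using 3 by simp
  finally show ?thesis .
qed

lemma T_comp_carrier: "is_rec f \<Longrightarrow> i < d \<Longrightarrow> T_comp d M f i \<in> carrier (TP (Suc d))"
proof -
  assume f: "is_rec f" and i: "i < d"
  obtain C where C: "adapted C f" using f by (auto simp: is_rec_def)
  show ?thesis using T_comp_grid[OF adapted_grid[OF C] i adaptedD[OF C]] Tsum_carrier[OF adapted_grid[OF C]] by simp
qed

abbreviation PG where "PG \<equiv> product_group {..<d} (\<lambda>_. TP (Suc d))"

lemma TP_group: "group (TP k)"
  using TP_comm_group comm_group.axioms(2) by blast

lemma T_hom: "T_map d M \<in> hom G PG"
proof (rule homI)
  fix f g assume "f \<in> carrier G" "g \<in> carrier G"
  thus "T_map d M (f \<otimes>\<^bsub>G\<^esub> g) = T_map d M f \<otimes>\<^bsub>PG\<^esub> T_map d M g"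
    by (auto simp: T_map_def T_comp_mult fun_eq_iff)
qed (auto simp: T_map_def T_comp_carrier)

end

section \<open>Positive rationally independent generators\<close>

text \<open>Indexed families instead of sets, since the exchange step below replaces several members
  in place. That the members are distinct follows from independence, and is derived when the family
  is turned into a set.\<close>

definition indep :: "nat \<Rightarrow> (nat \<Rightarrow> real) \<Rightarrow> bool" where
  "indep m e \<longleftrightarrow> (\<forall>n. (\<Sum>i<m. of_rat (n i) * e i) = 0 \<longrightarrow> (\<forall>i<m. n i = 0))"

definition cone :: "nat \<Rightarrow> (nat \<Rightarrow> real) \<Rightarrow> real \<Rightarrow> bool" where
  "cone m e x \<longleftrightarrow> (\<exists>n. (\<forall>i<m. n i \<ge> 0) \<and> x = (\<Sum>i<m. of_rat (n i) * e i))"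

lemma cone_add: "cone m e x \<Longrightarrow> cone m e y \<Longrightarrow> cone m e (x + y)"
proof -
  assume "cone m e x" "cone m e y"
  then obtain n k where "\<forall>i<m. n i \<ge> 0" "\<forall>i<m. k i \<ge> 0" "x = (\<Sum>i<m. of_rat (n i) * e i)" "y = (\<Sum>i<m. of_rat (k i) * e i)"
    by (auto simp: cone_def)
  thus ?thesis unfolding cone_def
    by (intro exI[of _ "\<lambda>i. n i + k i"]) (auto simp: of_rat_add distrib_right sum.distrib)
qed

lemma cone_scale: "cone m e x \<Longrightarrow> q \<ge> 0 \<Longrightarrow> cone m e (of_rat q * x)"
proof -
  assume q: "q \<ge> 0" and "cone m e x"
  then obtain n where "\<forall>i<m. n i \<ge> 0" "x = (\<Sum>i<m. of_rat (n i) * e i)"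
    by (auto simp: cone_def)
  thus ?thesis unfolding cone_def using q
    by (intro exI[of _ "\<lambda>i. q * n i"]) (auto simp: of_rat_mult sum_distrib_left mult.assoc)
qed

lemma cone_gen: "i < m \<Longrightarrow> cone m e (e i)"
  unfolding cone_def
  by (intro exI[of _ "\<lambda>j. if j = i then 1 else 0"]) (auto simp: if_distrib[of of_rat] if_distrib[of "\<lambda>x. x * _"] cong: if_cong)

lemma cone_sum: "(\<And>j. j \<in> J \<Longrightarrow> cone m e (f j)) \<Longrightarrow> cone m e (sum f J)"
proof (induction J rule: infinite_finite_induct)
  case (insert x F) thus ?case by (simp add: cone_add)
qed (auto simp: cone_def intro!: exI[of _ "\<lambda>_. 0"])

lemma cone_trans:
  assumes "cone m e x" "\<And>i. i < m \<Longrightarrow> cone k e' (e i)" shows "cone k e' x"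
proof -
  obtain n where n: "\<forall>i<m. n i \<ge> 0" "x = (\<Sum>i<m. of_rat (n i) * e i)" using assms(1) by (auto simp: cone_def)
  show ?thesis unfolding n(2) by (rule cone_sum) (use n assms(2) in \<open>auto intro: cone_scale\<close>)
qed

text \<open>Choose rationals slightly below the bounds \<open>t k\<close> whose total still exceeds
  \<open>Q\<close>, then scale them down so that the total becomes \<open>Q\<close>.\<close>

lemma rational_parts:
  fixes t :: "'k \<Rightarrow> real" and Q :: rat
  assumes "finite P" "\<And>k. k \<in> P \<Longrightarrow> t k > 0" "of_rat Q < (\<Sum>k\<in>P. t k)" "Q > 0"
  shows "\<exists>r. (\<forall>k\<in>P. 0 \<le> r k \<and> of_rat (r k) < t k) \<and> (\<Sum>k\<in>P. r k) = Q"
proof -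
  have ne: "P \<noteq> {}" using assms(3,4) by auto
  hence cP: "card P > 0" using assms(1) by (simp add: card_gt_0_iff)
  \<comment> \<open>Losing less than \<open>\<delta>\<close> at every index loses less than the
    total excess over \<open>Q\<close>.\<close>
  define \<delta> where "\<delta> = ((\<Sum>k\<in>P. t k) - of_rat Q) / card P"
  have \<delta>: "\<delta> > 0" using assms(3) cP by (simp add: \<delta>_def)
  have "\<exists>s. max 0 (t k - \<delta>) < of_rat s \<and> of_rat s < t k" if "k \<in> P" for k
    using of_rat_dense[of "max 0 (t k - \<delta>)" "t k"] assms(2)[OF that] \<delta> by auto
  then obtain s where s: "\<And>k. k \<in> P \<Longrightarrow> max 0 (t k - \<delta>) < of_rat (s k) \<and> of_rat (s k) < t k" by metis
  have s0: "s k > 0" if "k \<in> P" for k using s[OF that] by simp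
  let ?S = "\<Sum>k\<in>P. s k"
  have "(\<Sum>k\<in>P. t k - \<delta>) < (\<Sum>k\<in>P. of_rat (s k))"
    using s by (intro sum_strict_mono assms ne) auto
  also have "(\<Sum>k\<in>P. t k - \<delta>) = of_rat Q" using cP by (simp add: sum_subtractf \<delta>_def)
  finally have QS: "Q < ?S" by (simp add: of_rat_sum[symmetric] of_rat_less)
  hence S0: "?S > 0" using assms(4) by simp
  let ?r = "\<lambda>k. s k * (Q / ?S)"
  have "0 \<le> ?r k \<and> of_rat (?r k) < t k" if k: "k \<in> P" for k
  proof -
    have "Q / ?S < 1" using QS S0 by simp
    hence "?r k \<le> s k" using s0[OF k] mult_left_mono[of "Q / ?S" 1 "s k"] by simp
    hence "of_rat (?r k) \<le> (of_rat (s k) :: real)" by (simp only: of_rat_less_eq)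
    moreover have "0 \<le> Q / ?S" using assms(4) S0 by simp
    ultimately show ?thesis using s[OF k] s0[OF k] mult_nonneg_nonneg[of "s k" "Q / ?S"] by linarith
  qed
  moreover have "(\<Sum>k\<in>P. ?r k) = Q" using S0 by (simp only: sum_distrib_right[symmetric]) simp
  ultimately show ?thesis by (intro exI[of _ ?r]) blast
qed

text \<open>Induction on the number of negative coefficients of \<open>x\<close>. A negative term
  \<open>q l * e l\<close> is absorbed by the positive ones: rational multiples of
  \<open>e l\<close> with total coefficient \<open>- q l\<close> are subtracted from the terms
  \<open>q i * e i\<close> with \<open>q i > 0\<close>, each of which stays positive. Then
  \<open>x\<close> has coefficient \<open>1\<close> at these indices and \<open>0\<close> at
  \<open>l\<close>. The old \<open>e i\<close> remain in the cone, being recovered by adding a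
  nonnegative multiple of \<open>e l\<close> and dividing by \<open>q i\<close>.\<close>

lemma positive_basis_step:
  assumes "indep m e" "\<forall>i<m. e i > 0" "x = (\<Sum>i<m. of_rat (q i) * e i)" "x > 0"
  shows "\<exists>e'. indep m e' \<and> (\<forall>i<m. e' i > 0) \<and> (\<forall>i<m. cone m e' (e i)) \<and> cone m e' x"
  using assms
proof (induction "card {i. i < m \<and> q i < 0}" arbitrary: e q rule: less_induct)
  case less
  show ?case
  proof (cases "{i. i < m \<and> q i < 0} = {}")
    case True
    hence "cone m e x" using less.prems unfolding cone_def by (intro exI[of _ q]) auto
    thus ?thesis using less.prems cone_gen by (intro exI[of _ e]) auto
  next
    case False
    then obtain l where l: "l < m" "q l < 0" by auto
    define P where "P = {i. i < m \<and> q i > 0}"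
    define R where "R = {i. i < m \<and> i \<noteq> l \<and> q i \<le> 0}"
    have fP: "finite P" "finite R" by (auto simp: P_def R_def)
    have split: "sum f {..<m} = sum f P + f l + sum f R" for f :: "nat \<Rightarrow> real"
    proof -
      have "{..<m} = insert l (P \<union> R)" using l by (auto simp: P_def R_def)
      moreover have "l \<notin> P \<union> R" "P \<inter> R = {}" using l by (auto simp: P_def R_def)
      ultimately show ?thesis using fP by (simp add: sum.union_disjoint)
    qed
    have el: "e l > 0" using less.prems l by auto
    \<comment> \<open>How many multiples of \<open>e l\<close> fit into the term
      \<open>q k * e k\<close>.\<close>
    define t where "t k = of_rat (q k) * e k / e l" for k
    have t0: "t k > 0" if "k \<in> P" for k using that less.prems el by (auto simp: t_def P_def)
    have "(\<Sum>i\<in>R. of_rat (q i) * e i) \<le> 0"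
      using less.prems by (intro sum_nonpos) (auto simp: R_def mult_nonpos_nonneg less_imp_le)
    \<comment> \<open>Since \<open>x > 0\<close> and the terms in \<open>R\<close> are at most zero,
      the positive terms outweigh the term at \<open>l\<close>.\<close>
    hence "of_rat (- q l) * e l < (\<Sum>i\<in>P. of_rat (q i) * e i)"
      using less.prems(3,4) by (simp add: split of_rat_minus)
    also have "\<dots> = (\<Sum>k\<in>P. t k) * e l" using el by (simp add: t_def sum_distrib_right)
    finally have "of_rat (- q l) < (\<Sum>k\<in>P. t k)" using el by simp
    then obtain r where r: "\<forall>k\<in>P. 0 \<le> r k \<and> of_rat (r k) < t k" "(\<Sum>k\<in>P. r k) = - q l"
      using rational_parts[of P t "- q l"] fP(1) t0 l by auto
    define e' where "e' i = (if i \<in> P then of_rat (q i) * e i - of_rat (r i) * e l else e i)" for i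
    have lP: "l \<notin> P" and RP: "\<And>i. i \<in> R \<Longrightarrow> i \<notin> P" using l by (auto simp: P_def R_def)
    have pos: "e' i > 0" if "i < m" for i
    proof (cases "i \<in> P")
      case True
      hence "of_rat (r i) * e l < t i * e l" using r el by simp
      thus ?thesis using True el by (simp add: e'_def t_def)
    qed (use that less.prems in \<open>simp add: e'_def\<close>)
    have sum_e': "(\<Sum>i<m. of_rat (n i) * e' i) = (\<Sum>i\<in>P. of_rat (n i * q i) * e i) +
       of_rat (n l - (\<Sum>k\<in>P. n k * r k)) * e l + (\<Sum>i\<in>R. of_rat (n i) * e i)" for n
    proof -
      have "(\<Sum>i\<in>P. of_rat (n i) * e' i) = (\<Sum>i\<in>P. of_rat (n i * q i) * e i) - of_rat (\<Sum>k\<in>P. n k * r k) * e l"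
        by (simp add: e'_def algebra_simps of_rat_mult of_rat_sum sum_subtractf sum_distrib_left sum_distrib_right)
      thus ?thesis unfolding split using lP RP by (simp add: e'_def of_rat_diff algebra_simps)
    qed
    have ind: "indep m e'" unfolding indep_def
    proof (intro allI impI)
      fix n i assume 0: "(\<Sum>i<m. of_rat (n i) * e' i) = 0" and i: "i < m"
      \<comment> \<open>The coefficients of the same combination with respect to the old family
        \<open>e\<close>.\<close>
      let ?c = "\<lambda>i. if i \<in> P then n i * q i else if i = l then n l - (\<Sum>k\<in>P. n k * r k) else n i"
      have "(\<Sum>i<m. of_rat (?c i) * e i) = 0" unfolding split
        using 0 lP RP unfolding sum_e' by (simp add: R_def)
      hence "\<forall>j<m. ?c j = 0" using less.prems(1) unfolding indep_def by (elim allE[of _ ?c]) blast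
      hence c: "?c j = 0" if "j < m" for j using that by blast
      have P0: "n k = 0" if "k \<in> P" for k using c[of k] that by (auto simp: P_def split: if_splits)
      hence "n l = 0" using c[of l] l lP by simp
      thus "n i = 0" using P0 c[OF i] by (auto split: if_splits)
    qed
    let ?q = "\<lambda>i. if i \<in> P then 1 else if i = l then 0 else q i"
    have x: "x = (\<Sum>i<m. of_rat (?q i) * e' i)"
      unfolding sum_e' using lP RP r(2) less.prems(3) unfolding split by (simp add: R_def of_rat_minus)
    have "card {i. i < m \<and> ?q i < 0} < card {i. i < m \<and> q i < 0}"
      by (rule psubset_card_mono) (use l in \<open>auto simp: P_def split: if_splits\<close>)
    from less.hyps[OF this ind _ x less.prems(4)] pos
    obtain e'' where e'': "indep m e''" "\<forall>i<m. e'' i > 0" "\<forall>i<m. cone m e'' (e' i)" "cone m e'' x" by blast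
    have "cone m e' (e i)" if i: "i < m" for i
    proof (cases "i \<in> P")
      case True
      have "e i = of_rat (1 / q i) * e' i + of_rat (r i / q i) * e' l"
      proof -
        have "q i > 0" using True by (simp add: P_def)
        thus ?thesis using True lP by (simp add: e'_def of_rat_divide field_simps)
      qed
      also have "cone m e' \<dots>" using True r(1) i l by (intro cone_add cone_scale cone_gen) (auto simp: P_def)
      finally show ?thesis .
    next
      case False
      hence "e i = e' i" by (simp add: e'_def)
      thus ?thesis using cone_gen i by metis
    qed
    hence "\<forall>i<m. cone m e'' (e i)" using e''(3) cone_trans by blast
    thus ?thesis using e'' by blast
  qed
qed

text \<open>A new number either lies in the rational span of the family found so far, and then
  \<open>positive_basis_step\<close> applies, or it can be adjoined to the family.\<close>

lemma positive_basis_rat: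
  fixes Z :: "real set"
  assumes "finite Z" "\<forall>x\<in>Z. x > 0"
  shows "\<exists>m. \<exists>e. indep m e \<and> (\<forall>i<m. 0 < e i) \<and> (\<forall>x\<in>Z. cone m e x)"
  using assms
proof (induction Z rule: finite_induct)
  case empty
  show ?case by (intro exI[of _ 0]) (auto simp: indep_def)
next
  case (insert x Z)
  then obtain m e where e: "indep m e" "\<forall>i<m. e i > 0" "\<forall>x\<in>Z. cone m e x" by auto
  show ?case
  proof (cases "\<exists>q. x = (\<Sum>i<m. of_rat (q i) * e i)")
    case True
    then obtain q where "x = (\<Sum>i<m. of_rat (q i) * e i)" by blast
    from positive_basis_step[OF e(1,2) this] insert.prems
    obtain e' where "indep m e'" "\<forall>i<m. e' i > 0" "\<forall>i<m. cone m e' (e i)" "cone m e' x" by auto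
    thus ?thesis using e(3) cone_trans by (intro exI[of _ m] exI[of _ e']) blast
  next
    case False
    define e' where "e' = e(m := x)"
    have s: "(\<Sum>i<Suc m. of_rat (n i) * e' i) = (\<Sum>i<m. of_rat (n i) * e i) + of_rat (n m) * x" for n
      by (simp add: e'_def)
    have "indep (Suc m) e'" unfolding indep_def
    proof (intro allI impI)
      fix n i assume 0: "(\<Sum>i<Suc m. of_rat (n i) * e' i) = 0" and i: "i < Suc m"
      have nm: "n m = 0"
      proof (rule ccontr)
        assume n: "n m \<noteq> 0"
        have "x = - (\<Sum>i<m. of_rat (n i) * e i) / of_rat (n m)" using 0 n unfolding s by (simp add: field_simps)
        also have "\<dots> = (\<Sum>i<m. of_rat (- n i / n m) * e i)"
          by (simp add: sum_divide_distrib sum_negf of_rat_divide of_rat_minus)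
        finally have "\<exists>q. x = (\<Sum>i<m. of_rat (q i) * e i)" by (rule exI[of _ "\<lambda>i. - n i / n m"])
        thus False using False by blast
      qed
      hence "\<forall>i<m. n i = 0" using 0 e(1) unfolding s indep_def by simp
      thus "n i = 0" using nm i by (auto simp: less_Suc_eq)
    qed
    moreover have "\<forall>i<Suc m. e' i > 0" using e(2) insert.prems by (auto simp: e'_def)
    moreover have "cone (Suc m) e' y" if "cone m e y" for y
      by (rule cone_trans[OF that]) (metis cone_gen e'_def fun_upd_other less_SucI nat_less_le)
    moreover have "cone (Suc m) e' x" using cone_gen[of m "Suc m" e'] by (simp add: e'_def)
    ultimately show ?thesis using e(3) by (intro exI[of _ "Suc m"] exI[of _ e']) blast
  qed
qed

definition qindep :: "real set \<Rightarrow> bool" where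
  "qindep E \<longleftrightarrow> finite E \<and> (\<forall>n. (\<Sum>e\<in>E. of_rat (n e) * e) = 0 \<longrightarrow> (\<forall>e\<in>E. n e = 0))"

text \<open>Sums of elements of \<open>E\<close> with repetition, given as words because a word is
  also an order in which gaps can be laid out.\<close>

definition nspan :: "real set \<Rightarrow> real \<Rightarrow> bool" where
  "nspan E x \<longleftrightarrow> (\<exists>w. set w \<subseteq> E \<and> sum_list w = x)"

lemma nspan_0: "nspan E 0"
  unfolding nspan_def by (intro exI[of _ "[]"]) auto

lemma nspan_add: "nspan E x \<Longrightarrow> nspan E y \<Longrightarrow> nspan E (x + y)"
  unfolding nspan_def by (metis Un_least set_append sum_list_append)

lemma nspan_mult: "e \<in> E \<Longrightarrow> nspan E (of_nat n * e)"
  unfolding nspan_def by (intro exI[of _ "replicate n e"]) (auto simp: sum_list_replicate)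

lemma nspan_sum: "(\<And>j. j \<in> J \<Longrightarrow> nspan E (f j)) \<Longrightarrow> nspan E (sum f J)"
  by (induction J rule: infinite_finite_induct) (auto simp: nspan_0 nspan_add)

lemma common_denominator:
  assumes "finite A" "\<forall>q\<in>A. q \<ge> (0 :: rat)"
  shows "\<exists>N::nat. N > 0 \<and> (\<forall>q\<in>A. \<exists>k::nat. q * of_nat N = of_nat k)"
  using assms
proof (induction A rule: finite_induct)
  case empty show ?case by (intro exI[of _ 1]) auto
next
  case (insert q A)
  then obtain N where N: "N > 0" "\<forall>q\<in>A. \<exists>k::nat. q * of_nat N = of_nat k" by auto
  obtain a b :: int where ab: "b > 0" "q = of_int a / of_int b"
    using quotient_of_denom_pos[of q] quotient_of_div[of q] by (cases "quotient_of q") auto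
  have "a \<ge> 0" using ab insert.prems by (auto simp: zero_le_divide_iff)
  have "q * of_nat (N * nat b) = of_nat (N * nat a)" using ab \<open>a \<ge> 0\<close> by simp
  moreover have "\<exists>k::nat. p * of_nat (N * nat b) = of_nat k" if "p \<in> A" for p
  proof -
    obtain k :: nat where "p * of_nat N = of_nat k" using bspec[OF N(2) \<open>p \<in> A\<close>] by blast
    hence "p * of_nat (N * nat b) = of_nat (k * nat b)" by (simp add: mult.assoc[symmetric])
    thus ?thesis by blast
  qed
  ultimately have "\<forall>p\<in>insert q A. \<exists>k::nat. p * of_nat (N * nat b) = of_nat k" by blast
  moreover have "0 < N * nat b" using N(1) ab(1) by simp
  ultimately show ?case by blast
qed

lemma positive_basis:
  assumes "finite Z" "\<forall>x\<in>Z. x > 0" "\<epsilon> > 0"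
  shows "\<exists>E. qindep E \<and> (\<forall>e\<in>E. 0 < e \<and> e < \<epsilon>) \<and> (\<forall>x\<in>Z. nspan E x)"
proof -
  obtain m e where e: "indep m e" "\<forall>i<m. e i > 0" "\<forall>x\<in>Z. cone m e x"
    using positive_basis_rat[OF assms(1,2)] by blast
  obtain n where n: "\<And>x. x \<in> Z \<Longrightarrow> (\<forall>i<m. n x i \<ge> 0) \<and> x = (\<Sum>i<m. of_rat (n x i) * e i)"
    using e(3) unfolding cone_def by metis
  obtain N :: nat where N: "N > 0" "\<forall>q\<in>(\<lambda>(x, i). n x i) ` (Z \<times> {..<m}). \<exists>k::nat. q * of_nat N = of_nat k"
    using common_denominator[of "(\<lambda>(x, i). n x i) ` (Z \<times> {..<m})"] assms(1) n by force
  obtain K :: nat where K: "K > (\<Sum>i<m. e i) / \<epsilon>" using reals_Archimedean2 by blast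
  have sK: "(\<Sum>i<m. e i) \<ge> 0" using e(2) by (intro sum_nonneg) (auto intro: less_imp_le)
  hence K0: "K > 0" using K assms(3) by (metis divide_nonneg_pos of_nat_0 not_gr0 not_le)
  \<comment> \<open>Division by \<open>N\<close> clears the denominators of all coefficients,
    division by \<open>K\<close> brings every \<open>e i\<close> below
    \<open>\<epsilon>\<close>.\<close>
  define L where "L = real (N * K)"
  have L: "L > 0" using N K0 by (simp add: L_def)
  define E where "E = (\<lambda>i. e i / L) ` {..<m}"
  have inj: "inj_on (\<lambda>i. e i / L) {..<m}"
  proof (rule inj_onI, rule ccontr)
    fix i j assume ij: "i \<in> {..<m}" "j \<in> {..<m}" "e i / L = e j / L" "i \<noteq> j"
    let ?c = "\<lambda>k. if k = i then 1 else if k = j then -1 else (0::rat)"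
    have "(\<Sum>k<m. of_rat (?c k) * e k) = (\<Sum>k\<in>{i, j}. of_rat (?c k) * e k)"
      by (rule sum.mono_neutral_right) (use ij in auto)
    also have "\<dots> = 0" using ij L by simp
    finally have "\<forall>k<m. ?c k = 0" using e(1) unfolding indep_def by (elim allE[of _ ?c]) blast
    thus False using ij by (metis lessThan_iff one_neq_zero)
  qed
  have "qindep E" unfolding qindep_def
  proof (intro conjI allI impI)
    show "finite E" by (simp add: E_def)
    fix c assume "(\<Sum>x\<in>E. of_rat (c x) * x) = 0"
    hence "(\<Sum>i<m. of_rat (c (e i / L)) * (e i / L)) = 0" unfolding E_def by (subst (asm) sum.reindex[OF inj]) simp
    hence "(\<Sum>i<m. of_rat (c (e i / L)) * e i) / L = 0" by (simp add: sum_divide_distrib)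
    hence "(\<Sum>i<m. of_rat (c (e i / L)) * e i) = 0" using L by simp
    hence "\<forall>i<m. c (e i / L) = 0" using e(1) unfolding indep_def by (elim allE[of _ "\<lambda>i. c (e i / L)"]) blast
    thus "\<forall>x\<in>E. c x = 0" by (auto simp: E_def)
  qed
  moreover have "0 < x \<and> x < \<epsilon>" if "x \<in> E" for x
  proof -
    obtain i where i: "i < m" "x = e i / L" using \<open>x \<in> E\<close> by (auto simp: E_def)
    have "e i \<le> (\<Sum>i<m. e i)" using e(2) i by (intro member_le_sum) (auto intro: less_imp_le)
    also have "\<dots> < K * \<epsilon>" using K assms(3) by (simp add: field_simps)
    also have "\<dots> \<le> L * \<epsilon>"
      using N(1) assms(3) unfolding L_def by (intro mult_right_mono) (auto simp flip: of_nat_mult)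
    finally have "e i / L < \<epsilon>" using L by (simp add: divide_less_eq mult.commute)
    thus ?thesis using i e(2) L by simp
  qed
  moreover have "nspan E x" if "x \<in> Z" for x
  proof -
    have "x = (\<Sum>i<m. of_rat (n x i) * e i)" using n[OF that] by blast
    also have "\<dots> = (\<Sum>i<m. of_rat (n x i * of_nat N * of_nat K) * (e i / L))"
      using N(1) K0 by (intro sum.cong refl) (simp add: of_rat_mult L_def)
    also have "nspan E \<dots>"
    proof (rule nspan_sum)
      fix i assume i: "i \<in> {..<m}"
      obtain k :: nat where "n x i * of_nat N = of_nat k" using N(2) i \<open>x \<in> Z\<close> by force
      hence "(of_rat (n x i * of_nat N * of_nat K) :: real) = of_nat (k * K)" by (simp add: of_rat_mult)
      thus "nspan E (of_rat (n x i * of_nat N * of_nat K) * (e i / L))"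
        using nspan_mult[of "e i / L" E "k * K"] i unfolding E_def by (simp only:) blast
    qed
    finally show ?thesis .
  qed
  ultimately show ?thesis by blast
qed

interpretation Q: vector_space "\<lambda>(q::rat) (x::real). of_rat q * x"
  by standard (auto simp: of_rat_add of_rat_mult algebra_simps)

text \<open>The coordinate at \<open>e\<close> with respect to a Hamel basis of the reals over the
  rationals that contains \<open>E\<close>.\<close>

lemma dual_functional:
  assumes "qindep E" "e \<in> E"
  shows "\<exists>\<phi> :: real \<Rightarrow> rat. (\<forall>x y. \<phi> (x + y) = \<phi> x + \<phi> y) \<and> \<phi> e = 1 \<and> (\<forall>e'\<in>E. e' \<noteq> e \<longrightarrow> \<phi> e' = 0)"
proof -
  have ind: "Q.independent E"
    using assms(1) by (intro Q.independent_if_scalars_zero) (auto simp: qindep_def)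
  let ?B = "Q.extend_basis E"
  have B: "Q.independent ?B" "Q.span ?B = UNIV" "E \<subseteq> ?B"
    using Q.independent_extend_basis[OF ind] Q.span_extend_basis[OF ind] Q.extend_basis_superset[OF ind] by auto
  show ?thesis
  proof (intro exI[of _ "\<lambda>x. Q.representation ?B x e"] conjI allI ballI impI)
    fix x y show "Q.representation ?B (x + y) e = Q.representation ?B x e + Q.representation ?B y e"
      using Q.representation_add[OF B(1), of y x] B(2) by simp
  next
    show "Q.representation ?B e e = 1" using Q.representation_basis[OF B(1), of e] B(3) assms(2) by auto
  next
    fix e' assume "e' \<in> E" "e' \<noteq> e"
    thus "Q.representation ?B e' e = 0" using Q.representation_basis[OF B(1), of e'] B(3) by auto
  qed
qed

text \<open>Counting occurrences turns two words of equal sum into a rational relation on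
  \<open>E\<close> whose coefficients are the differences of multiplicities.\<close>

lemma qindep_mset_eq:
  assumes E: "qindep E" and w: "set w \<subseteq> E" "set w' \<subseteq> E" "sum_list w = sum_list w'"
  shows "mset w = mset w'"
proof (rule multiset_eqI)
  fix x
  have fE: "finite E" using E by (simp add: qindep_def)
  have s: "sum_list v = (\<Sum>e\<in>E. of_rat (of_nat (count (mset v) e)) * e)" if "set v \<subseteq> E" for v
    using that
  proof (induction v)
    case (Cons a v)
    have "(\<Sum>e\<in>E. of_rat (of_nat (count (mset (a # v)) e)) * e) =
      (\<Sum>e\<in>E. of_rat (of_nat (count (mset v) e)) * e + (if e = a then e else 0))"
      by (intro sum.cong) (auto simp: algebra_simps)
    thus ?case using Cons fE by (simp add: sum.distrib sum.delta)
  qed simp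
  let ?n = "\<lambda>e. of_nat (count (mset w) e) - of_nat (count (mset w') e) :: rat"
  have "(\<Sum>e\<in>E. of_rat (?n e) * e) = 0"
    using s[OF w(1)] s[OF w(2)] w(3) by (simp add: of_rat_diff algebra_simps sum_subtractf)
  hence n: "\<forall>e\<in>E. ?n e = 0" using E unfolding qindep_def by (elim conjE allE[of _ ?n]) blast
  show "count (mset w) x = count (mset w') x"
  proof (cases "x \<in> E")
    case True thus ?thesis using n by auto
  next
    case False
    hence "x \<notin> set w" "x \<notin> set w'" using w by auto
    thus ?thesis by (metis count_mset_0_iff)
  qed
qed

section \<open>Refining a grid\<close>

text \<open>Asking for a larger \<open>y\<close> leaves out the last point of the grid, whose gap is
  junk.\<close>

definition grid_gaps :: "real set \<Rightarrow> real set \<Rightarrow> bool" where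
  "grid_gaps E C \<longleftrightarrow> (\<forall>x\<in>C. \<forall>y\<in>C. x < y \<longrightarrow> gap C x \<in> E)"

lemma nx_eqI: "finite C \<Longrightarrow> y \<in> C \<Longrightarrow> x < y \<Longrightarrow> (\<And>c. c \<in> C \<Longrightarrow> x < c \<Longrightarrow> y \<le> c) \<Longrightarrow> nx C x = y"
  unfolding nx_def by (rule Min_eqI) auto

lemma grid_extend:
  assumes "finite C" "b \<in> C" "\<forall>c\<in>C. c \<le> b" "grid_gaps E C" "set w \<subseteq> E" "\<forall>e\<in>E. e > 0"
  shows "\<exists>C'. finite C' \<and> C \<subseteq> C' \<and> b + sum_list w \<in> C' \<and> (\<forall>c\<in>C'. c \<le> b + sum_list w) \<and> grid_gaps E C'"
  using assms
proof (induction w arbitrary: C b)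
  case Nil thus ?case by auto
next
  case (Cons t w)
  let ?C = "insert (b + t) C"
  have t: "t > 0" "t \<in> E" using Cons.prems by auto
  have "grid_gaps E ?C" unfolding grid_gaps_def
  proof (intro ballI impI)
    fix x y assume xy: "x \<in> ?C" "y \<in> ?C" "x < y"
    have x: "x \<in> C" using xy Cons.prems(3) t by auto
    show "gap ?C x \<in> E"
    proof (cases "x = b")
      case True
      have "nx ?C x = b + t" by (rule nx_eqI) (use True Cons.prems t in force)+
      thus ?thesis using True t by (simp add: gap_def)
    next
      case False
      hence xb: "x < b" using x Cons.prems(3) by force
      note n = nx_props[OF Cons.prems(1,2) xb]
      have "nx ?C x = nx C x" by (rule nx_eqI) (use n Cons.prems(1) t xb in auto)
      thus ?thesis using Cons.prems(2,4) x xb by (auto simp: grid_gaps_def gap_def)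
    qed
  qed
  hence "\<exists>C'. finite C' \<and> ?C \<subseteq> C' \<and> (b + t) + sum_list w \<in> C' \<and> (\<forall>c\<in>C'. c \<le> (b + t) + sum_list w) \<and> grid_gaps E C'"
  proof (intro Cons.IH)
    show "\<forall>c\<in>?C. c \<le> b + t" using Cons.prems(3) t by (auto intro: add_increasing2)
  qed (use Cons.prems t in auto)
  then obtain C' where "finite C'" "?C \<subseteq> C'" "b + t + sum_list w \<in> C'" "\<forall>c\<in>C'. c \<le> b + t + sum_list w" "grid_gaps E C'"
    by blast
  thus ?case by (intro exI[of _ C']) (simp add: add.assoc)
qed

text \<open>The intervals between consecutive points of \<open>C\<close> are filled from left to
  right. The clause that bounds \<open>C'\<close> by members of \<open>C\<close> carries the
  induction: it keeps \<open>Max A\<close> the largest point so far, from which the next interval is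
  filled.\<close>

lemma grid_refine:
  assumes "finite C" "\<forall>x\<in>C. \<forall>y\<in>C. x < y \<longrightarrow> nspan E (y - x)" "\<forall>e\<in>E. e > 0"
  shows "\<exists>C'. finite C' \<and> C \<subseteq> C' \<and> (\<forall>c\<in>C'. \<exists>b\<in>C. c \<le> b) \<and> grid_gaps E C'"
  using assms
proof (induction C rule: finite_linorder_max_induct)
  case empty show ?case by (intro exI[of _ "{}"]) (auto simp: grid_gaps_def)
next
  case (insert b A)
  then obtain C where C: "finite C" "A \<subseteq> C" "\<forall>c\<in>C. \<exists>b\<in>A. c \<le> b" "grid_gaps E C" by auto
  show ?case
  proof (cases "A = {}")
    case True
    thus ?thesis by (intro exI[of _ "{b}"]) (auto simp: grid_gaps_def)
  next
    case False
    let ?a = "Max A"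
    have a: "?a \<in> A" "\<forall>x\<in>A. x \<le> ?a" using insert(1) False by auto
    hence "nspan E (b - ?a)" using insert.prems insert(2) by auto
    then obtain w where w: "set w \<subseteq> E" "sum_list w = b - ?a" by (auto simp: nspan_def)
    have "\<forall>c\<in>C. c \<le> ?a" using C(3) a(2) by force
    from grid_extend[OF C(1) _ this C(4) w(1)] a C(2) insert.prems
    obtain C' where "finite C'" "C \<subseteq> C'" "?a + sum_list w \<in> C'" "\<forall>c\<in>C'. c \<le> ?a + sum_list w" "grid_gaps E C'"
      by blast
    thus ?thesis using w C(2) by (intro exI[of _ C']) auto
  qed
qed

lemma grid_refine_small:
  assumes "finite C" "\<epsilon> > 0"
  shows "\<exists>E C'. qindep E \<and> (\<forall>e\<in>E. 0 < e \<and> e < \<epsilon>) \<and> finite C' \<and> C \<subseteq> C' \<and> grid_gaps E C'"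
proof -
  let ?Z = "(\<lambda>(x, y). y - x) ` {(x, y) \<in> C \<times> C. x < y}"
  have "finite (C \<times> C)" using assms(1) by simp
  hence "finite {(x, y) \<in> C \<times> C. x < y}" by (rule rev_finite_subset) auto
  hence "finite ?Z" by (rule finite_imageI)
  from positive_basis[OF this _ assms(2)]
  obtain E where E: "qindep E" "\<forall>e\<in>E. 0 < e \<and> e < \<epsilon>" "\<forall>x\<in>?Z. nspan E x" by auto
  have "\<forall>x\<in>C. \<forall>y\<in>C. x < y \<longrightarrow> nspan E (y - x)" using E(3) by force
  from grid_refine[OF assms(1) this] E(2) obtain C' where "finite C'" "C \<subseteq> C'" "grid_gaps E C'" by blast
  thus ?thesis using E by blast
qed

section \<open>Swaps and shuffles\<close>

context mrect begin

text \<open>Boxes by corner and side lengths: a translate keeps its second argument.\<close>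

definition box_at :: "real list \<Rightarrow> real list \<Rightarrow> real list set" where
  "box_at a ts = {x. length x = d \<and> (\<forall>i<d. a ! i \<le> x ! i \<and> x ! i < a ! i + ts ! i)}"

definition axis_vec :: "nat \<Rightarrow> real \<Rightarrow> real list" where
  "axis_vec i t = (replicate d 0)[i := t]"

lemma axis_vec_length [simp]: "length (axis_vec i t) = d" by (simp add: axis_vec_def)

lemma axis_vec_nth: "j < d \<Longrightarrow> axis_vec i t ! j = (if j = i then t else 0)"
  by (simp add: axis_vec_def nth_list_update)

lemma box_at_box: "length a = d \<Longrightarrow> length ts = d \<Longrightarrow> box_at a ts = box_d d a (vadd a ts)"
  by (auto simp: box_at_def box_d_def)

lemma box_at_len: "x \<in> box_at a ts \<Longrightarrow> length x = d"
  by (simp add: box_at_def)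

lemma cell_box_at: "length p = d \<Longrightarrow> cell d C p = box_at p (map (gap C) p)"
  by (auto simp: box_at_def cell_def box_d_def gap_def)

lemma box_at_shift:
  assumes "length a = d" "length v = d"
  shows "x \<in> box_at a ts \<Longrightarrow> vadd x v \<in> box_at (vadd a v) ts"
    "x \<in> box_at (vadd a v) ts \<Longrightarrow> vdiff x v \<in> box_at a ts"
  using assms by (auto simp: box_at_def)

lemma vadd_vdiff_cancel:
  "length x = d \<Longrightarrow> length v = d \<Longrightarrow> vadd (vdiff x v) v = x"
  "length x = d \<Longrightarrow> length v = d \<Longrightarrow> vdiff (vadd x v) v = x"
  by (rule nth_equalityI; simp)+

lemma vadd_assoc: "vadd (vadd x v) w = vadd x (vadd v w)"
  by (rule nth_equalityI) auto

lemma vadd_commute: "vadd x v = vadd v x"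
  by (rule nth_equalityI) auto

text \<open>A criterion for maps given by explicit formulas. Bijectivity on \<open>M\<close> is
  inherited from the whole type, since \<open>f\<close> maps \<open>M\<close> into \<open>M\<close>
  and fixes all other points.\<close>

lemma recgI_boxes:
  assumes I: "finite I" "\<And>j. j \<in> I \<Longrightarrow> length (a j) = d \<and> length (ts j) = d \<and> (\<forall>i<d. ts j ! i > 0) \<and> length (r j) = d"
    and f: "\<And>j x. j \<in> I \<Longrightarrow> x \<in> box_at (a j) (ts j) \<Longrightarrow> f x = vadd x (r j)"
    and out: "\<And>x. (\<forall>j\<in>I. x \<notin> box_at (a j) (ts j)) \<Longrightarrow> f x = x"
    and sub: "\<And>j. j \<in> I \<Longrightarrow> box_at (a j) (ts j) \<subseteq> M" "\<And>j. j \<in> I \<Longrightarrow> box_at (vadd (a j) (r j)) (ts j) \<subseteq> M"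
    and inj: "inj f" and surj: "surj f"
  shows "is_rec f"
  unfolding is_rec_def
proof (intro conjI)
  show fo: "\<forall>x. x \<notin> M \<longrightarrow> f x = x" using out sub(1) by blast
  have fM: "f x \<in> M" if "x \<in> M" for x
  proof (cases "\<exists>j\<in>I. x \<in> box_at (a j) (ts j)")
    case True
    then obtain j where j: "j \<in> I" "x \<in> box_at (a j) (ts j)" by blast
    thus ?thesis using box_at_shift(1)[of "a j" "r j" x "ts j"] I(2)[OF j(1)] sub(2)[OF j(1)] f[OF j] by auto
  qed (use out that in auto)
  have "f ` M = M"
  proof
    show "f ` M \<subseteq> M" using fM by blast
    show "M \<subseteq> f ` M"
    proof
      fix y assume y: "y \<in> M"
      obtain x where x: "y = f x" using surj by blast
      have "x \<in> M" using fo x y by (cases "x \<in> M") auto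
      thus "y \<in> f ` M" using x by blast
    qed
  qed
  thus "bij_betw f M M" using inj by (auto simp: bij_betw_def inj_on_def inj_def)
  obtain C0 where C0: "gridset d C0 M" using M_grid by blast
  define C where "C = C0 \<union> (\<Union>j\<in>I. set (a j) \<union> set (vadd (a j) (ts j)))"
  have fin: "finite C" using gridset_finite[OF C0] I(1) by (auto simp: C_def)
  have M: "gridset d C M" by (rule gridset_mono[OF C0 _ fin]) (auto simp: C_def)
  have B: "gridset d C (box_at (a j) (ts j))" if "j \<in> I" for j
    using I(2)[OF that] that fin by (auto simp: box_at_box rect_data_def C_def intro!: gridset_box)
  have "adapted C f" unfolding adapted_def
  proof (intro conjI ballI allI impI M)
    fix x y assume x: "x \<in> M" and e: "ceq C x y"
    have l: "length x = d" "length y = d" using M_len x ceq_length[OF e] by auto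
    have iff: "y \<in> box_at (a j) (ts j) \<longleftrightarrow> x \<in> box_at (a j) (ts j)" if "j \<in> I" for j
      using gridset_ceq[OF B[OF that]] e ceq_sym[OF e] by blast
    show "disp f x = disp f y"
    proof (cases "\<exists>j\<in>I. x \<in> box_at (a j) (ts j)")
      case True
      then obtain j where j: "j \<in> I" "x \<in> box_at (a j) (ts j)" by blast
      hence "f x = vadd x (r j)" "f y = vadd y (r j)" using f iff by blast+
      thus ?thesis using l I(2)[OF j(1)] by (simp add: disp_def vdiff_vadd)
    next
      case False
      hence "f x = x" "f y = y" using out iff by blast+
      thus ?thesis using l by (intro nth_equalityI) (auto simp: disp_def)
    qed
  qed
  thus "\<exists>C. adapted C f" by blast
qed

definition swap_map :: "real list \<Rightarrow> real list \<Rightarrow> real list \<Rightarrow> real list \<Rightarrow> real list" where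
  "swap_map a ts v x = (if x \<in> box_at a ts then vadd x v else if x \<in> box_at (vadd a v) ts then vdiff x v else x)"

definition swap_data :: "real list \<Rightarrow> real list \<Rightarrow> real list \<Rightarrow> bool" where
  "swap_data a ts v \<longleftrightarrow> length a = d \<and> length ts = d \<and> length v = d \<and> (\<forall>i<d. ts ! i > 0) \<and>
     box_at a ts \<subseteq> M \<and> box_at (vadd a v) ts \<subseteq> M \<and> box_at a ts \<inter> box_at (vadd a v) ts = {}"

lemma swap_map_swap_map: assumes "swap_data a ts v" shows "swap_map a ts v (swap_map a ts v x) = x"
proof -
  have l: "length a = d" "length v = d" using assms by (auto simp: swap_data_def)
  consider "x \<in> box_at a ts" | "x \<in> box_at (vadd a v) ts" | "x \<notin> box_at a ts" "x \<notin> box_at (vadd a v) ts" by blast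
  thus ?thesis
  proof cases
    case 1
    hence "vadd x v \<in> box_at (vadd a v) ts" using box_at_shift(1)[OF l] by blast
    moreover have "vadd x v \<notin> box_at a ts" using calculation assms by (auto simp: swap_data_def)
    ultimately show ?thesis using 1 box_at_len[OF 1] l by (simp add: swap_map_def vadd_vdiff_cancel)
  next
    case 2
    hence "vdiff x v \<in> box_at a ts" using box_at_shift(2)[OF l] by blast
    moreover have "x \<notin> box_at a ts" using 2 assms by (auto simp: swap_data_def)
    ultimately show ?thesis using 2 box_at_len[OF 2] l by (simp add: swap_map_def vadd_vdiff_cancel)
  qed (simp add: swap_map_def)
qed

lemma swap_map_comp: "swap_data a ts v \<Longrightarrow> swap_map a ts v \<circ> swap_map a ts v = id"
  by (auto simp: swap_map_swap_map)

lemma swap_map_is_rec: assumes "swap_data a ts v" shows "is_rec (swap_map a ts v)"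
proof (rule recgI_boxes[where I = "{True, False}" and a = "\<lambda>c. if c then a else vadd a v"
     and ts = "\<lambda>_. ts" and r = "\<lambda>c. if c then v else map uminus v"])
  show "inj (swap_map a ts v)" "surj (swap_map a ts v)" using swap_map_swap_map[OF assms] by (metis injI, metis surjI)
next
  fix j x assume "j \<in> {True, False}" and x: "x \<in> box_at (if j then a else vadd a v) ts"
  have "x \<notin> box_at a ts" "vdiff x v = vadd x (map uminus v)" if "\<not> j"
    using that x assms box_at_len[OF x] by (auto simp: swap_data_def intro!: nth_equalityI)
  thus "swap_map a ts v x = vadd x (if j then v else map uminus v)" using x by (auto simp: swap_map_def)
next
  fix j assume "j \<in> {True, False}"
  have "vadd (vadd a v) (map uminus v) = a" using assms by (intro nth_equalityI) (auto simp: swap_data_def)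
  thus "box_at (vadd (if j then a else vadd a v) (if j then v else map uminus v)) ts \<subseteq> M"
    using assms by (auto simp: swap_data_def)
qed (use assms in \<open>auto simp: swap_data_def swap_map_def\<close>)

text \<open>
  The exchange of two adjacent boxes along axis \<open>i\<close>: the first has corner \<open>a\<close> and sides \<open>ts\<close>,
  the second differs from it only by its side \<open>t\<close> along axis \<open>i\<close>.
\<close>
definition shuffle :: "nat \<Rightarrow> real list \<Rightarrow> real list \<Rightarrow> real \<Rightarrow> real list \<Rightarrow> real list" where
  "shuffle i a ts t x = (if x \<in> box_at a (ts[i := ts ! i + t])
     then x[i := if x ! i < a ! i + ts ! i then x ! i + t else x ! i - ts ! i] else x)"

definition shuffle_data :: "nat \<Rightarrow> real list \<Rightarrow> real list \<Rightarrow> real \<Rightarrow> bool" where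
  "shuffle_data i a ts t \<longleftrightarrow> i < d \<and> length a = d \<and> length ts = d \<and> (\<forall>i<d. ts ! i > 0) \<and> t > 0 \<and>
     box_at a (ts[i := ts ! i + t]) \<subseteq> M"

lemma box_at_upd:
  assumes "x \<in> box_at a ts" "i < d" "a ! i \<le> t" "t < a ! i + ts ! i"
  shows "x[i := t] \<in> box_at a ts"
  using assms by (auto simp: box_at_def nth_list_update)

text \<open>The data of the inverse shuffle, in which the two lengths are interchanged; this is the
  source of the antisymmetry of the values of T.\<close>

lemma shuffle_data_inverse: "shuffle_data i a ts t \<Longrightarrow> shuffle_data i a (ts[i := t]) (ts ! i)"
  by (auto simp: shuffle_data_def nth_list_update add.commute)

lemma shuffle_box_at: assumes "shuffle_data i a ts t" "x \<in> box_at a (ts[i := ts ! i + t])"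
  shows "shuffle i a ts t x \<in> box_at a (ts[i := ts ! i + t])"
proof -
  have i: "i < d" "length ts = d" "t > 0" "ts ! i > 0" using assms by (auto simp: shuffle_data_def)
  have "a ! i \<le> x ! i" "x ! i < a ! i + (ts ! i + t)" using assms(2) i by (auto simp: box_at_def dest: spec[of _ i])
  thus ?thesis unfolding shuffle_def using assms(2) i
    by (simp add: box_at_upd)
qed

lemma shuffle_inverse:
  assumes "shuffle_data i a ts t" shows "shuffle i a (ts[i := t]) (ts ! i) (shuffle i a ts t x) = x"
proof (cases "x \<in> box_at a (ts[i := ts ! i + t])")
  case True
  have i: "i < d" "length ts = d" "t > 0" "ts ! i > 0" using assms by (auto simp: shuffle_data_def)
  have x: "a ! i \<le> x ! i" "x ! i < a ! i + (ts ! i + t)" "length x = d" using True i by (auto simp: box_at_def dest: spec[of _ i])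
  have "ts[i := t, i := ts[i := t] ! i + ts ! i] = ts[i := ts ! i + t]" using i by (simp add: add.commute)
  thus ?thesis using shuffle_box_at[OF assms True] True x i
    by (auto simp: shuffle_def)
next
  case False thus ?thesis using assms by (auto simp: shuffle_def shuffle_data_def add.commute)
qed

lemma shuffle_comp: "shuffle_data i a ts t \<Longrightarrow> shuffle i a (ts[i := t]) (ts ! i) \<circ> shuffle i a ts t = id"
  by (auto simp: shuffle_inverse)

lemma box_at_split:
  assumes "i < d" "length a = d" "length ts = d" "s > 0" "t > 0"
  shows "x \<in> box_at a (ts[i := s + t]) \<longleftrightarrow> x \<in> box_at a (ts[i := s]) \<or> x \<in> box_at (vadd a (axis_vec i s)) (ts[i := t])"
    "x \<in> box_at a (ts[i := s]) \<longleftrightarrow> x \<in> box_at a (ts[i := s + t]) \<and> x ! i < a ! i + s"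
    "x \<in> box_at (vadd a (axis_vec i s)) (ts[i := t]) \<longleftrightarrow> x \<in> box_at a (ts[i := s + t]) \<and> \<not> x ! i < a ! i + s"
proof -
  have nth: "ts[i := r] ! j = (if j = i then r else ts ! j)" "vadd a (axis_vec i s) ! j = (if j = i then a ! i + s else a ! j)"
    if "j < d" for r j using that assms by (auto simp: axis_vec_nth nth_list_update)
  have m: "x \<in> box_at b (ts[i := r]) \<longleftrightarrow> length x = d \<and> (\<forall>j<d. j \<noteq> i \<longrightarrow> b ! j \<le> x ! j \<and> x ! j < b ! j + ts ! j) \<and>
     b ! i \<le> x ! i \<and> x ! i < b ! i + r" for b r
    using assms(1) unfolding box_at_def by (auto simp: nth split: if_splits)
  have e: "(\<forall>j<d. j \<noteq> i \<longrightarrow> vadd a (axis_vec i s) ! j \<le> x ! j \<and> x ! j < vadd a (axis_vec i s) ! j + ts ! j) \<longleftrightarrow>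
      (\<forall>j<d. j \<noteq> i \<longrightarrow> a ! j \<le> x ! j \<and> x ! j < a ! j + ts ! j)" using nth(2) by simp
  show 1: "x \<in> box_at a (ts[i := s]) \<longleftrightarrow> x \<in> box_at a (ts[i := s + t]) \<and> x ! i < a ! i + s"
    unfolding m using assms(4,5) by argo
  show 2: "x \<in> box_at (vadd a (axis_vec i s)) (ts[i := t]) \<longleftrightarrow> x \<in> box_at a (ts[i := s + t]) \<and> \<not> x ! i < a ! i + s"
    unfolding m e nth(2)[OF assms(1)] using assms(4,5) by (simp; argo)
  show "x \<in> box_at a (ts[i := s + t]) \<longleftrightarrow> x \<in> box_at a (ts[i := s]) \<or> x \<in> box_at (vadd a (axis_vec i s)) (ts[i := t])"
    unfolding 1 2 by blast
qed

lemma shuffle_pieces: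
  assumes "shuffle_data i a ts t"
  shows "x \<in> box_at a ts \<Longrightarrow> shuffle i a ts t x = vadd x (axis_vec i t)"
    "x \<in> box_at (vadd a (axis_vec i (ts ! i))) (ts[i := t]) \<Longrightarrow> shuffle i a ts t x = vadd x (axis_vec i (- ts ! i))"
    "x \<notin> box_at a ts \<Longrightarrow> x \<notin> box_at (vadd a (axis_vec i (ts ! i))) (ts[i := t]) \<Longrightarrow> shuffle i a ts t x = x"
proof -
  have i: "i < d" "length a = d" "length ts = d" "t > 0" "ts ! i > 0" using assms by (auto simp: shuffle_data_def)
  note b = box_at_split[OF i(1,2,3,5,4)]
  have "ts[i := ts ! i] = ts" by simp
  note b = b[unfolded this]
  show "x \<in> box_at a ts \<Longrightarrow> shuffle i a ts t x = vadd x (axis_vec i t)"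
    using box_at_len[of x a ts] i by (intro nth_equalityI) (simp_all add: shuffle_def b(2) axis_vec_nth nth_list_update)
  show "x \<in> box_at (vadd a (axis_vec i (ts ! i))) (ts[i := t]) \<Longrightarrow> shuffle i a ts t x = vadd x (axis_vec i (- ts ! i))"
    using box_at_len[of x "vadd a (axis_vec i (ts ! i))" "ts[i := t]"] i
    by (intro nth_equalityI) (simp_all add: shuffle_def b(3) axis_vec_nth nth_list_update)
  show "x \<notin> box_at a ts \<Longrightarrow> x \<notin> box_at (vadd a (axis_vec i (ts ! i))) (ts[i := t]) \<Longrightarrow> shuffle i a ts t x = x"
    by (simp add: shuffle_def b(1))
qed

lemma shuffle_is_rec: assumes "shuffle_data i a ts t" shows "is_rec (shuffle i a ts t)"
proof (rule recgI_boxes[where I = "{True, False}" and a = "\<lambda>c. if c then a else vadd a (axis_vec i (ts ! i))"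
     and ts = "\<lambda>c. if c then ts else ts[i := t]" and r = "\<lambda>c. if c then axis_vec i t else axis_vec i (- ts ! i)"])
  have i: "i < d" "length a = d" "length ts = d" "t > 0" "ts ! i > 0" using assms by (auto simp: shuffle_data_def)
  note b = box_at_split[OF i(1,2,3,5,4), unfolded list_update_id]
  show "inj (shuffle i a ts t)" using shuffle_inverse[OF assms] by (metis injI)
  have "shuffle i a ts t (shuffle i a (ts[i := t]) (ts ! i) y) = y" for y
    using shuffle_inverse[OF shuffle_data_inverse[OF assms]] i by simp
  thus "surj (shuffle i a ts t)" by (metis surjI)
  have sub: "box_at a ts \<subseteq> M" "box_at (vadd a (axis_vec i (ts ! i))) (ts[i := t]) \<subseteq> M"
    using assms b by (auto simp: shuffle_data_def)
  note b' = box_at_split[OF i(1,2,3,4,5)]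
  have "box_at (vadd a (axis_vec i t)) (ts[i := ts ! i]) \<subseteq> M" "box_at a (ts[i := t]) \<subseteq> M"
    using b' assms by (auto simp: shuffle_data_def add.commute)
  moreover have "vadd (vadd a (axis_vec i (ts ! i))) (axis_vec i (- ts ! i)) = a"
    using i by (intro nth_equalityI) (auto simp: axis_vec_nth)
  ultimately show "box_at (vadd (if j then a else vadd a (axis_vec i (ts ! i))) (if j then axis_vec i t else axis_vec i (- ts ! i))) (if j then ts else ts[i := t]) \<subseteq> M"
    for j by simp
  show "box_at (if j then a else vadd a (axis_vec i (ts ! i))) (if j then ts else ts[i := t]) \<subseteq> M" for j
    using sub by simp
  show "length (if j then a else vadd a (axis_vec i (ts ! i))) = d \<and> length (if j then ts else ts[i := t]) = d \<and>
    (\<forall>k<d. (if j then ts else ts[i := t]) ! k > 0) \<and> length (if j then axis_vec i t else axis_vec i (- ts ! i)) = d" for j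
    using assms i by (auto simp: shuffle_data_def nth_list_update)
qed (use shuffle_pieces[OF assms] in \<open>auto split: if_splits\<close>)

text \<open>One box moves by \<open>t\<close> and the other by \<open>- ts ! i\<close>, both along
  axis \<open>i\<close> only. As \<open>swap_fac\<close> puts the length along axis \<open>i\<close>
  last, the value is an element \<open>u \<otimes> (s \<otimes> t - t \<otimes> s)\<close> with
  \<open>s = ts ! i\<close>.\<close>

lemma T_shuffle:
  assumes s: "shuffle_data i a ts t" and j: "j < d"
  shows "T_comp d M (shuffle i a ts t) j = (if j = i
     then cl (Suc d) (delta (swap_fac d i ts @ [t]) - delta (swap_fac d i (ts[i := t]) @ [ts ! i]))
     else \<one>\<^bsub>TP (Suc d)\<^esub>)"
proof -
  have i: "i < d" "length a = d" "length ts = d" "t > 0" "ts ! i > 0" and pos: "\<forall>k<d. ts ! k > 0"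
    using s by (auto simp: shuffle_data_def)
  let ?a = "\<lambda>c. if c then a else vadd a (axis_vec i (ts ! i))" and ?ts = "\<lambda>c. if c then ts else ts[i := t]"
  let ?r = "\<lambda>c. if c then axis_vec i t else axis_vec i (- ts ! i)"
  let ?b = "\<lambda>c. vadd (?a c) (?ts c)"
  note b = box_at_split[OF i(1,2,3,5,4), unfolded list_update_id]
  have box_at: "box_d d (?a c) (?b c) = box_at (?a c) (?ts c)" for c using i by (simp add: box_at_box)
  have sub: "box_at (?a c) (?ts c) \<subseteq> M" for c using s b by (auto simp: shuffle_data_def)
  have "T_comp d M (shuffle i a ts t) j = cl (Suc d) (\<Sum>c\<in>{True, False}. delta (swap_fac d j (vdiff (?b c) (?a c)) @ [?r c ! j]))"
  proof (rule T_comp_boxes[OF shuffle_is_rec[OF s] j])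
    show "rect_data d (?a c) (?b c)" for c using i pos by (auto simp: rect_data_def nth_list_update)
    show "box_d d (?a c) (?b c) \<subseteq> M" for c unfolding box_at using sub .
    show "c \<noteq> c' \<Longrightarrow> box_d d (?a c) (?b c) \<inter> box_d d (?a c') (?b c') = {}" for c c' unfolding box_at using b by auto
    show "disp (shuffle i a ts t) x = ?r c" if x: "x \<in> box_d d (?a c) (?b c)" for c x
      using shuffle_pieces[OF s, of x] x box_at_len[of x] unfolding box_at by (auto simp: disp_def vdiff_vadd split: if_splits)
    show "shuffle i a ts t x = x" if "\<forall>c\<in>{True, False}. x \<notin> box_d d (?a c) (?b c)" for x
      using shuffle_pieces(3)[OF s, of x] that unfolding box_at by auto
  qed simp
  also have "(\<Sum>c\<in>{True, False}. delta (swap_fac d j (vdiff (?b c) (?a c)) @ [?r c ! j])) =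
      delta (swap_fac d j ts @ [axis_vec i t ! j]) + delta (swap_fac d j (ts[i := t]) @ [axis_vec i (- ts ! i) ! j])"
    using i by (simp add: vdiff_vadd)
  also have "cl (Suc d) \<dots> = (if j = i
     then cl (Suc d) (delta (swap_fac d i ts @ [t]) - delta (swap_fac d i (ts[i := t]) @ [ts ! i]))
     else \<one>\<^bsub>TP (Suc d)\<^esub>)"
  proof (cases "j = i")
    case True
    let ?w = "swap_fac d i (ts[i := t])"
    have 1: "delta (?w @ [ts ! i + (- ts ! i)] @ []) - delta (?w @ [ts ! i] @ []) - delta (?w @ [- ts ! i] @ []) \<in> tensor_rel (Suc d)"
      using madd_delta[of "Suc d", unfolded madd_def, rule_format, of ?w "[]" "ts ! i" "- ts ! i"] i by simp
    have 2: "delta (?w @ [0]) \<in> tensor_rel (Suc d)" using delta_zero[of ?w d] i by simp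
    \<comment> \<open>Converts the last factor \<open>- ts ! i\<close> into a minus sign:
      \<open>x\<close>, \<open>y\<close> and \<open>z\<close> stand for the tensors with last factor
      \<open>0\<close>, \<open>ts ! i\<close> and \<open>- ts ! i\<close>.\<close>
    have "(x - y - z) \<in> tensor_rel (Suc d) \<Longrightarrow> x \<in> tensor_rel (Suc d) \<Longrightarrow> (u + z) - (u - y) \<in> tensor_rel (Suc d)" for x y z u
      using asub_diff[OF tensor_rel_asub, of x "Suc d" "x - y - z"] by (simp add: algebra_simps)
    from this[OF 1] 2 show ?thesis using True i by (simp add: cl_eq_iff axis_vec_nth)
  next
    case False
    thus ?thesis using j i delta_zero[of "swap_fac d j ts" d] delta_zero[of "swap_fac d j (ts[i := t])" d]
      by (simp add: cl_one cl_eq_iff axis_vec_nth asub_add[OF tensor_rel_asub])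
  qed
  finally show ?thesis .
qed

text \<open>If \<open>g\<close> translates both boxes, it conjugates their swap to the swap of the
  image boxes. The two translations may differ, which changes the vector between the boxes by
  \<open>w' - w\<close>.\<close>

lemma swap_map_conj:
  assumes g: "is_rec g" and s: "swap_data a ts v" and l: "length w = d" "length w' = d"
    and t1: "\<And>x. x \<in> box_at a ts \<Longrightarrow> g x = vadd x w" and t2: "\<And>x. x \<in> box_at (vadd a v) ts \<Longrightarrow> g x = vadd x w'"
    and v': "v' = vdiff (vadd v w') w"
  shows "g \<circ> swap_map a ts v = swap_map (vadd a w) ts v' \<circ> g"
proof
  fix x
  have la: "length a = d" "length v = d" using s by (auto simp: swap_data_def)
  have e: "vadd (vadd a w) v' = vadd (vadd a v) w'" unfolding v' using la l by (intro nth_equalityI) auto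
  have i1: "g x \<in> box_at (vadd a w) ts \<longleftrightarrow> x \<in> box_at a ts" for x
  proof
    assume "g x \<in> box_at (vadd a w) ts"
    hence "vdiff (g x) w \<in> box_at a ts" using box_at_shift(2) la l by blast
    moreover from t1[OF this] have "g (vdiff (g x) w) = g x" using vadd_vdiff_cancel(1)[OF box_at_len l(1)]
      \<open>g x \<in> box_at (vadd a w) ts\<close> by simp
    ultimately show "x \<in> box_at a ts" using is_rec_inj[OF g] by metis
  qed (use t1 box_at_shift(1) la l in auto)
  have i2: "g x \<in> box_at (vadd (vadd a v) w') ts \<longleftrightarrow> x \<in> box_at (vadd a v) ts" for x
  proof
    assume "g x \<in> box_at (vadd (vadd a v) w') ts"
    hence "vdiff (g x) w' \<in> box_at (vadd a v) ts" using box_at_shift(2) la l by auto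
    moreover from t2[OF this] have "g (vdiff (g x) w') = g x" using vadd_vdiff_cancel(1)[OF box_at_len l(2)]
      \<open>g x \<in> box_at (vadd (vadd a v) w') ts\<close> by simp
    ultimately show "x \<in> box_at (vadd a v) ts" using is_rec_inj[OF g] by metis
  qed (use t2 box_at_shift(1) la l in auto)
  consider "x \<in> box_at a ts" | "x \<notin> box_at a ts" "x \<in> box_at (vadd a v) ts" | "x \<notin> box_at a ts" "x \<notin> box_at (vadd a v) ts" by blast
  thus "(g \<circ> swap_map a ts v) x = (swap_map (vadd a w) ts v' \<circ> g) x"
  proof cases
    case 1
    hence "vadd x v \<in> box_at (vadd a v) ts" using box_at_shift(1) la by blast
    hence "g (swap_map a ts v x) = vadd (vadd x v) w'" using t2 1 by (simp add: swap_map_def)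
    moreover have "swap_map (vadd a w) ts v' (g x) = vadd (vadd x w) v'" using 1 i1[of x] t1[OF 1] by (simp add: swap_map_def)
    moreover have "vadd (vadd x w) v' = vadd (vadd x v) w'" unfolding v' using la l box_at_len[OF 1]
      by (intro nth_equalityI) auto
    ultimately show ?thesis by simp
  next
    case 2
    hence "vdiff x v \<in> box_at a ts" using box_at_shift(2) la by blast
    hence "g (swap_map a ts v x) = vadd (vdiff x v) w" using t1 2 by (simp add: swap_map_def)
    moreover have "swap_map (vadd a w) ts v' (g x) = vdiff (vadd x w') v'"
      unfolding swap_map_def e i1 i2 using 2 t2 by simp
    moreover have "vdiff (vadd x w') v' = vadd (vdiff x v) w" unfolding v' using la l box_at_len[OF 2(2)]
      by (intro nth_equalityI) auto
    ultimately show ?thesis by simp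
  next
    case 3
    thus ?thesis unfolding swap_map_def comp_def e i1 i2 by simp
  qed
qed

lemma shuffle_conj:
  assumes g: "is_rec g" and s: "shuffle_data i a ts t" and l: "length w = d"
    and t1: "\<And>x. x \<in> box_at a (ts[i := ts ! i + t]) \<Longrightarrow> g x = vadd x w"
  shows "g \<circ> shuffle i a ts t = shuffle i (vadd a w) ts t \<circ> g"
proof
  fix x
  have la: "length a = d" "i < d" using s by (auto simp: shuffle_data_def)
  let ?ts = "ts[i := ts ! i + t]"
  have i1: "g x \<in> box_at (vadd a w) ?ts \<longleftrightarrow> x \<in> box_at a ?ts" for x
  proof
    assume "g x \<in> box_at (vadd a w) ?ts"
    hence "vdiff (g x) w \<in> box_at a ?ts" using box_at_shift(2) la l by blast
    moreover from t1[OF this] have "g (vdiff (g x) w) = g x" using vadd_vdiff_cancel(1)[OF box_at_len l(1)]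
      \<open>g x \<in> box_at (vadd a w) ?ts\<close> by simp
    ultimately show "x \<in> box_at a ?ts" using is_rec_inj[OF g] by metis
  qed (use t1 box_at_shift(1) la l in auto)
  show "(g \<circ> shuffle i a ts t) x = (shuffle i (vadd a w) ts t \<circ> g) x"
  proof (cases "x \<in> box_at a ?ts")
    case True
    have "g (shuffle i a ts t x) = vadd (shuffle i a ts t x) w" using shuffle_box_at[OF s True] t1 by blast
    also have "\<dots> = shuffle i (vadd a w) ts t (vadd x w)"
      using True i1[of x] t1[OF True] la l box_at_len[OF True]
      by (intro nth_equalityI) (auto simp: shuffle_def nth_list_update)
    finally show ?thesis using t1[OF True] by simp
  next
    case False
    thus ?thesis unfolding shuffle_def comp_def i1 by simp
  qed
qed

section \<open>Classes modulo the derived subgroup\<close>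

abbreviation DG where "DG \<equiv> derived G (carrier G)"
abbreviation A where "A \<equiv> G Mod DG"

definition ab_class :: "(real list \<Rightarrow> real list) \<Rightarrow> (real list \<Rightarrow> real list) set" where
  "ab_class f = DG #>\<^bsub>G\<^esub> f"

lemma DG_normal: "DG \<lhd> G"
  using group.derived_self_is_normal[OF G_group] .

lemma A_comm: "comm_group A"
  using group.derived_quot_of_subgroup_is_comm_group[OF G_group group.subgroup_self[OF G_group]] by simp

lemma ab_class_carrier: "is_rec f \<Longrightarrow> ab_class f \<in> carrier A"
  by (auto simp: ab_class_def FactGroup_def RCOSETS_def)

lemma ab_class_comp: "is_rec f \<Longrightarrow> is_rec g \<Longrightarrow> ab_class (f \<circ> g) = ab_class f \<otimes>\<^bsub>A\<^esub> ab_class g"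
  using normal.rcos_sum[OF DG_normal, of f g] by (simp add: ab_class_def)

lemma DG_subgroup: "subgroup DG G"
  using DG_normal normal_imp_subgroup by blast

lemma ab_class_one_iff: "is_rec f \<Longrightarrow> ab_class f = \<one>\<^bsub>A\<^esub> \<longleftrightarrow> f \<in> DG"
  using subgroup.rcos_const[OF DG_subgroup G_group, of f] group.rcos_self[OF G_group, of f DG] DG_subgroup
  by (auto simp: ab_class_def)

lemma ab_class_id: "ab_class id = \<one>\<^bsub>A\<^esub>"
  using ab_class_one_iff[OF is_rec_id] subgroup.one_closed[OF DG_subgroup] by simp

lemma ab_class_conj:
  assumes "is_rec g" "is_rec s" "is_rec s'" "g \<circ> s = s' \<circ> g" shows "ab_class s = ab_class s'"
proof -
  interpret comm_group A by (rule A_comm)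
  have "ab_class g \<otimes>\<^bsub>A\<^esub> ab_class s = ab_class g \<otimes>\<^bsub>A\<^esub> ab_class s'" using ab_class_comp assms by (metis m_comm ab_class_carrier)
  thus ?thesis using assms ab_class_carrier by (metis l_cancel)
qed

lemma ab_class_swap_map: assumes s: "swap_data a ts v" shows "ab_class (swap_map a ts v) = \<one>\<^bsub>A\<^esub>"
proof -
  interpret comm_group A by (rule A_comm)
  have l: "length a = d" "length ts = d" "length v = d" and pos: "\<forall>i<d. ts ! i > 0"
    and sub: "box_at a ts \<subseteq> M" "box_at (vadd a v) ts \<subseteq> M" and dis: "box_at a ts \<inter> box_at (vadd a v) ts = {}"
    using s by (auto simp: swap_data_def)
  have z: "0 < d" using d1 by simp
  let ?h = "ts ! 0 / 2"
  have h: "?h > 0" using pos z by simp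
  let ?u = "axis_vec 0 ?h"
  let ?ts = "ts[0 := ?h]"
  have e: "ts[0 := ?h + ?h] = ts" by (simp only: field_sum_of_halves list_update_id)
  note b1 = box_at_split[OF z l(1,2) h h, unfolded e]
  have lav: "length (vadd a v) = d" using l by simp
  note b2 = box_at_split[OF z lav l(2) h h, unfolded e]
  have c: "vadd (vadd a ?u) v = vadd (vadd a v) ?u" by (metis vadd_assoc vadd_commute)
  have pos': "\<forall>i<d. ?ts ! i > 0" using pos h l by (auto simp: nth_list_update)
  have s1: "swap_data a ?ts v" using l pos' sub dis b1 b2 unfolding swap_data_def by auto
  have s2: "swap_data (vadd a ?u) ?ts v" using l pos' sub dis b1 b2 unfolding swap_data_def c by auto
  have c1: "swap_data a ?ts ?u" using l pos' sub dis b1 b2 unfolding swap_data_def by auto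
  have c2: "swap_data (vadd a v) ?ts ?u" using l pos' sub dis b1 b2 unfolding swap_data_def by auto
  have "swap_map a ts v x = (swap_map a ?ts v \<circ> swap_map (vadd a ?u) ?ts v) x" for x
  proof -
    have i1: "x \<in> box_at a ts \<longleftrightarrow> x \<in> box_at a ?ts \<or> x \<in> box_at (vadd a ?u) ?ts" for x using b1(1) .
    have i2: "x \<in> box_at (vadd a v) ts \<longleftrightarrow> x \<in> box_at (vadd a v) ?ts \<or> x \<in> box_at (vadd (vadd a v) ?u) ?ts" for x using b2(1) .
    have n1: "\<not> (x \<in> box_at a ?ts \<and> x \<in> box_at (vadd a ?u) ?ts)" for x using b1(2,3) by blast
    have n2: "\<not> (x \<in> box_at (vadd a v) ?ts \<and> x \<in> box_at (vadd (vadd a v) ?u) ?ts)" for x using b2(2,3) by blast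
    have n3: "\<not> (x \<in> box_at a ts \<and> x \<in> box_at (vadd a v) ts)" for x using dis by blast
    have m1: "vadd x v \<in> box_at (vadd (vadd a v) ?u) ?ts" if "x \<in> box_at (vadd a ?u) ?ts"
      using box_at_shift(1)[of "vadd a ?u" v x ?ts] that l c by simp
    have m2: "vdiff x v \<in> box_at (vadd a ?u) ?ts" if "x \<in> box_at (vadd (vadd a v) ?u) ?ts"
      using box_at_shift(2)[of "vadd a ?u" v x ?ts] that l c by simp
    consider "x \<in> box_at (vadd a ?u) ?ts" | "x \<in> box_at (vadd (vadd a v) ?u) ?ts"
      | "x \<notin> box_at (vadd a ?u) ?ts" "x \<notin> box_at (vadd (vadd a v) ?u) ?ts" by blast
    thus ?thesis
    proof cases
      case 1
      have "vadd x v \<notin> box_at a ?ts" "vadd x v \<notin> box_at (vadd a v) ?ts" using m1[OF 1] n2 n3 i1 i2 by blast+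
      thus ?thesis using 1 i1 by (simp add: swap_map_def)
    next
      case 2
      have "vdiff x v \<notin> box_at a ?ts" "vdiff x v \<notin> box_at (vadd a v) ?ts" "x \<notin> box_at a ts" "x \<in> box_at (vadd a v) ts" "x \<notin> box_at (vadd a ?u) ?ts"
        using 2 m2[OF 2] n1 n3 i1 i2 by blast+
      thus ?thesis using 2 by (simp add: swap_map_def c)
    next
      case 3
      thus ?thesis using i1[of x] i2[of x] by (simp add: swap_map_def c)
    qed
  qed
  hence eq: "swap_map a ts v = swap_map a ?ts v \<circ> swap_map (vadd a ?u) ?ts v" by blast
  \<comment> \<open>The conjugating element interchanges the two halves inside both boxes
    simultaneously.\<close>
  let ?c = "swap_map a ?ts ?u \<circ> swap_map (vadd a v) ?ts ?u"
  have rc: "is_rec ?c" by (intro is_rec_comp swap_map_is_rec c1 c2)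
  have "?c \<circ> swap_map a ?ts v = swap_map (vadd a ?u) ?ts v \<circ> ?c"
  proof (rule swap_map_conj[OF rc s1, of ?u ?u])
    fix x assume x: "x \<in> box_at a ?ts"
    hence "x \<notin> box_at (vadd a v) ?ts" "x \<notin> box_at (vadd (vadd a v) ?u) ?ts" using b1 b2 dis by blast+
    thus "?c x = vadd x ?u" using x by (simp add: swap_map_def)
  next
    fix x assume x: "x \<in> box_at (vadd a v) ?ts"
    hence "vadd x ?u \<in> box_at (vadd (vadd a v) ?u) ?ts" using box_at_shift(1)[OF lav, of ?u] by simp
    hence "vadd x ?u \<notin> box_at a ?ts" "vadd x ?u \<notin> box_at (vadd a ?u) ?ts" using b1 b2 dis by blast+
    thus "?c x = vadd x ?u" using x by (simp add: swap_map_def)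
  next
    show "v = vdiff (vadd v ?u) ?u" using l by (intro nth_equalityI) auto
  qed simp_all
  hence "ab_class (swap_map a ?ts v) = ab_class (swap_map (vadd a ?u) ?ts v)"
    by (rule ab_class_conj[OF rc swap_map_is_rec[OF s1] swap_map_is_rec[OF s2]])
  hence "ab_class (swap_map a ts v) = ab_class (swap_map a ?ts v) \<otimes>\<^bsub>A\<^esub> ab_class (swap_map a ?ts v)"
    unfolding eq using ab_class_comp[OF swap_map_is_rec[OF s1] swap_map_is_rec[OF s2]] by simp
  also have "\<dots> = ab_class (swap_map a ?ts v \<circ> swap_map a ?ts v)" using ab_class_comp[OF swap_map_is_rec[OF s1] swap_map_is_rec[OF s1]] by simp
  also have "\<dots> = \<one>\<^bsub>A\<^esub>" unfolding swap_map_comp[OF s1] by (rule ab_class_id)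
  finally show ?thesis .
qed

section \<open>The class of a small shuffle does not depend on its position\<close>

lemma ab_class_shuffle_disjoint:
  assumes s: "shuffle_data i a ts t" "shuffle_data i c ts t"
    and dis: "box_at a (ts[i := ts ! i + t]) \<inter> box_at c (ts[i := ts ! i + t]) = {}"
  shows "ab_class (shuffle i a ts t) = ab_class (shuffle i c ts t)"
proof -
  let ?w = "vdiff c a" and ?ts = "ts[i := ts ! i + t]"
  have l: "length a = d" "length c = d" "length ts = d" "i < d" using s by (auto simp: shuffle_data_def)
  have c: "vadd a ?w = c" using l by (simp add: vadd_vdiff)
  have sd: "swap_data a ?ts ?w" unfolding swap_data_def c using s l dis by (auto simp: shuffle_data_def nth_list_update)
  have "swap_map a ?ts ?w \<circ> shuffle i a ts t = shuffle i (vadd a ?w) ts t \<circ> swap_map a ?ts ?w"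
    by (rule shuffle_conj[OF swap_map_is_rec[OF sd] s(1)]) (use l in \<open>auto simp: swap_map_def\<close>)
  thus ?thesis unfolding c by (rule ab_class_conj[OF swap_map_is_rec[OF sd] shuffle_is_rec[OF s(1)] shuffle_is_rec[OF s(2)]])
qed

text \<open>A cube with the corner of some cell of \<open>M\<close>, whose side is the least gap of
  that cell. It is the common place to which small shuffles are carried.\<close>

lemma room: obtains a0 L where "length a0 = d" "L > 0" "box_at a0 (replicate d L) \<subseteq> M"
proof -
  obtain C where C: "gridset d C M" using M_grid by blast
  obtain x where "x \<in> M" using M_ne by blast
  then obtain p where p: "p \<in> pts C M" using fl_pts(1)[OF C] by blast
  have l: "length p = d" using pts_length[OF C p] .
  have g: "gap C (p ! i) > 0" if "i < d" for i using pts_nth_nx(3)[OF C p that] by (simp add: gap_def)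
  let ?S = "(\<lambda>i. gap C (p ! i)) ` {..<d}"
  have "0 \<in> {..<d}" using d1 by simp
  hence S: "finite ?S" "?S \<noteq> {}" by blast+
  have "Min ?S > 0" using Min_in[OF S] g by auto
  moreover have "box_at p (replicate d (Min ?S)) \<subseteq> M"
  proof
    fix x assume x: "x \<in> box_at p (replicate d (Min ?S))"
    have "p ! i \<le> x ! i \<and> x ! i < p ! i + map (gap C) p ! i" if i: "i < d" for i
    proof -
      have "Min ?S \<le> gap C (p ! i)" using S i by (intro Min_le) auto
      moreover have "p ! i \<le> x ! i" "x ! i < p ! i + Min ?S" using x i by (auto simp: box_at_def)
      moreover have "map (gap C) p ! i = gap C (p ! i)" using l i by simp
      ultimately show ?thesis by linarith
    qed
    hence "x \<in> box_at p (map (gap C) p)" using box_at_len[OF x] by (simp add: box_at_def)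
    thus "x \<in> M" using cell_subset[OF C p] cell_box_at[OF l] by auto
  qed
  ultimately show thesis using that l by blast
qed

text \<open>Already the slots \<open>0\<close>, \<open>2\<close> and \<open>4\<close> suffice: the
  open intervals of radius \<open>L / 5\<close> about them are disjoint, and \<open>x\<close> and
  \<open>y\<close> cannot meet all three.\<close>

lemma five_slots:
  fixes x y z L \<sigma> :: real
  assumes "\<sigma> < L / 5" "L > 0"
  shows "\<exists>k\<in>{0, 1, 2, 3, 4}. \<bar>x - (z + k * (L / 5))\<bar> \<ge> \<sigma> \<and> \<bar>y - (z + k * (L / 5))\<bar> \<ge> \<sigma>"
proof (rule ccontr)
  define h where "h = L / 5"
  assume no: "\<not> ?thesis"
  have n: "\<bar>x - (z + k * h)\<bar> < h \<or> \<bar>y - (z + k * h)\<bar> < h" if "k \<in> {0, 1, 2, 3, 4}" for k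
  proof (rule ccontr)
    assume "\<not> (\<bar>x - (z + k * h)\<bar> < h \<or> \<bar>y - (z + k * h)\<bar> < h)"
    hence "\<bar>x - (z + k * h)\<bar> \<ge> \<sigma> \<and> \<bar>y - (z + k * h)\<bar> \<ge> \<sigma>" using assms(1) unfolding h_def[symmetric] by linarith
    thus False using no that unfolding h_def[symmetric] by blast
  qed
  have h: "h > 0" using assms by (simp add: h_def)
  have "x - z < h \<and> - h < x - z \<or> y - z < h \<and> - h < y - z" using n[of 0] by (simp add: abs_less_iff) linarith
  moreover have "x - z < 3 * h \<and> h < x - z \<or> y - z < 3 * h \<and> h < y - z" using n[of 2] by (simp add: abs_less_iff) linarith
  moreover have "x - z < 5 * h \<and> 3 * h < x - z \<or> y - z < 5 * h \<and> 3 * h < y - z" using n[of 4] by (simp add: abs_less_iff) linarith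
  ultimately show False using h by (elim disjE conjE) linarith+
qed

text \<open>The boxes at \<open>a\<close> and \<open>c\<close> may overlap, so both are compared
  with a third box, separated from each of them along axis \<open>0\<close>. Sides below
  \<open>L / 5\<close> make each of the five candidate positions fit into the cube.\<close>

lemma ab_class_shuffle_small:
  assumes R: "length a0 = d" "box_at a0 (replicate d L) \<subseteq> M" "L > 0"
    and s: "shuffle_data i a ts t" "shuffle_data i c ts t" and small: "\<forall>j<d. ts[i := ts ! i + t] ! j < L / 5"
  shows "ab_class (shuffle i a ts t) = ab_class (shuffle i c ts t)"
proof -
  have z: "0 < d" using d1 by simp
  let ?ts = "ts[i := ts ! i + t]"
  obtain k where k: "k \<in> {0, 1, 2, 3, 4 :: real}" "\<bar>a ! 0 - (a0 ! 0 + k * (L / 5))\<bar> \<ge> ?ts ! 0"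
     "\<bar>c ! 0 - (a0 ! 0 + k * (L / 5))\<bar> \<ge> ?ts ! 0"
    using five_slots[of "?ts ! 0" L "a ! 0" "a0 ! 0" "c ! 0"] small R(3) z by blast
  let ?e = "vadd a0 (axis_vec 0 (k * (L / 5)))"
  have e0: "?e ! 0 = a0 ! 0 + k * (L / 5)" using R(1) z by (simp add: axis_vec_nth)
  have k0: "k * (L / 5) \<ge> 0" "k * (L / 5) \<le> 4 * (L / 5)" using k(1) R(3) by auto
  have "box_at ?e ?ts \<subseteq> box_at a0 (replicate d L)"
  proof
    fix x assume x: "x \<in> box_at ?e ?ts"
    have "a0 ! j \<le> x ! j \<and> x ! j < a0 ! j + L" if j: "j < d" for j
    proof -
      have "?e ! j \<le> x ! j" "x ! j < ?e ! j + ?ts ! j" using x j by (auto simp: box_at_def)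
      moreover have "?ts ! j < L / 5" using small j by blast
      moreover have "?e ! j = a0 ! j + (if j = 0 then k * (L / 5) else 0)" using R(1) j by (simp add: axis_vec_nth)
      ultimately show ?thesis using k0 R(3) by argo
    qed
    thus "x \<in> box_at a0 (replicate d L)" using box_at_len[OF x] by (auto simp: box_at_def)
  qed
  hence se: "shuffle_data i ?e ts t" using s(1) R by (auto simp: shuffle_data_def)
  have dis: "box_at b ?ts \<inter> box_at ?e ?ts = {}" if "\<bar>b ! 0 - (a0 ! 0 + k * (L / 5))\<bar> \<ge> ?ts ! 0" for b
  proof -
    have "False" if "x \<in> box_at b ?ts" "x \<in> box_at ?e ?ts" for x
    proof -
      have "b ! 0 \<le> x ! 0" "x ! 0 < b ! 0 + ?ts ! 0" "?e ! 0 \<le> x ! 0" "x ! 0 < ?e ! 0 + ?ts ! 0"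
        using that z unfolding box_at_def by blast+
      thus False using \<open>\<bar>b ! 0 - (a0 ! 0 + k * (L / 5))\<bar> \<ge> ?ts ! 0\<close> unfolding e0 by linarith
    qed
    thus ?thesis by blast
  qed
  show ?thesis using ab_class_shuffle_disjoint[OF s(1) se dis[OF k(2)]] ab_class_shuffle_disjoint[OF s(2) se dis[OF k(3)]] by simp
qed

text \<open>Equal lengths turn a shuffle into a swap, which is trivial in the abelianization. This
  matches the vanishing of \<open>a \<otimes> b - b \<otimes> a\<close> for
  \<open>a = b\<close>.\<close>

lemma shuffle_eq_swap_map:
  assumes s: "shuffle_data i a ts (ts ! i)"
  shows "swap_data a ts (axis_vec i (ts ! i))" "shuffle i a ts (ts ! i) = swap_map a ts (axis_vec i (ts ! i))"
proof -
  have i: "i < d" "length a = d" "length ts = d" "ts ! i > 0" using s by (auto simp: shuffle_data_def)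
  note b = box_at_split[OF i(1,2,3,4,4), unfolded list_update_id]
  show "swap_data a ts (axis_vec i (ts ! i))" using s b i unfolding swap_data_def shuffle_data_def by auto
  show "shuffle i a ts (ts ! i) = swap_map a ts (axis_vec i (ts ! i))"
  proof
    fix x
    have "vadd x (axis_vec i (- ts ! i)) = vdiff x (axis_vec i (ts ! i))" if "length x = d"
      using that by (intro nth_equalityI) (auto simp: axis_vec_nth)
    thus "shuffle i a ts (ts ! i) x = swap_map a ts (axis_vec i (ts ! i)) x"
      using shuffle_pieces[OF s, of x] box_at_len[of x] by (simp add: swap_map_def)
  qed
qed

end

section \<open>Rearranging consecutive intervals\<close>

text \<open>Rearrangements of a list built from adjacent transpositions, because these are what
  shuffles of neighbouring intervals realise.\<close>

inductive wperm :: "'a list \<Rightarrow> 'a list \<Rightarrow> bool" where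
  wperm_Nil: "wperm [] []"
| wperm_Cons: "wperm u v \<Longrightarrow> wperm (x # u) (x # v)"
| wperm_swap: "wperm (x # y # u) (y # x # u)"
| wperm_trans: "wperm u v \<Longrightarrow> wperm v w \<Longrightarrow> wperm u w"

lemma wperm_refl: "wperm u u"
  by (induction u) (auto intro: wperm.intros)

lemma wperm_move: "wperm (x # u @ v) (u @ x # v)"
proof (induction u)
  case (Cons y u)
  have "wperm (x # y # u @ v) (y # x # u @ v)" by (rule wperm_swap)
  from wperm_trans[OF this wperm_Cons[OF Cons]] show ?case by simp
qed (simp add: wperm_refl)

lemma mset_eq_imp_wperm: "mset u = mset v \<Longrightarrow> wperm u v"
proof (induction u arbitrary: v)
  case Nil thus ?case by (simp add: wperm_Nil)
next
  case (Cons x u)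
  hence "x \<in> set v" using mset_eq_setD[OF Cons.prems] by auto
  then obtain v1 v2 where v: "v = v1 @ x # v2" by (meson split_list)
  have "mset u = mset (v1 @ v2)" using Cons.prems v by simp
  hence "wperm (x # u) (x # v1 @ v2)" by (intro wperm_Cons Cons.IH)
  thus ?case unfolding v by (rule wperm_trans[OF _ wperm_move])
qed

lemma wperm_mset: "wperm u v \<Longrightarrow> mset u = mset v"
  by (induction rule: wperm.induct) auto

text \<open>Left ends and lengths of the consecutive intervals that arise when a word of lengths is
  laid out from \<open>\<alpha>\<close>.\<close>

fun pieces :: "real \<Rightarrow> real list \<Rightarrow> (real \<times> real) set" where
  "pieces \<alpha> [] = {}"
| "pieces \<alpha> (l # w) = insert (\<alpha>, l) (pieces (\<alpha> + l) w)"

lemma pieces_shift: "pieces (\<alpha> + v) w = (\<lambda>(p, l). (p + v, l)) ` pieces \<alpha> w"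
proof (induction w arbitrary: \<alpha>)
  case (Cons l w)
  have e: "\<alpha> + v + l = \<alpha> + l + v" by simp
  show ?case unfolding pieces.simps e Cons[of "\<alpha> + l"] by simp
qed simp

lemma pieces_ge: "(p, l) \<in> pieces \<alpha> w \<Longrightarrow> \<forall>e\<in>set w. e > 0 \<Longrightarrow> \<alpha> \<le> p"
proof (induction w arbitrary: \<alpha>)
  case (Cons e w) thus ?case by fastforce
qed simp

lemma sum_list_pos: "\<forall>e\<in>set w. e > (0::real) \<Longrightarrow> sum_list w \<ge> 0"
  by (induction w) auto

lemma grid_word:
  assumes "finite C" "b \<in> C" "a \<le> b" "a \<in> C" "grid_gaps E C"
  shows "\<exists>w. set w \<subseteq> E \<and> sum_list w = b - a \<and> pieces a w = (\<lambda>x. (x, gap C x)) ` (C \<inter> {a..<b})"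
  using assms(1-4)
proof (induction rule: grid_induct)
  case base show ?case by (intro exI[of _ "[]"]) auto
next
  case (step a)
  then obtain w where w: "set w \<subseteq> E" "sum_list w = b - nx C a" "pieces (nx C a) w = (\<lambda>x. (x, gap C x)) ` (C \<inter> {nx C a..<b})"
    by blast
  have "gap C a \<in> E" using step assms(5) unfolding grid_gaps_def by blast
  moreover have "pieces a (gap C a # w) = (\<lambda>x. (x, gap C x)) ` (C \<inter> {a..<b})"
    unfolding step(6) using w(3) by (simp add: gap_def)
  ultimately show ?case using w by (intro exI[of _ "gap C a # w"]) (auto simp: gap_def)
qed

definition interval_shuffle :: "real \<Rightarrow> real \<Rightarrow> real \<Rightarrow> real \<Rightarrow> real" where
  "interval_shuffle \<alpha> s t y = (if \<alpha> \<le> y \<and> y < \<alpha> + s then y + t else if \<alpha> + s \<le> y \<and> y < \<alpha> + s + t then y - s else y)"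

section \<open>Generation by swaps and shuffles\<close>

text \<open>Each \<open>h j\<close> preserves its own \<open>B j\<close> and is the identity
  elsewhere, so on \<open>B j\<close> the composition of all of them acts as \<open>h j\<close>
  alone.\<close>

lemma glue:
  fixes h :: "'j \<Rightarrow> 'a \<Rightarrow> 'a"
  assumes "finite J" "id \<in> K" "\<And>f g. f \<in> K \<Longrightarrow> g \<in> K \<Longrightarrow> f \<circ> g \<in> K"
    "\<And>j. j \<in> J \<Longrightarrow> h j \<in> K" "\<And>j x. j \<in> J \<Longrightarrow> x \<in> B j \<Longrightarrow> h j x \<in> B j" "\<And>j x. j \<in> J \<Longrightarrow> x \<notin> B j \<Longrightarrow> h j x = x"
    "\<And>j j' x. j \<in> J \<Longrightarrow> j' \<in> J \<Longrightarrow> x \<in> B j \<Longrightarrow> x \<in> B j' \<Longrightarrow> j = j'"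
  shows "\<exists>H\<in>K. (\<forall>j\<in>J. \<forall>x\<in>B j. H x = h j x) \<and> (\<forall>x. (\<forall>j\<in>J. x \<notin> B j) \<longrightarrow> H x = x)"
  using assms
proof (induction J rule: finite_induct)
  case empty show ?case by (rule bexI[OF _ \<open>id \<in> K\<close>]) simp
next
  case (insert i J)
  have "\<exists>H\<in>K. (\<forall>j\<in>J. \<forall>x\<in>B j. H x = h j x) \<and> (\<forall>x. (\<forall>j\<in>J. x \<notin> B j) \<longrightarrow> H x = x)"
    using insert.prems by (intro insert.IH) auto
  then obtain H where H: "H \<in> K" "\<And>j x. j \<in> J \<Longrightarrow> x \<in> B j \<Longrightarrow> H x = h j x" "\<And>x. (\<forall>j\<in>J. x \<notin> B j) \<Longrightarrow> H x = x"
    by blast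
  show ?case
  proof (intro bexI[of _ "h i \<circ> H"] conjI ballI allI impI)
    show "h i \<circ> H \<in> K" using insert.prems H by blast
    fix j x assume j: "j \<in> insert i J" "x \<in> B j"
    show "(h i \<circ> H) x = h j x"
    proof (cases "j = i")
      case True
      have "x \<notin> B j'" if "j' \<in> J" for j'
      proof
        assume "x \<in> B j'"
        hence "j' = i" using insert.prems(6)[of j' i x] that j True by blast
        thus False using that insert.hyps by blast
      qed
      thus ?thesis using H(3) True by simp
    next
      case False
      hence jJ: "j \<in> J" using j by simp
      hence hx: "h j x \<in> B j" using insert.prems(4) j by blast
      have "h j x \<notin> B i"
      proof
        assume "h j x \<in> B i"
        hence "i = j" using insert.prems(6)[of i j "h j x"] hx j by blast
        thus False using False by simp
      qed
      hence "h i (h j x) = h j x" using insert.prems(5) by blast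
      thus ?thesis using H(2)[OF jJ j(2)] by simp
    qed
  next
    fix x assume "\<forall>j\<in>insert i J. x \<notin> B j"
    thus "(h i \<circ> H) x = x" using H(3) insert.prems(5) by simp
  qed
qed

context mrect begin

definition gen_by :: "real set \<Rightarrow> (real list \<Rightarrow> real list) set" where
  "gen_by E = generate G ({swap_map a ts v | a ts v. swap_data a ts v} \<union>
     {shuffle i a ts t | i a ts t. shuffle_data i a ts t \<and> set ts \<subseteq> E \<and> t \<in> E})"

lemma gen_by_subgroup: "subgroup (gen_by E) G"
  unfolding gen_by_def by (rule group.generate_is_subgroup[OF G_group]) (auto simp: swap_map_is_rec shuffle_is_rec)

lemma gen_by_id: "id \<in> gen_by E"
  using subgroup.one_closed[OF gen_by_subgroup] by simp

lemma gen_by_comp: "f \<in> gen_by E \<Longrightarrow> g \<in> gen_by E \<Longrightarrow> f \<circ> g \<in> gen_by E"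
  using subgroup.m_closed[OF gen_by_subgroup] by simp

lemma gen_by_is_rec: "f \<in> gen_by E \<Longrightarrow> is_rec f"
  using subsetD[OF subgroup.subset[OF gen_by_subgroup]] G_carrier by blast

lemma gen_by_swap_map: "swap_data a ts v \<Longrightarrow> swap_map a ts v \<in> gen_by E"
  unfolding gen_by_def by (rule generate.incl) blast

lemma gen_by_shuffle: "shuffle_data i a ts t \<Longrightarrow> set ts \<subseteq> E \<Longrightarrow> t \<in> E \<Longrightarrow> shuffle i a ts t \<in> gen_by E"
  unfolding gen_by_def by (rule generate.incl) blast

section \<open>Rearranging a box along one axis\<close>

definition axis_map :: "nat \<Rightarrow> real list set \<Rightarrow> (real \<Rightarrow> real) \<Rightarrow> real list \<Rightarrow> real list" where
  "axis_map k B g x = (if x \<in> B then x[k := g (x ! k)] else x)"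

lemma axis_map_id_gen_by: "axis_map k B id \<in> gen_by E"
proof -
  have "axis_map k B id = id" by (auto simp: axis_map_def)
  thus ?thesis using gen_by_id by metis
qed

text \<open>The grid in the remaining axes cuts the slab
  \<open>\<alpha> \<le> x ! k < \<alpha> + s + t\<close> of the box into smaller boxes whose other
  sides are gaps, hence in \<open>E\<close>. One shuffle in each of them, glued together, gives the
  map.\<close>

lemma axis_map_interval_shuffle_gen_by:
  assumes E: "\<forall>e\<in>E. e > 0" and C: "gridset d C M" "grid_gaps E C"
    and B: "length b = d" "length bs = d" "gridset d C (box_at b bs)" "box_at b bs \<subseteq> M" "set b \<subseteq> C" and k: "k < d"
    and s: "s \<in> E" "t \<in> E" and \<alpha>: "b ! k \<le> \<alpha>" "\<alpha> + s + t \<le> b ! k + bs ! k"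
  shows "axis_map k (box_at b bs) (interval_shuffle \<alpha> s t) \<in> gen_by E"
proof -
  let ?B = "box_at b bs"
  \<comment> \<open>One corner for every column of cells parallel to axis \<open>k\<close>: the
    corners on the lower face of the box.\<close>
  define J where "J = {p \<in> pts C ?B. p ! k = b ! k}"
  define c where "c p = p[k := \<alpha>]" for p :: "real list"
  define ts where "ts p = (map (gap C) p)[k := s]" for p :: "real list"
  define Bx where "Bx p = box_at (c p) ((ts p)[k := ts p ! k + t])" for p
  have st: "s > 0" "t > 0" using s E by auto
  have J: "p \<in> pts C ?B" "length p = d" if "p \<in> J" for p using that pts_length[OF B(3)] by (auto simp: J_def)
  \<comment> \<open>Resetting coordinate \<open>k\<close> to \<open>b ! k\<close> moves
    \<open>x\<close> along its column to the lower face, where the column is identified by a grid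
    cell.\<close>
  have Bx: "x \<in> Bx p \<longleftrightarrow> length x = d \<and> x[k := b ! k] \<in> cell d C p \<and> \<alpha> \<le> x ! k \<and> x ! k < \<alpha> + s + t" if p: "p \<in> J" for p x
  proof -
    have pk: "p ! k = b ! k" "p \<in> pts C M" using p B(4) by (auto simp: J_def pts_def)
    have "gap C (p ! k) > 0" using pts_nth_nx(3)[OF B(3) J(1)[OF p] k] by (simp add: gap_def)
    hence "(\<forall>i<d. p ! i \<le> x[k := b ! k] ! i \<and> x[k := b ! k] ! i < p ! i + map (gap C) p ! i) \<longleftrightarrow>
      (\<forall>i<d. i \<noteq> k \<longrightarrow> p ! i \<le> x ! i \<and> x ! i < p ! i + gap C (p ! i))" if "length x = d"
    proof -
      have "x[k := b ! k] ! i = (if i = k then b ! k else x ! i)" "map (gap C) p ! i = gap C (p ! i)" if "i < d" for i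
        using that k \<open>length x = d\<close> J(2)[OF p] by simp_all
      thus ?thesis using pk(1) \<open>gap C (p ! k) > 0\<close> by auto
    qed
    moreover have "(\<forall>i<d. c p ! i \<le> x ! i \<and> x ! i < c p ! i + (ts p)[k := ts p ! k + t] ! i) \<longleftrightarrow>
      (\<forall>i<d. i \<noteq> k \<longrightarrow> p ! i \<le> x ! i \<and> x ! i < p ! i + gap C (p ! i)) \<and> \<alpha> \<le> x ! k \<and> x ! k < \<alpha> + s + t"
      using J(2)[OF p] k by (auto simp: nth_list_update c_def ts_def)
    ultimately show ?thesis unfolding Bx_def cell_box_at[OF J(2)[OF p]] unfolding box_at_def by auto
  qed
  have sub: "x \<in> ?B" if "p \<in> J" "x \<in> Bx p" for p x
  proof -
    have x: "length x = d" "x[k := b ! k] \<in> cell d C p" "\<alpha> \<le> x ! k" "x ! k < \<alpha> + s + t" using Bx that by auto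
    have "x[k := b ! k] \<in> ?B" using x(2) cell_subset[OF B(3) J(1)[OF that(1)]] by auto
    from box_at_upd[OF this k, of "x ! k"] show ?thesis using x \<alpha> by simp
  qed
  have sd: "shuffle_data k (c p) (ts p) t" if p: "p \<in> J" for p
  proof -
    have "box_at (c p) ((ts p)[k := ts p ! k + t]) \<subseteq> M" using sub[OF p] B(4) unfolding Bx_def by blast
    moreover have "ts p ! i > 0" if "i < d" for i
      using pts_nth_nx(3)[OF B(3) J(1)[OF p] that] that st J(2)[OF p]
      by (cases "i = k") (simp_all add: ts_def gap_def)
    ultimately show ?thesis using k st J(2)[OF p] unfolding shuffle_data_def by (simp add: c_def ts_def)
  qed
  have tsE: "set (ts p) \<subseteq> E" if p: "p \<in> J" for p
  proof -
    have "gap C (p ! i) \<in> E" if "i < d" for i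
      using pts_nth_nx[OF B(3) J(1)[OF p] that] C(2) unfolding grid_gaps_def by blast
    hence "set (map (gap C) p) \<subseteq> E" using J(2)[OF p] by (auto simp: in_set_conv_nth)
    thus ?thesis unfolding ts_def using set_update_subset_insert s(1) by fast
  qed
  have "\<exists>H\<in>gen_by E. (\<forall>p\<in>J. \<forall>x\<in>Bx p. H x = shuffle k (c p) (ts p) t x) \<and> (\<forall>x. (\<forall>p\<in>J. x \<notin> Bx p) \<longrightarrow> H x = x)"
  proof (rule glue)
    show "finite J" using finite_pts[OF B(3)] by (simp add: J_def)
    show "shuffle k (c p) (ts p) t \<in> gen_by E" if "p \<in> J" for p by (rule gen_by_shuffle[OF sd[OF that] tsE[OF that] s(2)])
    show "shuffle k (c p) (ts p) t x \<in> Bx p" if "p \<in> J" "x \<in> Bx p" for p x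
      using shuffle_box_at[OF sd[OF that(1)]] that unfolding Bx_def by blast
    show "shuffle k (c p) (ts p) t x = x" if "p \<in> J" "x \<notin> Bx p" for p x
      using that unfolding Bx_def shuffle_def by simp
    show "p = p'" if p: "p \<in> J" "p' \<in> J" and x: "x \<in> Bx p" "x \<in> Bx p'" for p p' x
    proof -
      have "x[k := b ! k] \<in> cell d C p" using Bx[OF p(1)] x by blast
      moreover have "x[k := b ! k] \<in> cell d C p'" using Bx[OF p(2)] x by blast
      ultimately show ?thesis using cell_eq[OF B(3) J(1)[OF p(1)] B(3) J(1)[OF p(2)]] by blast
    qed
  qed (auto intro: gen_by_id gen_by_comp)
  then obtain H where H: "H \<in> gen_by E" "\<And>p x. p \<in> J \<Longrightarrow> x \<in> Bx p \<Longrightarrow> H x = shuffle k (c p) (ts p) t x"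
    "\<And>x. (\<forall>p\<in>J. x \<notin> Bx p) \<Longrightarrow> H x = x" by blast
  have "H x = axis_map k ?B (interval_shuffle \<alpha> s t) x" for x
  proof (cases "\<exists>p\<in>J. x \<in> Bx p")
    case True
    then obtain p where p: "p \<in> J" "x \<in> Bx p" by blast
    have x: "length x = d" "\<alpha> \<le> x ! k" "x ! k < \<alpha> + s + t" using Bx[OF p(1)] p(2) by auto
    have ck: "c p ! k = \<alpha>" "ts p ! k = s" using k J(2)[OF p(1)] by (auto simp: c_def ts_def)
    have "H x = x[k := if x ! k < \<alpha> + s then x ! k + t else x ! k - s]"
      unfolding H(2)[OF p] shuffle_def using p(2) unfolding Bx_def ck by simp
    also have "\<dots> = axis_map k ?B (interval_shuffle \<alpha> s t) x" using sub[OF p] x by (simp add: axis_map_def interval_shuffle_def)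
    finally show ?thesis .
  next
    case False
    hence Hx: "H x = x" using H(3) by blast
    show ?thesis
    proof (cases "x \<in> ?B \<and> \<alpha> \<le> x ! k \<and> x ! k < \<alpha> + s + t")
      case True
      hence x: "x \<in> ?B" "length x = d" using box_at_len by auto
      have bsk: "bs ! k > 0" using st \<alpha> by linarith
      have xb: "x[k := b ! k] \<in> ?B" by (rule box_at_upd[OF x(1) k]) (use bsk in auto)
      let ?p = "map (fl C) (x[k := b ! k])"
      have bk: "b ! k \<in> C" using B(1) k set_nthD[OF B(5), of k] by simp
      have "fl C (b ! k) = b ! k" using fl_props[OF gridset_finite[OF C(1)] bk, of "b ! k"] bk by force
      hence "?p \<in> J" using fl_pts(1)[OF B(3) xb] x k by (simp add: J_def)
      moreover have "x \<in> Bx ?p" unfolding Bx[OF \<open>?p \<in> J\<close>] using fl_pts(2)[OF B(3) xb] x True by simp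
      ultimately show ?thesis using False by blast
    next
      case no: False
      thus ?thesis using Hx st by (auto simp: axis_map_def interval_shuffle_def)
    qed
  qed
  hence "H = axis_map k ?B (interval_shuffle \<alpha> s t)" by blast
  thus ?thesis using H(1) by simp
qed

text \<open>The last clause is the purpose: every interval in the layout of \<open>w\<close> is
  translated onto an interval of the same length in the layout of \<open>w'\<close>. The first two
  clauses confine \<open>g\<close> to the range of the word, which is what the cases of a common
  head and of a composition need.\<close>

lemma axis_map_wperm_gen_by:
  assumes "wperm w w'" "set w \<subseteq> E" "b ! k \<le> \<alpha>" "\<alpha> + sum_list w \<le> b ! k + bs ! k"
    and E: "\<forall>e\<in>E. e > 0" and C: "gridset d C M" "grid_gaps E C"
    and B: "length b = d" "length bs = d" "gridset d C (box_at b bs)" "box_at b bs \<subseteq> M" "set b \<subseteq> C" and k: "k < d"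
  shows "\<exists>g. axis_map k (box_at b bs) g \<in> gen_by E \<and> (\<forall>y. y < \<alpha> \<or> \<alpha> + sum_list w \<le> y \<longrightarrow> g y = y) \<and>
    (\<forall>y. \<alpha> \<le> y \<and> y < \<alpha> + sum_list w \<longrightarrow> \<alpha> \<le> g y \<and> g y < \<alpha> + sum_list w) \<and>
    (\<forall>p l. (p, l) \<in> pieces \<alpha> w \<longrightarrow> (\<exists>p'. (p', l) \<in> pieces \<alpha> w' \<and> (\<forall>y. p \<le> y \<and> y < p + l \<longrightarrow> g y = y + (p' - p))))"
  using assms(1-4)
proof (induction arbitrary: \<alpha> rule: wperm.induct)
  case wperm_Nil
  show ?case by (intro exI[of _ id] conjI axis_map_id_gen_by) auto
next
  case (wperm_Cons u v x \<alpha>)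
  have x: "x > 0" using wperm_Cons.prems E by auto
  have "set u \<subseteq> E" "b ! k \<le> \<alpha> + x" "\<alpha> + x + sum_list u \<le> b ! k + bs ! k" using wperm_Cons.prems x by auto
  from wperm_Cons.IH[OF this] obtain g where g: "axis_map k (box_at b bs) g \<in> gen_by E"
    "\<And>y. y < \<alpha> + x \<or> \<alpha> + x + sum_list u \<le> y \<Longrightarrow> g y = y"
    "\<And>y. \<alpha> + x \<le> y \<and> y < \<alpha> + x + sum_list u \<Longrightarrow> \<alpha> + x \<le> g y \<and> g y < \<alpha> + x + sum_list u"
    "\<And>p l. (p, l) \<in> pieces (\<alpha> + x) u \<Longrightarrow> (\<exists>p'. (p', l) \<in> pieces (\<alpha> + x) v \<and> (\<forall>y. p \<le> y \<and> y < p + l \<longrightarrow> g y = y + (p' - p)))"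
    by blast
  have su: "sum_list u \<ge> 0" using wperm_Cons.prems(1) E by (intro sum_list_pos) auto
  show ?case
  proof (intro exI[of _ g] conjI allI impI g(1))
    fix y assume "y < \<alpha> \<or> \<alpha> + sum_list (x # u) \<le> y"
    thus "g y = y" using x g(2)[of y] by (auto simp: add.assoc)
  next
    fix y assume y: "\<alpha> \<le> y \<and> y < \<alpha> + sum_list (x # u)"
    show "\<alpha> \<le> g y" "g y < \<alpha> + sum_list (x # u)"
      using g(2)[of y] g(3)[of y] y x su by (cases "y < \<alpha> + x"; simp add: add.assoc)+
  next
    fix p l assume "(p, l) \<in> pieces \<alpha> (x # u)"
    thus "\<exists>p'. (p', l) \<in> pieces \<alpha> (x # v) \<and> (\<forall>y. p \<le> y \<and> y < p + l \<longrightarrow> g y = y + (p' - p))"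
    proof (cases "(p, l) = (\<alpha>, x)")
      case True
      thus ?thesis using g(2) by (intro exI[of _ \<alpha>]) auto
    next
      case False
      hence "(p, l) \<in> pieces (\<alpha> + x) u" using \<open>(p, l) \<in> pieces \<alpha> (x # u)\<close> by auto
      from g(4)[OF this] show ?thesis by auto
    qed
  qed
next
  case (wperm_swap x y u \<alpha>)
  have xy: "x \<in> E" "y \<in> E" "x > 0" "y > 0" using wperm_swap.prems E by auto
  have pos: "\<forall>e\<in>set u. e > 0" using wperm_swap.prems E by auto
  have su: "sum_list u \<ge> 0" using sum_list_pos[OF pos] .
  have "\<alpha> + x + y \<le> b ! k + bs ! k" using wperm_swap.prems su by simp
  from axis_map_interval_shuffle_gen_by[OF E C B k xy(1,2) _ this] wperm_swap.prems
  have 1: "axis_map k (box_at b bs) (interval_shuffle \<alpha> x y) \<in> gen_by E" by simp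
  show ?case
  proof (intro exI[of _ "interval_shuffle \<alpha> x y"] conjI allI impI 1)
    fix z assume "z < \<alpha> \<or> \<alpha> + sum_list (x # y # u) \<le> z"
    thus "interval_shuffle \<alpha> x y z = z" using xy su by (auto simp: interval_shuffle_def)
  next
    fix z assume "\<alpha> \<le> z \<and> z < \<alpha> + sum_list (x # y # u)"
    thus "\<alpha> \<le> interval_shuffle \<alpha> x y z" "interval_shuffle \<alpha> x y z < \<alpha> + sum_list (x # y # u)" using xy su by (auto simp: interval_shuffle_def)
  next
    fix p l assume "(p, l) \<in> pieces \<alpha> (x # y # u)"
    then consider "p = \<alpha>" "l = x" | "p = \<alpha> + x" "l = y" | "(p, l) \<in> pieces (\<alpha> + x + y) u" by auto
    thus "\<exists>p'. (p', l) \<in> pieces \<alpha> (y # x # u) \<and> (\<forall>z. p \<le> z \<and> z < p + l \<longrightarrow> interval_shuffle \<alpha> x y z = z + (p' - p))"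
    proof cases
      case 1 thus ?thesis by (intro exI[of _ "\<alpha> + y"]) (auto simp: interval_shuffle_def)
    next
      case 2 thus ?thesis by (intro exI[of _ \<alpha>]) (auto simp: interval_shuffle_def)
    next
      case 3
      have "p \<ge> \<alpha> + x + y" using pieces_ge[OF 3 pos] .
      moreover have "\<alpha> + y + x = \<alpha> + x + y" by simp
      hence "(p, l) \<in> pieces (\<alpha> + y + x) u" using 3 by (simp only:)
      ultimately show ?thesis using xy by (intro exI[of _ p]) (auto simp: interval_shuffle_def)
    qed
  qed
next
  case (wperm_trans u v w \<alpha>)
  have m: "mset u = mset v" using wperm_mset wperm_trans.hyps by blast
  have s: "sum_list u = sum_list v" using m by (metis sum_mset_sum_list)
  have sv: "set v \<subseteq> E" using m wperm_trans.prems by (metis set_mset_mset)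
  from wperm_trans.IH(1)[OF wperm_trans.prems] obtain g where g: "axis_map k (box_at b bs) g \<in> gen_by E"
    "\<And>y. y < \<alpha> \<or> \<alpha> + sum_list u \<le> y \<Longrightarrow> g y = y"
    "\<And>y. \<alpha> \<le> y \<and> y < \<alpha> + sum_list u \<Longrightarrow> \<alpha> \<le> g y \<and> g y < \<alpha> + sum_list u"
    "\<And>p l. (p, l) \<in> pieces \<alpha> u \<Longrightarrow> (\<exists>p'. (p', l) \<in> pieces \<alpha> v \<and> (\<forall>y. p \<le> y \<and> y < p + l \<longrightarrow> g y = y + (p' - p)))"
    by blast
  from wperm_trans.IH(2)[OF sv wperm_trans.prems(2) wperm_trans.prems(3)[unfolded s]]
  obtain h where h: "axis_map k (box_at b bs) h \<in> gen_by E"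
    "\<And>y. y < \<alpha> \<or> \<alpha> + sum_list v \<le> y \<Longrightarrow> h y = y"
    "\<And>y. \<alpha> \<le> y \<and> y < \<alpha> + sum_list v \<Longrightarrow> \<alpha> \<le> h y \<and> h y < \<alpha> + sum_list v"
    "\<And>p l. (p, l) \<in> pieces \<alpha> v \<Longrightarrow> (\<exists>p'. (p', l) \<in> pieces \<alpha> w \<and> (\<forall>y. p \<le> y \<and> y < p + l \<longrightarrow> h y = y + (p' - p)))"
    by blast
  have gB: "b ! k \<le> g y \<and> g y < b ! k + bs ! k" if "b ! k \<le> y" "y < b ! k + bs ! k" for y
    using g(2)[of y] g(3)[of y] that wperm_trans.prems(2,3) by fastforce
  have "axis_map k (box_at b bs) (h \<circ> g) = axis_map k (box_at b bs) h \<circ> axis_map k (box_at b bs) g"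
  proof
    fix x
    show "axis_map k (box_at b bs) (h \<circ> g) x = (axis_map k (box_at b bs) h \<circ> axis_map k (box_at b bs) g) x"
    proof (cases "x \<in> box_at b bs")
      case True
      hence "b ! k \<le> x ! k" "x ! k < b ! k + bs ! k" "length x = d" using k by (auto simp: box_at_def)
      moreover from this have "x[k := g (x ! k)] \<in> box_at b bs" using gB by (intro box_at_upd[OF True k]) blast+
      ultimately show ?thesis using True k by (simp add: axis_map_def)
    qed (simp add: axis_map_def)
  qed
  hence 1: "axis_map k (box_at b bs) (h \<circ> g) \<in> gen_by E" using gen_by_comp[OF h(1) g(1)] by simp
  show ?case
  proof (intro exI[of _ "h \<circ> g"] conjI allI impI 1)
    fix y assume "y < \<alpha> \<or> \<alpha> + sum_list u \<le> y"
    thus "(h \<circ> g) y = y" using g(2) h(2) s by simp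
  next
    fix y assume "\<alpha> \<le> y \<and> y < \<alpha> + sum_list u"
    thus "\<alpha> \<le> (h \<circ> g) y" "(h \<circ> g) y < \<alpha> + sum_list u" using g(3) h(3) s by simp_all
  next
    fix p l assume "(p, l) \<in> pieces \<alpha> u"
    then obtain p' where p': "(p', l) \<in> pieces \<alpha> v" "\<And>y. p \<le> y \<and> y < p + l \<Longrightarrow> g y = y + (p' - p)" using g(4) by blast
    from h(4)[OF p'(1)] obtain p'' where p'': "(p'', l) \<in> pieces \<alpha> w" "\<And>y. p' \<le> y \<and> y < p' + l \<Longrightarrow> h y = y + (p'' - p')" by blast
    have "(h \<circ> g) y = y + (p'' - p)" if y: "p \<le> y \<and> y < p + l" for y
    proof -
      have "h (y + (p' - p)) = y + (p' - p) + (p'' - p')" by (rule p''(2)) (use y in auto)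
      thus ?thesis using p'(2)[OF y] by simp
    qed
    thus "\<exists>p'. (p', l) \<in> pieces \<alpha> w \<and> (\<forall>y. p \<le> y \<and> y < p + l \<longrightarrow> (h \<circ> g) y = y + (p' - p))" using p''(1) by blast
  qed
qed

text \<open>By rational independence, the grid cuts a box and its translate into the same multiset of lengths
  along each axis.\<close>
lemma box_rearrange:
  assumes E: "qindep E" "\<forall>e\<in>E. e > 0" and C: "gridset d C M" "grid_gaps E C"
    and a: "length a = d" "length ts = d" "length v = d" "\<forall>i<d. ts ! i > 0"
    and aC: "set a \<subseteq> C" "set (vadd a ts) \<subseteq> C" "set (vadd a v) \<subseteq> C" "set (vadd (vadd a v) ts) \<subseteq> C"
    and sub: "box_at (vadd a v) ts \<subseteq> M"
  shows "\<exists>h\<in>gen_by E. (\<forall>x. x \<in> box_at (vadd a v) ts \<longrightarrow> h x \<in> box_at (vadd a v) ts) \<and> (\<forall>x. x \<notin> box_at (vadd a v) ts \<longrightarrow> h x = x) \<and>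
    (\<forall>p\<in>pts C (box_at a ts). \<exists>p'\<in>pts C (box_at (vadd a v) ts). map (gap C) p' = map (gap C) p \<and>
       (\<forall>y\<in>cell d C p. h (vadd y v) = vadd y (vdiff p' p)))"
proof -
  let ?b = "vadd a v" and ?B = "box_at (vadd a v) ts"
  let ?P = "\<lambda>k g p p'. p' \<in> C \<and> ?b ! k \<le> p' \<and> p' < ?b ! k + ts ! k \<and> gap C p' = gap C p \<and>
      (\<forall>y. p \<le> y \<and> y < p + gap C p \<longrightarrow> g (y + v ! k) = y + (p' - p))"
  let ?Q = "\<lambda>k g. axis_map k ?B g \<in> gen_by E \<and>
      (\<forall>y. ?b ! k \<le> y \<and> y < ?b ! k + ts ! k \<longrightarrow> ?b ! k \<le> g y \<and> g y < ?b ! k + ts ! k) \<and>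
      (\<forall>p. p \<in> C \<and> a ! k \<le> p \<and> p < a ! k + ts ! k \<longrightarrow> (\<exists>p'. ?P k g p p'))"
  have fC: "finite C" using gridset_finite[OF C(1)] .
  have lb: "length ?b = d" using a by simp
  have gB: "gridset d C ?B" "gridset d C (box_at a ts)"
    using a aC fC by (auto simp: box_at_box rect_data_def intro!: gridset_box)
  have "\<exists>g. ?Q k g" if k: "k < d" for k
  proof -
    have m: "a ! k \<in> C" "a ! k + ts ! k \<in> C" "?b ! k \<in> C" "?b ! k + ts ! k \<in> C" "?b ! k = a ! k + v ! k"
      using set_nthD[OF aC(1), of k] set_nthD[OF aC(2), of k] set_nthD[OF aC(3), of k] set_nthD[OF aC(4), of k] k a by auto
    have tk: "ts ! k > 0" using a k by auto
    obtain w where w: "set w \<subseteq> E" "sum_list w = ts ! k" "pieces (a ! k) w = (\<lambda>x. (x, gap C x)) ` (C \<inter> {a ! k..<a ! k + ts ! k})"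
      using grid_word[OF fC m(2) _ m(1) C(2)] tk by auto
    obtain w' where w': "set w' \<subseteq> E" "sum_list w' = ts ! k" "pieces (?b ! k) w' = (\<lambda>x. (x, gap C x)) ` (C \<inter> {?b ! k..<?b ! k + ts ! k})"
      using grid_word[OF fC m(4) _ m(3) C(2)] tk by auto
    have "wperm w w'" using qindep_mset_eq[OF E(1) w(1) w'(1)] w(2) w'(2) mset_eq_imp_wperm by metis
    from axis_map_wperm_gen_by[OF this w(1), of ?b k "?b ! k" ts, OF _ _ E(2) C lb a(2) gB(1) sub aC(3) k]
    obtain g where g: "axis_map k ?B g \<in> gen_by E"
      "\<And>y. ?b ! k \<le> y \<and> y < ?b ! k + sum_list w \<Longrightarrow> ?b ! k \<le> g y \<and> g y < ?b ! k + sum_list w"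
      "\<And>p l. (p, l) \<in> pieces (?b ! k) w \<Longrightarrow> (\<exists>p'. (p', l) \<in> pieces (?b ! k) w' \<and> (\<forall>y. p \<le> y \<and> y < p + l \<longrightarrow> g y = y + (p' - p)))"
      using w(2) by auto
    show ?thesis
    proof (intro exI[of _ g] conjI g(1) allI impI)
      fix y assume "?b ! k \<le> y \<and> y < ?b ! k + ts ! k"
      thus "?b ! k \<le> g y" "g y < ?b ! k + ts ! k" using g(2) w(2) by simp_all
    next
      fix p assume p: "p \<in> C \<and> a ! k \<le> p \<and> p < a ! k + ts ! k"
      hence "(p, gap C p) \<in> pieces (a ! k) w" unfolding w(3) by auto
      hence "(p + v ! k, gap C p) \<in> pieces (?b ! k) w" unfolding m(5) pieces_shift by force
      from g(3)[OF this] obtain p' where p': "(p', gap C p) \<in> pieces (?b ! k) w'"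
        "\<And>y. p + v ! k \<le> y \<and> y < p + v ! k + gap C p \<Longrightarrow> g y = y + (p' - (p + v ! k))" by blast
      have "p' \<in> C \<and> ?b ! k \<le> p' \<and> p' < ?b ! k + ts ! k \<and> gap C p' = gap C p" using p'(1) unfolding w'(3) by auto
      moreover have "g (y + v ! k) = y + (p' - p)" if "p \<le> y \<and> y < p + gap C p" for y
        using p'(2)[of "y + v ! k"] that by simp
      ultimately show "\<exists>p'. ?P k g p p'" by blast
    qed
  qed
  hence "\<forall>k. \<exists>g. k < d \<longrightarrow> ?Q k g" by blast
  from choice[OF this] obtain g where g: "\<And>k. k < d \<Longrightarrow> axis_map k ?B (g k) \<in> gen_by E"
    "\<And>k y. k < d \<Longrightarrow> ?b ! k \<le> y \<and> y < ?b ! k + ts ! k \<Longrightarrow> ?b ! k \<le> g k y \<and> g k y < ?b ! k + ts ! k"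
    "\<And>k p. k < d \<Longrightarrow> p \<in> C \<and> a ! k \<le> p \<and> p < a ! k + ts ! k \<Longrightarrow> \<exists>p'. ?P k (g k) p p'" by blast
  \<comment> \<open>The axes are treated one by one, \<open>n\<close> of them being done. Each axis
    map changes its own coordinate only, so the maps do not interfere.\<close>
  have "\<exists>h\<in>gen_by E. (\<forall>x\<in>?B. h x \<in> ?B \<and> (\<forall>i<d. h x ! i = (if i < n then g i (x ! i) else x ! i))) \<and> (\<forall>x. x \<notin> ?B \<longrightarrow> h x = x)"
    if "n \<le> d" for n using that
  proof (induction n)
    case 0 show ?case by (intro bexI[of _ id]) (auto simp: gen_by_id)
  next
    case (Suc n)
    then obtain h where h: "h \<in> gen_by E" "\<And>x. x \<in> ?B \<Longrightarrow> h x \<in> ?B \<and> (\<forall>i<d. h x ! i = (if i < n then g i (x ! i) else x ! i))"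
      "\<And>x. x \<notin> ?B \<Longrightarrow> h x = x" by auto
    have n: "n < d" using Suc.prems by simp
    show ?case
    proof (intro bexI[of _ "axis_map n ?B (g n) \<circ> h"] conjI ballI allI impI)
      show "axis_map n ?B (g n) \<circ> h \<in> gen_by E" by (intro gen_by_comp g(1) n h(1))
      show "(axis_map n ?B (g n) \<circ> h) x = x" if "x \<notin> ?B" for x using h(3) that by (simp add: axis_map_def)
      fix x assume x: "x \<in> ?B"
      have hx: "h x \<in> ?B" "length (h x) = d" using h(2)[OF x] box_at_len by blast+
      have "?b ! n \<le> h x ! n \<and> h x ! n < ?b ! n + ts ! n" using hx(1) n unfolding box_at_def by blast
      from g(2)[OF n this] show "(axis_map n ?B (g n) \<circ> h) x \<in> ?B" using hx box_at_upd[OF hx(1) n] by (simp add: axis_map_def)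
      fix i assume i: "i < d"
      thus "(axis_map n ?B (g n) \<circ> h) x ! i = (if i < Suc n then g i (x ! i) else x ! i)"
        using hx h(2)[OF x] by (auto simp: axis_map_def nth_list_update less_Suc_eq)
    qed
  qed
  from this[OF order_refl] obtain h where h: "h \<in> gen_by E" "\<And>x. x \<in> ?B \<Longrightarrow> h x \<in> ?B"
     "\<And>x i. x \<in> ?B \<Longrightarrow> i < d \<Longrightarrow> h x ! i = g i (x ! i)" "\<And>x. x \<notin> ?B \<Longrightarrow> h x = x" by auto
  show ?thesis
  proof (intro bexI[OF _ h(1)] conjI allI impI ballI)
    fix p assume p: "p \<in> pts C (box_at a ts)"
    have lp: "length p = d" using pts_length[OF gB(2) p] .
    have "\<forall>k. \<exists>p'. k < d \<longrightarrow> ?P k (g k) (p ! k) p'"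
    proof
      fix k show "\<exists>p'. k < d \<longrightarrow> ?P k (g k) (p ! k) p'"
      proof (cases "k < d")
        case True
        have "p ! k \<in> C \<and> a ! k \<le> p ! k \<and> p ! k < a ! k + ts ! k"
          using p True pts_nth_nx(1)[OF gB(2) p True] by (auto simp: pts_def box_at_def)
        from g(3)[OF True this] show ?thesis by blast
      qed simp
    qed
    from choice[OF this] obtain p' where p': "\<And>k. k < d \<Longrightarrow> p' k \<in> C \<and> ?b ! k \<le> p' k \<and> p' k < ?b ! k + ts ! k \<and> gap C (p' k) = gap C (p ! k)"
      "\<And>k y. k < d \<Longrightarrow> p ! k \<le> y \<and> y < p ! k + gap C (p ! k) \<Longrightarrow> g k (y + v ! k) = y + (p' k - p ! k)" by blast
    let ?p = "map p' [0..<d]"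
    show "\<exists>p'\<in>pts C ?B. map (gap C) p' = map (gap C) p \<and> (\<forall>y\<in>cell d C p. h (vadd y v) = vadd y (vdiff p' p))"
    proof (intro bexI[of _ ?p] conjI ballI)
      show "?p \<in> pts C ?B" using p'(1) by (auto simp: pts_def box_at_def)
      show "map (gap C) ?p = map (gap C) p" using p'(1) lp by (intro nth_equalityI) auto
      fix y assume y: "y \<in> cell d C p"
      hence yb: "y \<in> box_at p (map (gap C) p)" using cell_box_at[OF lp] by simp
      have "y \<in> box_at a ts" using y cell_subset[OF gB(2) p] by blast
      hence yB: "vadd y v \<in> ?B" using box_at_shift(1)[OF a(1,3)] by blast
      have ly: "length y = d" using box_at_len[OF yb] .
      show "h (vadd y v) = vadd y (vdiff ?p p)"
      proof (rule nth_equalityI)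
        show "length (h (vadd y v)) = length (vadd y (vdiff ?p p))" using box_at_len[OF h(2)[OF yB]] ly lp by simp
        fix i assume "i < length (h (vadd y v))"
        hence i: "i < d" using box_at_len[OF h(2)[OF yB]] by simp
        have "p ! i \<le> y ! i \<and> y ! i < p ! i + gap C (p ! i)" using yb i lp by (auto simp: box_at_def)
        from p'(2)[OF i this] show "h (vadd y v) ! i = vadd y (vdiff ?p p) ! i"
          using h(3)[OF yB i] i ly lp a(3) by simp
      qed
    qed
  qed (use h in auto)
qed

text \<open>A permutation is sorted by transpositions. Following \<open>F\<close> by the swap of the
  cells at \<open>p\<close> and \<open>F p\<close> makes \<open>F\<close> fix the cell at
  \<open>p\<close> and moves no cell that was fixed before. The condition on the gaps makes the two
  cells translates of each other, so that the swap exists.\<close>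

lemma cell_permutation_gen_by:
  assumes C: "gridset d C M" and F: "is_rec F"
    and P: "\<And>p. p \<in> pts C M \<Longrightarrow> \<exists>p'\<in>pts C M. map (gap C) p' = map (gap C) p \<and> (\<forall>y\<in>cell d C p. F y = vadd y (vdiff p' p))"
  shows "F \<in> gen_by E"
  using F P
proof (induction "card {p \<in> pts C M. F p \<noteq> p}" arbitrary: F rule: less_induct)
  case less
  note F = less.prems(1) and P = less.prems(2)
  have lp: "length p = d" if "p \<in> pts C M" for p using pts_length[OF C that] .
  have Fp: "F p \<in> pts C M \<and> map (gap C) (F p) = map (gap C) p \<and> (\<forall>y\<in>cell d C p. F y = vadd y (vdiff (F p) p))"
    if p: "p \<in> pts C M" for p
  proof -
    obtain p' where p': "p' \<in> pts C M" "map (gap C) p' = map (gap C) p" "\<forall>y\<in>cell d C p. F y = vadd y (vdiff p' p)"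
      using P[OF p] by blast
    have "F p = p'" using p'(3) self_in_cell[OF C p] vadd_vdiff[of p p'] lp[OF p] lp[OF p'(1)] by simp
    thus ?thesis using p' by simp
  qed
  have fin: "finite {p \<in> pts C M. F p \<noteq> p}" using finite_pts[OF C] by simp
  show ?case
  proof (cases "{p \<in> pts C M. F p \<noteq> p} = {}")
    case True
    have "F x = x" for x
    proof (cases "x \<in> M")
      case xM: True
      let ?p = "map (fl C) x"
      have p: "?p \<in> pts C M" "x \<in> cell d C ?p" using fl_pts[OF C xM] by auto
      have "F ?p = ?p" using True p(1) by blast
      moreover have "vdiff ?p ?p = replicate (length x) 0" by (intro nth_equalityI) auto
      ultimately have "F x = vadd x (replicate (length x) 0)" using Fp[OF p(1)] p(2) by simp
      also have "\<dots> = x" by (intro nth_equalityI) auto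
      finally show ?thesis .
    qed (use F is_rec_out in blast)
    hence "F = id" by auto
    thus ?thesis using gen_by_id by simp
  next
    case False
    then obtain p where p: "p \<in> pts C M" "F p \<noteq> p" by blast
    let ?p = "F p"
    have p': "?p \<in> pts C M" "map (gap C) ?p = map (gap C) p" using Fp[OF p(1)] by auto
    let ?g = "map (gap C) p" and ?v = "vdiff ?p p"
    have pv: "vadd p ?v = ?p" using vadd_vdiff lp p(1) p'(1) by metis
    have cells: "cell d C p = box_at p ?g" "cell d C ?p = box_at ?p ?g" using cell_box_at lp p(1) p' by metis+
    have lv: "length ?v = d" using lp p p' by simp
    have s: "swap_data p ?g ?v" unfolding swap_data_def pv cells[symmetric]
      using lp[OF p(1)] lv cell_subset[OF C] p(1) p'(1) cell_eq[OF C p(1) C p'(1)] p(2) pts_nth_nx(3)[OF C p(1)]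
      by (auto simp: gap_def)
    let ?s = "swap_map p ?g ?v"
    have s1: "?s y = vadd y ?v" if "y \<in> cell d C p" for y using that by (simp add: swap_map_def cells)
    have s2: "?s y = vdiff y ?v" if "y \<in> cell d C ?p" for y
      using that s unfolding swap_map_def swap_data_def pv cells by auto
    have s3: "?s y = y" if "y \<notin> cell d C p" "y \<notin> cell d C ?p" for y using that by (simp add: swap_map_def pv cells)
    have FC: "F y \<in> cell d C (F r)" if r: "r \<in> pts C M" and y: "y \<in> cell d C r" for r y
    proof -
      have l: "length r = d" "length (F r) = d" using lp Fp[OF r] r by auto
      have "vadd y (vdiff (F r) r) \<in> box_at (vadd r (vdiff (F r) r)) (map (gap C) r)"
        using y cell_box_at l by (intro box_at_shift(1)) auto
      moreover have "vadd r (vdiff (F r) r) = F r" using vadd_vdiff l by simp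
      ultimately show ?thesis using Fp[OF r] y cell_box_at[OF l(2)] by simp
    qed
    have rs: "is_rec (?s \<circ> F)" by (rule is_rec_comp[OF swap_map_is_rec[OF s] F])
    have ret: "?s (F y) = y" if "y \<in> cell d C p" for y
    proof -
      have "F y = vadd y ?v" using Fp[OF p(1)] that by blast
      moreover have "length y = d" using that cells box_at_len by auto
      ultimately show ?thesis using s2[OF FC[OF p(1) that]] vadd_vdiff_cancel(2)[OF _ lv] by simp
    qed
    have "{r \<in> pts C M. (?s \<circ> F) r \<noteq> r} \<subset> {r \<in> pts C M. F r \<noteq> r}"
    proof
      show "{r \<in> pts C M. (?s \<circ> F) r \<noteq> r} \<subseteq> {r \<in> pts C M. F r \<noteq> r}"
      proof safe
        fix r assume r: "r \<in> pts C M" "(?s \<circ> F) r \<noteq> r" "F r = r"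
        have n: "r \<noteq> p" "r \<noteq> ?p" using r p is_rec_inj[OF F, of r p] by auto
        have "r \<notin> cell d C p" "r \<notin> cell d C ?p"
          using cell_eq[OF C r(1) C p(1) self_in_cell[OF C r(1)]] cell_eq[OF C r(1) C p'(1) self_in_cell[OF C r(1)]] n by auto
        thus False using s3 r by simp
      qed
      show "{r \<in> pts C M. (?s \<circ> F) r \<noteq> r} \<noteq> {r \<in> pts C M. F r \<noteq> r}"
        using ret[OF self_in_cell[OF C p(1)]] p by auto
    qed
    hence "card {r \<in> pts C M. (?s \<circ> F) r \<noteq> r} < card {r \<in> pts C M. F r \<noteq> r}" by (rule psubset_card_mono[OF fin])
    hence "?s \<circ> F \<in> gen_by E"
    proof (rule less.hyps[OF _ rs])
      fix r assume r: "r \<in> pts C M"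
      have lr: "length r = d" "length (F r) = d" using lp r Fp[OF r] by auto
      \<comment> \<open>The swap matters for the cell at \<open>p\<close>, which returns to its
        place, and for the cell that \<open>F\<close> sends to \<open>p\<close>, which now goes to
        \<open>F p\<close>. All other cells keep their image.\<close>
      consider "F r = ?p" | "F r = p" "F r \<noteq> ?p" | "F r \<noteq> p" "F r \<noteq> ?p" by blast
      thus "\<exists>p'\<in>pts C M. map (gap C) p' = map (gap C) r \<and> (\<forall>y\<in>cell d C r. (?s \<circ> F) y = vadd y (vdiff p' r))"
      proof cases
        case 1
        hence "r = p" using is_rec_inj[OF F] by blast
        moreover have "(?s \<circ> F) y = vadd y (vdiff p p)" if "y \<in> cell d C p" for y
          using ret[OF that] lp[OF p(1)] cells box_at_len that by (intro nth_equalityI) auto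
        ultimately show ?thesis using p(1) by (intro bexI[of _ p]) auto
      next
        case 2
        have "(?s \<circ> F) y = vadd y (vdiff ?p r)" if y: "y \<in> cell d C r" for y
        proof -
          have ly: "length y = d" using y cell_box_at[OF lr(1)] box_at_len by auto
          have "F y = vadd y (vdiff p r)" using Fp[OF r] y 2 by simp
          moreover have "?s (F y) = vadd (F y) ?v" using s1 FC[OF r y] 2 by simp
          ultimately show ?thesis using ly lr lp[OF p(1)] lp[OF p'(1)] by (intro nth_equalityI) auto
        qed
        moreover have "map (gap C) ?p = map (gap C) r" using p'(2) Fp[OF r] 2 by simp
        ultimately show ?thesis using p'(1) by (intro bexI[of _ ?p]) auto
      next
        case 3
        have "(?s \<circ> F) y = vadd y (vdiff (F r) r)" if y: "y \<in> cell d C r" for y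
        proof -
          have "F r \<in> pts C M" using Fp[OF r] by blast
          hence "F y \<notin> cell d C p" "F y \<notin> cell d C ?p"
            using cell_eq[OF C _ C p(1) FC[OF r y]] cell_eq[OF C _ C p'(1) FC[OF r y]] 3 by auto
          thus ?thesis using s3 Fp[OF r] y by simp
        qed
        thus ?thesis using Fp[OF r] by blast
      qed
    qed
    hence "?s \<circ> (?s \<circ> F) \<in> gen_by E" using gen_by_comp[OF gen_by_swap_map[OF s]] by blast
    moreover have "?s \<circ> (?s \<circ> F) = F" using swap_map_comp[OF s] by (metis comp_assoc id_comp)
    ultimately show ?thesis by simp
  qed
qed

theorem generation:
  assumes f: "is_rec f" and \<epsilon>: "\<epsilon> > 0"
  shows "\<exists>E. qindep E \<and> (\<forall>e\<in>E. 0 < e \<and> e < \<epsilon>) \<and> f \<in> gen_by E"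
proof -
  obtain C0 where C0: "adapted C0 f" using f by (auto simp: is_rec_def)
  note M0 = adapted_grid[OF C0]
  define J where "J = pts C0 M"
  have fJ: "finite J" using finite_pts[OF M0] by (simp add: J_def)
  have J: "length p = d" "length (disp f p) = d" "p \<in> M" "\<forall>i<d. gap C0 (p ! i) > 0" if "p \<in> J" for p
    using that pts_length[OF M0] disp_len[OF f] pts_nth_nx(3)[OF M0] by (auto simp: J_def pts_def gap_def)
  let ?g = "\<lambda>p. map (gap C0) p"
  \<comment> \<open>The corner coordinates of all pieces of \<open>f\<close> and of their images, so
    that \<open>box_rearrange\<close> applies to every piece.\<close>
  define C1 where "C1 = C0 \<union> (\<Union>p\<in>J. set p \<union> set (vadd p (?g p)) \<union> set (vadd p (disp f p)) \<union> set (vadd (vadd p (disp f p)) (?g p)))"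
  have "finite C1" using gridset_finite[OF M0] fJ by (simp add: C1_def)
  from grid_refine_small[OF this \<epsilon>] obtain E C where E: "qindep E" "\<forall>e\<in>E. 0 < e \<and> e < \<epsilon>"
    and C: "finite C" "C1 \<subseteq> C" "grid_gaps E C" by blast
  have M: "gridset d C M" using gridset_mono[OF M0 _ C(1)] C(2) by (auto simp: C1_def)
  have Epos: "\<forall>e\<in>E. e > 0" using E by blast
  let ?R = "\<lambda>p. box_at p (?g p)" and ?R' = "\<lambda>p. box_at (vadd p (disp f p)) (?g p)"
  let ?H = "\<lambda>p h. (\<forall>x. x \<in> ?R' p \<longrightarrow> h x \<in> ?R' p) \<and> (\<forall>x. x \<notin> ?R' p \<longrightarrow> h x = x) \<and>
    (\<forall>r\<in>pts C (?R p). \<exists>r'\<in>pts C (?R' p). map (gap C) r' = map (gap C) r \<and>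
       (\<forall>y\<in>cell d C r. h (vadd y (disp f p)) = vadd y (vdiff r' r)))"
  have R: "cell d C0 p = ?R p" if "p \<in> J" for p using cell_box_at J(1)[OF that] by simp
  have fR: "f y = vadd y (disp f p)" if "p \<in> J" "y \<in> ?R p" for p y
    using is_rec_disp[OF f] disp_cell[OF C0, of p y] that R[OF that(1)] cell_subset[OF M0, of p] by (auto simp: J_def)
  have R': "?R' p = f ` ?R p" if p: "p \<in> J" for p
  proof -
    have "?R' p = (\<lambda>y. vadd y (disp f p)) ` ?R p"
    proof (intro Set.set_eqI iffI)
      fix x assume x: "x \<in> ?R' p"
      have "x = vadd (vdiff x (disp f p)) (disp f p)" using vadd_vdiff_cancel(1) box_at_len[OF x] J(2)[OF p] by simp
      thus "x \<in> (\<lambda>y. vadd y (disp f p)) ` ?R p" using box_at_shift(2)[OF J(1,2)[OF p] x] by blast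
    qed (use box_at_shift(1)[OF J(1,2)[OF p]] in blast)
    thus ?thesis using fR[OF p] by simp
  qed
  have R'M: "?R' p \<subseteq> M" if "p \<in> J" for p
    using R'[OF that] R[OF that] cell_subset[OF M0, of p] that is_rec_in[OF f] by (auto simp: J_def)
  have "\<exists>h\<in>gen_by E. ?H p h" if p: "p \<in> J" for p
    by (rule box_rearrange[OF E(1) Epos M C(3) J(1)[OF p] _ J(2)[OF p]])
       (use J[OF p] p R'M[OF p] C(2) in \<open>auto simp: C1_def\<close>)
  hence "\<forall>p\<in>J. \<exists>h. h \<in> gen_by E \<and> ?H p h" unfolding Bex_def by (intro ballI)
  from bchoice[OF this] obtain h where hh: "\<forall>p\<in>J. h p \<in> gen_by E \<and> ?H p (h p)" ..
  have h: "\<And>p. p \<in> J \<Longrightarrow> h p \<in> gen_by E" "\<And>p x. p \<in> J \<Longrightarrow> x \<in> ?R' p \<Longrightarrow> h p x \<in> ?R' p"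
    "\<And>p x. p \<in> J \<Longrightarrow> x \<notin> ?R' p \<Longrightarrow> h p x = x"
    "\<And>p r. p \<in> J \<Longrightarrow> r \<in> pts C (?R p) \<Longrightarrow> \<exists>r'\<in>pts C (?R' p). map (gap C) r' = map (gap C) r \<and>
       (\<forall>y\<in>cell d C r. h p (vadd y (disp f p)) = vadd y (vdiff r' r))"
    using bspec[OF hh] by simp_all
  \<comment> \<open>The rearrangements act inside the images of the pieces, which are disjoint
    because \<open>f\<close> is injective.\<close>
  have "\<exists>H\<in>gen_by E. (\<forall>p\<in>J. \<forall>x\<in>?R' p. H x = h p x) \<and> (\<forall>x. (\<forall>p\<in>J. x \<notin> ?R' p) \<longrightarrow> H x = x)"
  proof (rule glue[OF fJ gen_by_id gen_by_comp h(1,2,3)])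
    fix p p' x assume p: "p \<in> J" "p' \<in> J" and x: "x \<in> ?R' p" "x \<in> ?R' p'"
    obtain y where y: "y \<in> ?R p" "x = f y" using x R'[OF p(1)] by auto
    obtain y' where y': "y' \<in> ?R p'" "x = f y'" using x R'[OF p(2)] by auto
    have "y = y'" using is_rec_inj[OF f] y y' by blast
    thus "p = p'" using cell_eq[OF M0 _ M0, of p p' y] R p y y' by (auto simp: J_def)
  qed
  then obtain H where H: "H \<in> gen_by E" "\<And>p x. p \<in> J \<Longrightarrow> x \<in> ?R' p \<Longrightarrow> H x = h p x" by blast
  have "H \<circ> f \<in> gen_by E"
  proof (rule cell_permutation_gen_by[OF M is_rec_comp[OF gen_by_is_rec[OF H(1)] f]])
    fix r assume r: "r \<in> pts C M"
    have rM: "r \<in> M" "set r \<subseteq> C" using r by (auto simp: pts_def)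
    let ?p = "map (fl C0) r"
    have p: "?p \<in> J" using fl_pts(1)[OF M0 rM(1)] by (simp add: J_def)
    have rR: "r \<in> ?R ?p" using fl_pts(2)[OF M0 rM(1)] R[OF p] by simp
    have pC: "set ?p \<subseteq> C" "set (vadd ?p (?g ?p)) \<subseteq> C" using p C(2) unfolding C1_def by blast+
    have "?R ?p = box_d d ?p (vadd ?p (?g ?p))" using J(1)[OF p] by (intro box_at_box) simp_all
    moreover have "rect_data d ?p (vadd ?p (?g ?p))" using J(1,4)[OF p] by (simp add: rect_data_def)
    ultimately have gR: "gridset d C (?R ?p)" using gridset_box[OF C(1) _ pC] by simp
    have rp: "r \<in> pts C (?R ?p)" using rR rM by (simp add: pts_def)
    from h(4)[OF p rp] obtain r' where r': "r' \<in> pts C (?R' ?p)" "map (gap C) r' = map (gap C) r"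
       "\<forall>y\<in>cell d C r. h ?p (vadd y (disp f ?p)) = vadd y (vdiff r' r)" by blast
    have "r' \<in> pts C M" using r'(1) R'M[OF p] by (auto simp: pts_def)
    moreover have "(H \<circ> f) y = vadd y (vdiff r' r)" if y: "y \<in> cell d C r" for y
    proof -
      have "y \<in> ?R ?p" using cell_subset[OF gR rp] y by blast
      hence "f y = vadd y (disp f ?p)" "f y \<in> ?R' ?p" using fR[OF p] R'[OF p] by auto
      thus ?thesis using H(2)[OF p] r'(3) y by simp
    qed
    ultimately show "\<exists>p'\<in>pts C M. map (gap C) p' = map (gap C) r \<and> (\<forall>y\<in>cell d C r. (H \<circ> f) y = vadd y (vdiff p' r))"
      using r'(2) by blast
  qed
  hence "inv\<^bsub>G\<^esub> H \<otimes>\<^bsub>G\<^esub> (H \<circ> f) \<in> gen_by E"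
    using subgroup.m_closed[OF gen_by_subgroup subgroup.m_inv_closed[OF gen_by_subgroup H(1)]] by blast
  moreover have "inv\<^bsub>G\<^esub> H \<otimes>\<^bsub>G\<^esub> (H \<circ> f) = f"
  proof -
    interpret group G by (rule G_group)
    have "inv\<^bsub>G\<^esub> H \<otimes>\<^bsub>G\<^esub> (H \<otimes>\<^bsub>G\<^esub> f) = f" using gen_by_is_rec[OF H(1)] f
      by (simp only: m_assoc[symmetric] inv_closed l_inv l_one G_carrier[symmetric])
    thus ?thesis by simp
  qed
  ultimately show ?thesis using E by auto
qed

end

section \<open>The image of T\<close>

lemma real_subgroup_UNIV:
  fixes S :: "real set"
  assumes "0 \<in> S" "\<And>x y. x \<in> S \<Longrightarrow> y \<in> S \<Longrightarrow> x + y \<in> S" "\<And>x. x \<in> S \<Longrightarrow> - x \<in> S"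
    "\<epsilon> > 0" "\<And>x. 0 < x \<Longrightarrow> x < \<epsilon> \<Longrightarrow> x \<in> S"
  shows "x \<in> S"
proof -
  have pos: "x \<in> S" if x: "x > 0" for x
  proof -
    obtain n :: nat where n: "x / \<epsilon> < n" using reals_Archimedean2 by blast
    hence n0: "n > 0" using x assms(4) by (metis divide_pos_pos less_trans of_nat_0_less_iff)
    have "x / n < \<epsilon>" using n n0 assms(4) by (simp add: field_simps)
    hence y: "x / n \<in> S" using assms(5) x n0 by simp
    have "of_nat k * (x / n) \<in> S" for k
      by (induction k) (use assms(1,2) y in \<open>auto simp: distrib_right simp del: times_divide_eq_right\<close>)
    from this[of n] show ?thesis using n0 by simp
  qed
  show ?thesis using pos[of x] pos[of "- x"] assms(1) assms(3)[of "- x"] by (cases x "0 :: real" rule: linorder_cases) auto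
qed

text \<open>One slot is freed at a time, \<open>n\<close> counting the leading slots with arbitrary
  entries. With the other slots fixed, the entries for which \<open>m\<close> lands in
  \<open>H\<close> form a subgroup of the reals containing all small positive numbers, so they are
  all reals.\<close>

lemma madd_from_small:
  assumes H: "asub H" and m: "madd k H m" and \<epsilon>: "\<epsilon> > 0"
    and small: "\<And>zs. length zs = k \<Longrightarrow> (\<forall>j<k. 0 < zs ! j \<and> zs ! j < \<epsilon>) \<Longrightarrow> m zs \<in> H"
    and zs: "length zs = k"
  shows "m zs \<in> H"
proof -
  have "m zs \<in> H" if "n \<le> k" "length zs = k" "\<forall>j<k. n \<le> j \<longrightarrow> 0 < zs ! j \<and> zs ! j < \<epsilon>" for n zs
    using that
  proof (induction n arbitrary: zs)
    case 0 thus ?case using small by simp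
  next
    case (Suc n)
    let ?S = "{x. m (zs[n := x]) \<in> H}"
    have n: "n < k" using Suc.prems by simp
    have a: "m (zs[n := x + y]) - m (zs[n := x]) - m (zs[n := y]) \<in> H" for x y
      using madd_updD[OF m Suc.prems(2) n] .
    have z: "m (zs[n := 0]) \<in> H" using asub_uminus[OF H a[of 0 0]] by simp
    have "zs ! n \<in> ?S"
    proof (rule real_subgroup_UNIV[OF _ _ _ \<epsilon>])
      show "0 \<in> ?S" using z by simp
      show "x + y \<in> ?S" if "x \<in> ?S" "y \<in> ?S" for x y
        using asub_add[OF H asub_add[OF H a[of x y], of "m (zs[n := x])"], of "m (zs[n := y])"] that by simp
      show "- x \<in> ?S" if "x \<in> ?S" for x
      proof -
        have "m (zs[n := 0]) - m (zs[n := x]) - m (zs[n := - x]) \<in> H" using a[of x "- x"] by simp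
        from asub_diff[OF H asub_diff[OF H z, of "m (zs[n := x])"] this] that show ?thesis by simp
      qed
      fix x assume x: "0 < x" "x < \<epsilon>"
      have "m (zs[n := x]) \<in> H"
      proof (rule Suc.IH)
        show "\<forall>j<k. n \<le> j \<longrightarrow> 0 < zs[n := x] ! j \<and> zs[n := x] ! j < \<epsilon>"
          using Suc.prems x by (auto simp: nth_list_update)
      qed (use Suc.prems in auto)
      thus "x \<in> ?S" by simp
    qed
    thus ?case by simp
  qed
  from this[OF order_refl zs] show ?thesis by simp
qed

lemma swap_fac_upd_last:
  assumes "i < d" "length ts = d"
  shows "swap_fac d i (ts[i := t]) = butlast (swap_fac d i ts) @ [t]"
proof (rule nth_equalityI)
  fix j assume "j < length (swap_fac d i (ts[i := t]))"
  thus "swap_fac d i (ts[i := t]) ! j = (butlast (swap_fac d i ts) @ [t]) ! j"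
    using assms by (cases "j = d - 1") (auto simp: swap_fac_upd nth_append nth_butlast nth_list_update)
qed (use assms in auto)

lemma wedge_gens_eq:
  "{ptensor (ts @ [a, b]) \<otimes>\<^bsub>TP (Suc d)\<^esub> inv\<^bsub>TP (Suc d)\<^esub> ptensor (ts @ [b, a]) | ts a b. length ts = d - 1}
    = {cl (Suc d) (delta (ts @ [a, b]) - delta (ts @ [b, a])) | ts a b. length ts = d - 1}" if d: "d \<ge> 1"
proof -
  have *: "ptensor (ts @ [a, b]) \<otimes>\<^bsub>TP (Suc d)\<^esub> inv\<^bsub>TP (Suc d)\<^esub> ptensor (ts @ [b, a]) =
     cl (Suc d) (delta (ts @ [a, b]) - delta (ts @ [b, a]))" if l: "length ts = d - 1" for ts a b
  proof -
    have c: "delta (ts @ [a, b]) \<in> carrier (FreeQ (Suc d))" "delta (ts @ [b, a]) \<in> carrier (FreeQ (Suc d))" using l d by auto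
    have p: "ptensor (ts @ [a, b]) = cl (Suc d) (delta (ts @ [a, b]))" "ptensor (ts @ [b, a]) = cl (Suc d) (delta (ts @ [b, a]))"
      using l d by (auto intro!: ptensor_cl)
    show ?thesis unfolding p cl_inv[OF c(2)] cl_mult[OF c(1) asub_uminus[OF FreeQ_asub c(2)]] by simp
  qed
  show ?thesis by (intro Collect_cong) (metis *)
qed

context mrect begin

lemma wedge_eq: "wedge_sub d = generate (TP (Suc d)) {cl (Suc d) (delta (ts @ [a, b]) - delta (ts @ [b, a])) | ts a b. length ts = d - 1}"
  unfolding wedge_sub_def wedge_gens_eq[OF d1] ..

lemma wedge_subgroup: "subgroup (wedge_sub d) (TP (Suc d))"
  unfolding wedge_eq
proof (rule group.generate_is_subgroup[OF TP_group], safe)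
  fix ts :: "real list" and a b assume "length ts = d - 1"
  thus "cl (Suc d) (delta (ts @ [a, b]) - delta (ts @ [b, a])) \<in> carrier (TP (Suc d))"
    using d1 by (intro cl_carrier asub_diff[OF FreeQ_asub] delta_carrier) auto
qed

section \<open>T kills the derived subgroup and takes values in the wedge subgroup\<close>

lemma T_comp_hom: "i < d \<Longrightarrow> (\<lambda>f. T_comp d M f i) \<in> hom G (TP (Suc d))"
  by (rule homI) (simp_all only: G_carrier G_mult T_comp_carrier T_comp_mult)

lemma T_comp_group_hom: "i < d \<Longrightarrow> group_hom G (TP (Suc d)) (\<lambda>f. T_comp d M f i)"
  using T_comp_hom G_group TP_group by (simp add: group_hom_def group_hom_axioms_def)

lemma T_comp_id: "i < d \<Longrightarrow> T_comp d M id i = \<one>\<^bsub>TP (Suc d)\<^esub>"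
  using group_hom.hom_one[OF T_comp_group_hom] unfolding G_one .

lemma T_comp_DG:
  assumes i: "i < d" and f: "f \<in> DG" shows "T_comp d M f i = \<one>\<^bsub>TP (Suc d)\<^esub>"
proof -
  interpret T: group_hom G "TP (Suc d)" "\<lambda>f. T_comp d M f i" by (rule T_comp_group_hom[OF i])
  interpret TP: comm_group "TP (Suc d)" by (rule TP_comm_group)
  have "DG \<subseteq> kernel G (TP (Suc d)) (\<lambda>f. T_comp d M f i)"
    unfolding derived_def
  proof (rule T.G.generate_subgroup_incl[OF _ T.subgroup_kernel], safe)
    fix a b assume ab: "a \<in> carrier G" "b \<in> carrier G"
    let ?a = "T_comp d M a i" and ?b = "T_comp d M b i"
    have c: "?a \<in> carrier (TP (Suc d))" "?b \<in> carrier (TP (Suc d))" using ab T.hom_closed by blast+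
    have "T_comp d M (a \<otimes>\<^bsub>G\<^esub> b \<otimes>\<^bsub>G\<^esub> inv\<^bsub>G\<^esub> a \<otimes>\<^bsub>G\<^esub> inv\<^bsub>G\<^esub> b) i = ?a \<otimes>\<^bsub>TP (Suc d)\<^esub> ?b \<otimes>\<^bsub>TP (Suc d)\<^esub> inv\<^bsub>TP (Suc d)\<^esub> ?a \<otimes>\<^bsub>TP (Suc d)\<^esub> inv\<^bsub>TP (Suc d)\<^esub> ?b"
      using ab by (simp only: T.hom_mult T.hom_inv T.G.m_closed T.G.inv_closed)
    also have "?a \<otimes>\<^bsub>TP (Suc d)\<^esub> ?b \<otimes>\<^bsub>TP (Suc d)\<^esub> inv\<^bsub>TP (Suc d)\<^esub> ?a = ?b"
      using c by (simp add: TP.m_comm[of ?a ?b] T.H.m_assoc)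
    also have "?b \<otimes>\<^bsub>TP (Suc d)\<^esub> inv\<^bsub>TP (Suc d)\<^esub> ?b = \<one>\<^bsub>TP (Suc d)\<^esub>" by (rule T.H.r_inv[OF c(2)])
    finally show "a \<otimes>\<^bsub>G\<^esub> b \<otimes>\<^bsub>G\<^esub> inv\<^bsub>G\<^esub> a \<otimes>\<^bsub>G\<^esub> inv\<^bsub>G\<^esub> b \<in> kernel G (TP (Suc d)) (\<lambda>f. T_comp d M f i)"
      unfolding kernel_def using ab by (simp del: G_mult G_carrier)
  qed
  thus ?thesis using f by (auto simp: kernel_def)
qed

text \<open>No tensors need to be computed: a swap lies in the derived subgroup.\<close>

lemma T_comp_swap_map: "swap_data a ts v \<Longrightarrow> i < d \<Longrightarrow> T_comp d M (swap_map a ts v) i = \<one>\<^bsub>TP (Suc d)\<^esub>"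
  using T_comp_DG ab_class_swap_map ab_class_one_iff[OF swap_map_is_rec] by blast

text \<open>No case for inverses appears, because a swap is its own inverse and the inverse of a
  shuffle with lengths in \<open>E\<close> is again such a shuffle.\<close>

lemma gen_by_induct [consumes 1, case_names id swap_map shuffle comp]:
  assumes f: "f \<in> gen_by E" and P: "P id" "\<And>a ts v. swap_data a ts v \<Longrightarrow> P (swap_map a ts v)"
    "\<And>i a ts t. shuffle_data i a ts t \<Longrightarrow> set ts \<subseteq> E \<Longrightarrow> t \<in> E \<Longrightarrow> P (shuffle i a ts t)"
    "\<And>f g. is_rec f \<Longrightarrow> is_rec g \<Longrightarrow> P f \<Longrightarrow> P g \<Longrightarrow> P (f \<circ> g)"
  shows "P f"
proof -
  interpret group G by (rule G_group)
  have inv_eqI: "inv\<^bsub>G\<^esub> h = h'" if "h' \<circ> h = id" "is_rec h" "is_rec h'" for h h'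
    using that by (intro inv_equality) (simp_all only: G_mult G_one G_carrier)
  have "is_rec f \<and> P f" using f unfolding gen_by_def
  proof (induction f rule: generate.induct)
    case one show ?case using P(1) is_rec_id by (simp only: G_one)
  next
    case (incl h)
    thus ?case using P(2,3) swap_map_is_rec shuffle_is_rec by blast
  next
    case (inv h)
    then consider a ts v where "swap_data a ts v" "h = swap_map a ts v"
      | i a ts t where "shuffle_data i a ts t" "set ts \<subseteq> E" "t \<in> E" "h = shuffle i a ts t" by blast
    thus ?case
    proof cases
      case 1
      have "inv\<^bsub>G\<^esub> h = h" using inv_eqI[OF swap_map_comp[OF 1(1)] swap_map_is_rec[OF 1(1)] swap_map_is_rec[OF 1(1)]] 1(2) by simp
      thus ?thesis using 1 P(2) swap_map_is_rec by simp
    next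
      case 2
      note s = shuffle_data_inverse[OF 2(1)]
      have "inv\<^bsub>G\<^esub> h = shuffle i a (ts[i := t]) (ts ! i)" using inv_eqI[OF shuffle_comp[OF 2(1)] shuffle_is_rec[OF 2(1)] shuffle_is_rec[OF s]] 2(4) by simp
      moreover have "set (ts[i := t]) \<subseteq> E" using 2(2,3) set_update_subset_insert[of ts i t] by blast
      moreover have "ts ! i \<in> E" using 2(1,2) set_nthD[OF 2(2)] by (simp add: shuffle_data_def)
      ultimately show ?thesis using P(3)[OF s] shuffle_is_rec[OF s] by simp
    qed
  next
    case (eng h1 h2)
    thus ?case using P(4) is_rec_comp unfolding G_mult by blast
  qed
  thus ?thesis by blast
qed

lemma T_comp_wedge:
  assumes f: "is_rec f" and i: "i < d" shows "T_comp d M f i \<in> wedge_sub d"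
proof -
  obtain E where "f \<in> gen_by E" using generation[OF f zero_less_one] by blast
  thus ?thesis
  proof (induction rule: gen_by_induct)
    case id show ?case unfolding T_comp_id[OF i] by (rule subgroup.one_closed[OF wedge_subgroup])
  next
    case (swap_map a ts v) show ?case unfolding T_comp_swap_map[OF swap_map i] by (rule subgroup.one_closed[OF wedge_subgroup])
  next
    case (shuffle j a ts t)
    show ?case
    proof (cases "i = j")
      case True
      have l: "length ts = d" using shuffle(1) by (simp add: shuffle_data_def)
      let ?u = "butlast (swap_fac d i ts)"
      have 1: "swap_fac d i ts = ?u @ [ts ! i]" using swap_fac_upd_last[OF i l, of "ts ! i"] by simp
      have "cl (Suc d) (delta (?u @ [ts ! i, t]) - delta (?u @ [t, ts ! i])) \<in> wedge_sub d"
        unfolding wedge_eq by (rule generate.incl) (use l in \<open>auto intro!: exI[of _ ?u]\<close>)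
      moreover have "T_comp d M (shuffle j a ts t) i = cl (Suc d) (delta (?u @ [ts ! i, t]) - delta (?u @ [t, ts ! i]))"
        unfolding T_shuffle[OF shuffle(1) i] using True swap_fac_upd_last[OF i l, of t] 1 by (metis append.assoc append_Cons append_Nil)
      ultimately show ?thesis by simp
    next
      case False
      thus ?thesis unfolding T_shuffle[OF shuffle(1) i] using subgroup.one_closed[OF wedge_subgroup] by simp
    qed
  next
    case (comp f g)
    thus ?case unfolding T_comp_mult[OF comp(1,2) i] using subgroup.m_closed[OF wedge_subgroup] by blast
  qed
qed

text \<open>Formal sums whose class is attained in component \<open>i\<close> while the other
  components are trivial. They form a subgroup containing the relations, so this set can play the
  role of \<open>H\<close> in \<open>madd_from_small\<close>.\<close>

definition realized :: "nat \<Rightarrow> (real list \<Rightarrow> rat) set" where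
  "realized i = {u \<in> carrier (FreeQ (Suc d)). \<exists>f. is_rec f \<and> T_comp d M f i = cl (Suc d) u \<and>
     (\<forall>j<d. j \<noteq> i \<longrightarrow> T_comp d M f j = \<one>\<^bsub>TP (Suc d)\<^esub>)}"

lemma realized_asub: assumes i: "i < d" shows "asub (realized i)"
  unfolding asub_def
proof (intro conjI ballI)
  interpret G: group G by (rule G_group)
  interpret TP: comm_group "TP (Suc d)" by (rule TP_comm_group)
  show "0 \<in> realized i" unfolding realized_def
    using is_rec_id T_comp_id i asub_0[OF FreeQ_asub] cl_one by blast
  fix u v assume "u \<in> realized i" "v \<in> realized i"
  then obtain f g where u: "u \<in> carrier (FreeQ (Suc d))" and v: "v \<in> carrier (FreeQ (Suc d))"
    and f: "is_rec f" "T_comp d M f i = cl (Suc d) u" "\<forall>j<d. j \<noteq> i \<longrightarrow> T_comp d M f j = \<one>\<^bsub>TP (Suc d)\<^esub>"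
    and g: "is_rec g" "T_comp d M g i = cl (Suc d) v" "\<forall>j<d. j \<noteq> i \<longrightarrow> T_comp d M g j = \<one>\<^bsub>TP (Suc d)\<^esub>"
    unfolding realized_def by blast
  let ?h = "f \<circ> inv\<^bsub>G\<^esub> g"
  have ig: "is_rec (inv\<^bsub>G\<^esub> g)" using G.inv_closed g(1) G_carrier by blast
  have T: "T_comp d M ?h j = T_comp d M f j \<otimes>\<^bsub>TP (Suc d)\<^esub> inv\<^bsub>TP (Suc d)\<^esub> T_comp d M g j" if "j < d" for j
    unfolding T_comp_mult[OF f(1) ig that] using group_hom.hom_inv[OF T_comp_group_hom[OF that], of g] g(1) by simp
  have "T_comp d M ?h i = cl (Suc d) (u - v)"
    unfolding T[OF i] f(2) g(2) cl_inv[OF v] cl_mult[OF u asub_uminus[OF FreeQ_asub v]] by simp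
  moreover have "\<forall>j<d. j \<noteq> i \<longrightarrow> T_comp d M ?h j = \<one>\<^bsub>TP (Suc d)\<^esub>" using T f(3) g(3) by simp
  ultimately show "u - v \<in> realized i" unfolding realized_def
    using is_rec_comp[OF f(1) ig] asub_diff[OF FreeQ_asub u v] by blast
qed

lemma realized_rel: assumes "i < d" "u \<in> tensor_rel (Suc d)" shows "u \<in> realized i"
proof -
  have "cl (Suc d) u = cl (Suc d) 0" using assms(2) by (simp add: cl_eq_iff)
  thus ?thesis unfolding realized_def using is_rec_id T_comp_id assms tensor_rel_carrier cl_one by blast
qed

lemma shuffle_data_room:
  assumes "length a0 = d" "box_at a0 (replicate d L) \<subseteq> M" "i < d" "length ts = d"
    "\<forall>j<d. 0 < ts ! j \<and> ts ! j < \<epsilon>" "0 < t" "t < \<epsilon>" "2 * \<epsilon> \<le> L"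
  shows "shuffle_data i a0 ts t"
proof -
  have "box_at a0 (ts[i := ts ! i + t]) \<subseteq> box_at a0 (replicate d L)"
  proof
    fix x assume x: "x \<in> box_at a0 (ts[i := ts ! i + t])"
    have "a0 ! j \<le> x ! j \<and> x ! j < a0 ! j + replicate d L ! j" if j: "j < d" for j
    proof -
      have "a0 ! j \<le> x ! j" "x ! j < a0 ! j + ts[i := ts ! i + t] ! j" using x j unfolding box_at_def by blast+
      moreover have "ts[i := ts ! i + t] ! j \<le> L" using assms(3-8) j
        by (cases "j = i") (auto dest!: spec[of _ j])
      ultimately show ?thesis using j by simp
    qed
    thus "x \<in> box_at a0 (replicate d L)" using box_at_len[OF x] by (simp add: box_at_def)
  qed
  thus ?thesis using assms unfolding shuffle_data_def by blast
qed

lemma realized_wedge: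
  assumes i: "i < d" and ts: "length ts = d - 1"
  shows "delta (ts @ [a, b]) - delta (ts @ [b, a]) \<in> realized i"
proof -
  \<comment> \<open>Exchanges the last two of the \<open>Suc d\<close> slots, so that
    \<open>?m\<close> is an antisymmetrisation that makes sense, and is multiadditive, in all
    slots.\<close>
  let ?sf = "swap_fac (Suc d) (d - 1)"
  let ?m = "\<lambda>zs. delta zs - delta (?sf zs)"
  obtain a0 L where R: "length a0 = d" "L > 0" "box_at a0 (replicate d L) \<subseteq> M" using room by blast
  have m: "madd (Suc d) (realized i) ?m"
    unfolding madd_upd
  proof (intro allI impI)
    fix zs :: "real list" and j and x y :: real assume zs: "length zs = Suc d" "j < Suc d"
    have 1: "delta (zs[j := x + y]) - delta (zs[j := x]) - delta (zs[j := y]) \<in> realized i"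
      by (intro realized_rel[OF i] madd_updD[OF madd_delta zs])
    have 2: "delta (?sf (zs[j := x + y])) - delta (?sf (zs[j := x])) - delta (?sf (zs[j := y])) \<in> realized i"
      by (intro realized_rel[OF i] madd_updD[OF madd_swap_fac[OF madd_delta] zs]) simp
    from asub_diff[OF realized_asub[OF i] 1 2]
    show "?m (zs[j := x + y]) - ?m (zs[j := x]) - ?m (zs[j := y]) \<in> realized i" by (simp only: algebra_simps)
  qed
  have "?m (ts @ [a, b]) \<in> realized i"
  proof (rule madd_from_small[OF realized_asub[OF i] m, of "L / 2"])
    show "length (ts @ [a, b]) = Suc d" using ts d1 by simp
    fix zs :: "real list" assume zs: "length zs = Suc d" "\<forall>j<Suc d. 0 < zs ! j \<and> zs ! j < L / 2"
    \<comment> \<open>The sides are permuted in advance so that the \<open>swap_fac d i\<close>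
      occurring in the value of T restores the list \<open>zs\<close> itself.\<close>
    let ?ts = "swap_fac d i (take d zs)" and ?t = "zs ! d"
    have lt: "length (take d zs) = d" "length ?ts = d" using zs by simp_all
    have sd: "shuffle_data i a0 ?ts ?t"
    proof (rule shuffle_data_room[OF R(1,3) i lt(2), of "L / 2"])
      show "\<forall>j<d. 0 < ?ts ! j \<and> ?ts ! j < L / 2"
        using zs i d1 by (auto simp: swap_fac_def nth_list_update)
    qed (use zs R in auto)
    have n: "?ts ! i = zs ! (d - 1)" using i zs by (simp add: swap_fac_def nth_list_update)
    have e1: "swap_fac d i ?ts @ [?t] = zs"
      using swap_fac_swap_fac[OF i lt(1)] zs(1) by (metis lessI take_Suc_conv_app_nth take_all_iff order_refl)
    have e2: "swap_fac d i (?ts[i := ?t]) @ [?ts ! i] = ?sf zs"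
      unfolding swap_fac_upd_last[OF i lt(2)] swap_fac_swap_fac[OF i lt(1)] n
      by (rule nth_equalityI) (use zs d1 in \<open>auto simp: swap_fac_def nth_list_update nth_append nth_butlast\<close>)
    have "?m zs \<in> carrier (FreeQ (Suc d))" using zs by (intro asub_diff[OF FreeQ_asub] delta_carrier) auto
    thus "?m zs \<in> realized i" unfolding realized_def
      using T_shuffle[OF sd] shuffle_is_rec[OF sd] i unfolding e1 e2 by auto
  qed (use R in simp)
  moreover have "?sf (ts @ [a, b]) = ts @ [b, a]"
    by (rule nth_equalityI) (use ts d1 in \<open>auto simp: swap_fac_def nth_list_update nth_append\<close>)
  ultimately show ?thesis by simp
qed

lemma wedge_realized:
  assumes i: "i < d" and w: "w \<in> wedge_sub d"
  shows "\<exists>f. is_rec f \<and> T_comp d M f i = w \<and> (\<forall>j<d. j \<noteq> i \<longrightarrow> T_comp d M f j = \<one>\<^bsub>TP (Suc d)\<^esub>)"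
proof -
  have *: "\<exists>u\<in>realized i. w = cl (Suc d) u"
    using w unfolding wedge_eq
  proof (induction w rule: generate.induct)
    case one show ?case using asub_0[OF realized_asub[OF i]] cl_one by blast
  next
    case (incl h) thus ?case using realized_wedge[OF i] by blast
  next
    case (inv h)
    then obtain u where u: "u \<in> realized i" "h = cl (Suc d) u" using realized_wedge[OF i] by blast
    hence "u \<in> carrier (FreeQ (Suc d))" by (simp add: realized_def)
    from cl_inv[OF this] u show ?case using asub_uminus[OF realized_asub[OF i] u(1)] by blast
  next
    case (eng h1 h2)
    then obtain u v where u: "u \<in> realized i" "h1 = cl (Suc d) u" "v \<in> realized i" "h2 = cl (Suc d) v" by blast
    hence "u \<in> carrier (FreeQ (Suc d))" "v \<in> carrier (FreeQ (Suc d))" by (simp_all add: realized_def)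
    from cl_mult[OF this] u show ?case using asub_add[OF realized_asub[OF i] u(1,3)] by blast
  qed
  thus ?thesis unfolding realized_def by blast
qed

lemma T_image: "T_map d M ` carrier G = (\<Pi>\<^sub>E i\<in>{..<d}. wedge_sub d)"
proof
  show "T_map d M ` carrier G \<subseteq> (\<Pi>\<^sub>E i\<in>{..<d}. wedge_sub d)"
    using T_comp_wedge by (auto simp: T_map_def)
next
  show "(\<Pi>\<^sub>E i\<in>{..<d}. wedge_sub d) \<subseteq> T_map d M ` carrier G"
  proof
    fix w assume w: "w \<in> (\<Pi>\<^sub>E i\<in>{..<d}. wedge_sub d)"
    interpret TP: comm_group "TP (Suc d)" by (rule TP_comm_group)
    have wc: "w j \<in> wedge_sub d" "w j \<in> carrier (TP (Suc d))" if "j < d" for j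
      using w that subgroup.mem_carrier[OF wedge_subgroup] by auto
    \<comment> \<open>The components are adjusted one after the other, each by an exchange that is
      trivial in all other components.\<close>
    have "\<exists>f. is_rec f \<and> (\<forall>j<d. T_comp d M f j = (if j < n then w j else \<one>\<^bsub>TP (Suc d)\<^esub>))" if "n \<le> d" for n
      using that
    proof (induction n)
      case 0
      have "\<forall>j<d. T_comp d M id j = (if j < 0 then w j else \<one>\<^bsub>TP (Suc d)\<^esub>)" unfolding less_nat_zero_code if_False using T_comp_id by blast
      thus ?case using is_rec_id by blast
    next
      case (Suc n)
      then obtain f where f: "is_rec f" "\<forall>j<d. T_comp d M f j = (if j < n then w j else \<one>\<^bsub>TP (Suc d)\<^esub>)" by auto
      have n: "n < d" using Suc.prems by simp
      obtain g where g: "is_rec g" "T_comp d M g n = w n" "\<forall>j<d. j \<noteq> n \<longrightarrow> T_comp d M g j = \<one>\<^bsub>TP (Suc d)\<^esub>"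
        using wedge_realized[OF n wc(1)[OF n]] by blast
      have "T_comp d M (f \<circ> g) j = (if j < Suc n then w j else \<one>\<^bsub>TP (Suc d)\<^esub>)" if j: "j < d" for j
        unfolding T_comp_mult[OF f(1) g(1) j] using f(2) g(2,3) j wc(2)[OF j] by (cases "j = n") auto
      thus ?case using is_rec_comp[OF f(1) g(1)] by blast
    qed
    from this[OF order_refl] obtain f where f: "is_rec f" "\<forall>j<d. T_comp d M f j = w j" by auto
    have "T_map d M f = w"
    proof
      fix j show "T_map d M f j = w j"
        using f(2) PiE_arb[OF w, of j] by (cases "j < d") (simp_all add: T_map_def)
    qed
    thus "w \<in> T_map d M ` carrier G" using f(1) G_carrier by blast
  qed
qed

section \<open>The kernel of T\<close>

text \<open>An integer vector of exponents is read off both in the abelianization and, through products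
  of dual functionals, from the values of T.\<close>
lemma kernel_DG:
  assumes f: "is_rec f" and T1: "\<forall>i<d. T_comp d M f i = \<one>\<^bsub>TP (Suc d)\<^esub>"
  shows "f \<in> DG"
proof -
  interpret A: comm_group A by (rule A_comm)
  interpret TP: comm_group "TP (Suc d)" by (rule TP_comm_group)
  obtain a0 L where R: "length a0 = d" "L > 0" "box_at a0 (replicate d L) \<subseteq> M" using room by blast
  \<comment> \<open>The bound \<open>L / 10\<close> keeps the sum of two elements of
    \<open>E\<close>, the long side of a shuffled box, below the \<open>L / 5\<close> of
    \<open>ab_class_shuffle_small\<close>.\<close>
  obtain E where E: "qindep E" "\<forall>e\<in>E. 0 < e \<and> e < L / 10" and fE: "f \<in> gen_by E"
    using generation[OF f, of "L / 10"] R(2) by auto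
  have fin: "finite E" using E by (simp add: qindep_def)
  have "\<forall>e\<in>E. \<exists>\<phi> :: real \<Rightarrow> rat. (\<forall>x y. \<phi> (x + y) = \<phi> x + \<phi> y) \<and> \<phi> e = 1 \<and> (\<forall>e'\<in>E. e' \<noteq> e \<longrightarrow> \<phi> e' = 0)"
    using dual_functional[OF E(1)] by blast
  from bchoice[OF this] obtain \<phi> :: "real \<Rightarrow> real \<Rightarrow> rat" where
    "\<forall>e\<in>E. (\<forall>x y. \<phi> e (x + y) = \<phi> e x + \<phi> e y) \<and> \<phi> e e = 1 \<and> (\<forall>e'\<in>E. e' \<noteq> e \<longrightarrow> \<phi> e e' = 0)" ..
  hence \<phi>: "e \<in> E \<Longrightarrow> \<phi> e (x + y) = \<phi> e x + \<phi> e y"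
    "e \<in> E \<Longrightarrow> e' \<in> E \<Longrightarrow> \<phi> e e' = (if e' = e then 1 else 0)" for e e' x y by simp_all
  \<comment> \<open>On lists over \<open>E\<close> of the same length as \<open>es\<close>, this
    takes the value \<open>1\<close> at \<open>es\<close> and \<open>0\<close> elsewhere, while
    being multiadditive on all lists.\<close>
  define \<Phi> where "\<Phi> es xs = (\<Prod>j<length es. \<phi> (es ! j) (xs ! j))" for es xs
  have \<Phi>madd: "madd k {0} (\<Phi> es)" if "length es = k" "set es \<subseteq> E" for es k
    unfolding madd_upd
  proof (intro allI impI)
    fix zs :: "real list" and j and x y :: real assume zs: "length zs = k" "j < k"
    have "\<Phi> es (zs[j := u]) = \<phi> (es ! j) u * (\<Prod>l\<in>{..<k} - {j}. \<phi> (es ! l) (zs ! l))" for u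
      unfolding \<Phi>_def that(1) using zs
      by (subst prod.remove[of _ j]) (auto intro!: prod.cong)
    moreover have "es ! j \<in> E" using that zs set_nthD[OF that(2)] by simp
    ultimately show "\<Phi> es (zs[j := x + y]) - \<Phi> es (zs[j := x]) - \<Phi> es (zs[j := y]) \<in> {0}"
      using \<phi>(1) by (simp add: algebra_simps)
  qed
  have \<Phi>val: "\<Phi> es zs = (if zs = es then 1 else 0)" if "length zs = length es" "set es \<subseteq> E" "set zs \<subseteq> E" for es zs
  proof -
    have "\<phi> (es ! j) (zs ! j) = (if zs ! j = es ! j then 1 else 0)" if "j < length es" for j
      using \<phi>(2) set_nthD[OF \<open>set es \<subseteq> E\<close>] set_nthD[OF \<open>set zs \<subseteq> E\<close>] that \<open>length zs = length es\<close> by simp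
    hence "\<Phi> es zs = (\<Prod>j<length es. if zs ! j = es ! j then 1 else 0)" by (simp add: \<Phi>_def)
    also have "\<dots> = (if zs = es then 1 else 0)"
    proof (cases "zs = es")
      case False
      hence "\<exists>j<length es. zs ! j \<noteq> es ! j" using that(1) by (auto simp: list_eq_iff_nth_eq)
      then obtain j where "j < length es" "zs ! j \<noteq> es ! j" by blast
      thus ?thesis using False by (auto intro!: prod_zero)
    qed simp
    finally show ?thesis .
  qed
  \<comment> \<open>The strict inequality selects one member from each pair consisting of a shuffle
    and its inverse, and leaves out the shuffles that are swaps.\<close>
  define Ty where "Ty = {(i, ts, t). i < d \<and> length ts = d \<and> set ts \<subseteq> E \<and> t \<in> E \<and> ts ! i < t}"
  have "finite ({..<d} \<times> {ts. set ts \<subseteq> E \<and> length ts = d} \<times> E)"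
    using finite_lists_length_eq[OF fin] fin by (intro finite_cartesian_product) auto
  hence finTy: "finite Ty" by (rule rev_finite_subset) (auto simp: Ty_def)
  define c where "c = (\<lambda>(i, ts, t). ab_class (shuffle i a0 ts t))"
  have room': "shuffle_data i a0 ts t" if "i < d" "length ts = d" "set ts \<subseteq> E" "t \<in> E" for i ts t
  proof (rule shuffle_data_room[OF R(1,3) that(1,2), of "L / 10"])
    show "\<forall>j<d. 0 < ts ! j \<and> ts ! j < L / 10" using set_nthD[OF that(3)] that(2) E(2) by simp
  qed (use E(2) that R in auto)
  have cA: "c \<tau> \<in> carrier A" if "\<tau> \<in> Ty" for \<tau>
    using that room' shuffle_is_rec ab_class_carrier unfolding c_def Ty_def by auto
  have small: "ab_class (shuffle i a ts t) = ab_class (shuffle i a0 ts t)" if s: "shuffle_data i a ts t" "set ts \<subseteq> E" "t \<in> E" for i a ts t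
  proof (rule ab_class_shuffle_small[OF R(1,3,2) s(1)])
    have l: "i < d" "length ts = d" using s(1) by (simp_all add: shuffle_data_def)
    show "shuffle_data i a0 ts t" by (rule room'[OF l s(2,3)])
    have "ts ! j < L / 10" if "j < d" for j using set_nthD[OF s(2)] l that E(2) by simp
    thus "\<forall>j<d. ts[i := ts ! i + t] ! j < L / 5" using l s(3) E(2) R(2)
      by (auto simp: nth_list_update) (smt (verit) field_sum_of_halves)+
  qed
  \<comment> \<open>The list of the pure tensor that occurs with sign plus in the value of T at a
    shuffle of this type.\<close>
  define es where "es = (\<lambda>(i, ts, t). swap_fac d i ts @ [t])"
  have es: "length (es \<tau>) = Suc d" "set (es \<tau>) \<subseteq> E" "fst \<tau> < d" if "\<tau> \<in> Ty" for \<tau>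
  proof -
    obtain i ts t where \<tau>: "\<tau> = (i, ts, t)" by (cases \<tau>)
    have l: "i < d" "length ts = d" "set ts \<subseteq> E" "t \<in> E" using that by (auto simp: Ty_def \<tau>)
    have "swap_fac d i ts ! j \<in> E" if "j < d" for j
      using that l d1 set_nthD[OF l(3)] by (simp add: swap_fac_def nth_list_update)
    thus "length (es \<tau>) = Suc d" "set (es \<tau>) \<subseteq> E" "fst \<tau> < d" using l by (auto simp: es_def \<tau> in_set_conv_nth)
  qed
  \<comment> \<open>An arbitrary representative is chosen; the value is independent of it because
    the functional vanishes on the relations.\<close>
  define \<chi> where "\<chi> \<tau> g = eval_functional (\<Phi> (es \<tau>)) (SOME u. u \<in> carrier (FreeQ (Suc d)) \<and> T_comp d M g (fst \<tau>) = cl (Suc d) u)" for \<tau> g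
  have \<chi>: "\<chi> \<tau> g = eval_functional (\<Phi> (es \<tau>)) u" if "\<tau> \<in> Ty" "u \<in> carrier (FreeQ (Suc d))" "T_comp d M g (fst \<tau>) = cl (Suc d) u" for \<tau> g u
  proof -
    let ?v = "SOME u. u \<in> carrier (FreeQ (Suc d)) \<and> T_comp d M g (fst \<tau>) = cl (Suc d) u"
    have "?v \<in> carrier (FreeQ (Suc d)) \<and> T_comp d M g (fst \<tau>) = cl (Suc d) ?v"
      by (rule someI[of _ u]) (use that in blast)
    thus ?thesis unfolding \<chi>_def using that(2,3) by (intro eval_functional_cl[OF \<Phi>madd[OF es(1,2)[OF that(1)]]]) auto
  qed
  have \<chi>one: "\<chi> \<tau> g = 0" if "\<tau> \<in> Ty" "T_comp d M g (fst \<tau>) = \<one>\<^bsub>TP (Suc d)\<^esub>" for \<tau> g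
    using \<chi>[OF that(1) asub_0[OF FreeQ_asub]] that(2) cl_one eval_functional_rel[OF \<Phi>madd[OF es(1,2)[OF that(1)]] asub_0[OF tensor_rel_asub]] by simp
  have \<chi>comp: "\<chi> \<tau> (g \<circ> h) = \<chi> \<tau> g + \<chi> \<tau> h" if \<tau>: "\<tau> \<in> Ty" and g: "is_rec g" and h: "is_rec h" for \<tau> g h
  proof -
    obtain u where u: "u \<in> carrier (FreeQ (Suc d))" "T_comp d M g (fst \<tau>) = cl (Suc d) u"
      using T_comp_carrier[OF g es(3)[OF \<tau>]] unfolding TP_carrier by auto
    obtain v where v: "v \<in> carrier (FreeQ (Suc d))" "T_comp d M h (fst \<tau>) = cl (Suc d) v"
      using T_comp_carrier[OF h es(3)[OF \<tau>]] unfolding TP_carrier by auto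
    have "T_comp d M (g \<circ> h) (fst \<tau>) = cl (Suc d) (u + v)"
      unfolding T_comp_mult[OF g h es(3)[OF \<tau>]] u(2) v(2) by (rule cl_mult[OF u(1) v(1)])
    from \<chi>[OF \<tau> asub_add[OF FreeQ_asub u(1) v(1)] this] show ?thesis
      using \<chi>[OF \<tau> u] \<chi>[OF \<tau> v] eval_functional_add[OF u(1) v(1)] by simp
  qed
  have \<chi>shuffle: "\<chi> \<tau> (shuffle i a ts t) = (if \<tau> = (i, ts, t) then 1 else 0)"
    if \<tau>: "\<tau> \<in> Ty" and s: "shuffle_data i a ts t" "set ts \<subseteq> E" "t \<in> E" "ts ! i < t" for \<tau> i a ts t
  proof -
    obtain i' ts' t' where \<tau>e: "\<tau> = (i', ts', t')" by (cases \<tau>)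
    have l': "i' < d" "length ts' = d" "set ts' \<subseteq> E" "t' \<in> E" "ts' ! i' < t'" using \<tau> by (auto simp: Ty_def \<tau>e)
    have l: "i < d" "length ts = d" using s(1) by (simp_all add: shuffle_data_def)
    show ?thesis
    proof (cases "i' = i")
      case False
      hence "T_comp d M (shuffle i a ts t) (fst \<tau>) = \<one>\<^bsub>TP (Suc d)\<^esub>" using T_shuffle[OF s(1) l'(1)] by (simp add: \<tau>e)
      thus ?thesis using \<chi>one[OF \<tau>] False \<tau>e by simp
    next
      case True
      let ?x = "swap_fac d i ts @ [t]" and ?y = "swap_fac d i (ts[i := t]) @ [ts ! i]"
      have tyx: "(i, ts, t) \<in> Ty" using l s by (auto simp: Ty_def)
      have x: "length ?x = Suc d" "set ?x \<subseteq> E" using es(1,2)[OF tyx] by (simp_all add: es_def)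
      have y: "length ?y = Suc d" "set ?y \<subseteq> E"
      proof -
        have xx: "?x = butlast (swap_fac d i ts) @ [ts ! i, t]" using swap_fac_upd_last[OF l, of "ts ! i"] by simp
        have "?y = butlast (swap_fac d i ts) @ [t, ts ! i]" using swap_fac_upd_last[OF l, of t] by simp
        thus "length ?y = Suc d" "set ?y \<subseteq> E" using x unfolding xx by auto
      qed
      have "\<chi> \<tau> (shuffle i a ts t) = eval_functional (\<Phi> (es \<tau>)) (delta ?x - delta ?y)"
      proof (rule \<chi>[OF \<tau>])
        show "delta ?x - delta ?y \<in> carrier (FreeQ (Suc d))" using x y by (intro asub_diff[OF FreeQ_asub] delta_carrier)
        show "T_comp d M (shuffle i a ts t) (fst \<tau>) = cl (Suc d) (delta ?x - delta ?y)"
          using T_shuffle[OF s(1) l(1)] True by (simp add: \<tau>e)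
      qed
      also have "\<dots> = \<Phi> (es \<tau>) ?x - \<Phi> (es \<tau>) ?y"
        using eval_functional_diff[OF delta_carrier[OF x(1)] delta_carrier[OF y(1)]] by simp
      also have "\<dots> = (if ?x = es \<tau> then 1 else 0) - (if ?y = es \<tau> then 1 else 0)"
        using \<Phi>val[OF _ es(2)[OF \<tau>] x(2)] \<Phi>val[OF _ es(2)[OF \<tau>] y(2)] es(1)[OF \<tau>] x(1) y(1) by simp
      also have "?x = es \<tau> \<longleftrightarrow> \<tau> = (i, ts, t)"
      proof
        assume "?x = es \<tau>"
        hence e: "swap_fac d i ts = swap_fac d i ts'" "t = t'" using True by (simp_all add: es_def \<tau>e)
        have "ts = swap_fac d i (swap_fac d i ts)" by (rule swap_fac_swap_fac[OF l, symmetric])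
        also have "\<dots> = ts'" unfolding e(1) by (rule swap_fac_swap_fac[OF l(1) l'(2)])
        finally show "\<tau> = (i, ts, t)" using e(2) True by (simp add: \<tau>e)
      qed (simp add: es_def)
      \<comment> \<open>In the tensor with sign minus the two lengths come in the opposite order, so
        it could only belong to a type whose first length is the larger one, against the definition
        of \<open>Ty\<close>.\<close>
      also have "?y \<noteq> es \<tau>"
      proof
        assume "?y = es \<tau>"
        hence e: "swap_fac d i (ts[i := t]) = swap_fac d i ts'" "ts ! i = t'" using True by (simp_all add: es_def \<tau>e)
        have "ts[i := t] = swap_fac d i (swap_fac d i (ts[i := t]))" by (rule swap_fac_swap_fac[OF l(1), symmetric]) (simp add: l)
        also have "\<dots> = ts'" unfolding e(1) by (rule swap_fac_swap_fac[OF l(1) l'(2)])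
        finally have "ts[i := t] = ts'" .
        hence "ts' ! i' = t" using True l by auto
        thus False using l'(5) e(2) s(4) by simp
      qed
      ultimately show ?thesis by simp
    qed
  qed
  \<comment> \<open>The invariant of the induction: a single integer vector gives both the
    functional values and the class of \<open>g\<close>. Once T vanishes at \<open>f\<close>, so do
    the exponents of its class.\<close>
  define Z where "Z g \<longleftrightarrow> (\<exists>n :: _ \<Rightarrow> int. (\<forall>\<tau>\<in>Ty. \<chi> \<tau> g = of_int (n \<tau>)) \<and> ab_class g = finprod A (\<lambda>\<tau>. c \<tau> [^]\<^bsub>A\<^esub> n \<tau>) Ty)" for g
  have Z0: "Z g" if "\<And>i. i < d \<Longrightarrow> T_comp d M g i = \<one>\<^bsub>TP (Suc d)\<^esub>" "ab_class g = \<one>\<^bsub>A\<^esub>" for g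
    unfolding Z_def
  proof (intro exI[of _ "\<lambda>_. 0"] conjI ballI)
    show "\<chi> \<tau> g = of_int 0" if "\<tau> \<in> Ty" for \<tau> using \<chi>one[OF that] es(3)[OF that] \<open>\<And>i. i < d \<Longrightarrow> T_comp d M g i = \<one>\<^bsub>TP (Suc d)\<^esub>\<close> by simp
    show "ab_class g = finprod A (\<lambda>\<tau>. c \<tau> [^]\<^bsub>A\<^esub> (0::int)) Ty" using that(2) by (simp only: int_pow_0 A.finprod_one)
  qed
  have Z1: "Z g" if \<tau>: "\<tau> \<in> Ty" and n: "\<And>\<tau>'. \<tau>' \<in> Ty \<Longrightarrow> \<chi> \<tau>' g = (if \<tau>' = \<tau> then of_int k else 0)"
    and qg: "ab_class g = c \<tau> [^]\<^bsub>A\<^esub> (k :: int)" for g \<tau> k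
    unfolding Z_def
  proof (intro exI[of _ "\<lambda>\<tau>'. if \<tau> = \<tau>' then k else 0"] conjI ballI)
    show "\<chi> \<tau>' g = of_int (if \<tau> = \<tau>' then k else 0)" if "\<tau>' \<in> Ty" for \<tau>' using n[OF that] by auto
    have "finprod A (\<lambda>\<tau>'. c \<tau>' [^]\<^bsub>A\<^esub> (if \<tau> = \<tau>' then k else 0)) Ty = finprod A (\<lambda>\<tau>'. if \<tau> = \<tau>' then c \<tau>' [^]\<^bsub>A\<^esub> k else \<one>\<^bsub>A\<^esub>) Ty"
    proof (rule A.finprod_cong')
      show "(\<lambda>\<tau>'. if \<tau> = \<tau>' then c \<tau>' [^]\<^bsub>A\<^esub> k else \<one>\<^bsub>A\<^esub>) \<in> Ty \<rightarrow> carrier A"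
        using cA A.int_pow_closed A.one_closed by auto
      fix \<tau>' show "c \<tau>' [^]\<^bsub>A\<^esub> (if \<tau> = \<tau>' then k else 0) = (if \<tau> = \<tau>' then c \<tau>' [^]\<^bsub>A\<^esub> k else \<one>\<^bsub>A\<^esub>)"
        by (simp only: int_pow_0 split: if_split) simp
    qed simp
    also have "\<dots> = c \<tau> [^]\<^bsub>A\<^esub> k"
      by (rule A.finprod_singleton[OF \<tau> finTy]) (use cA A.int_pow_closed in auto)
    finally show "ab_class g = finprod A (\<lambda>\<tau>'. c \<tau>' [^]\<^bsub>A\<^esub> (if \<tau> = \<tau>' then k else 0)) Ty" using qg by simp
  qed
  from fE have "Z f"
  proof (induction rule: gen_by_induct)
    case id show ?case by (rule Z0[OF T_comp_id ab_class_id])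
  next
    case (swap_map a ts v) show ?case by (rule Z0[OF T_comp_swap_map[OF swap_map] ab_class_swap_map[OF swap_map]])
  next
    case (shuffle i a ts t)
    have l: "i < d" "length ts = d" using shuffle(1) by (simp_all add: shuffle_data_def)
    have sE: "ts ! i \<in> E" using set_nthD[OF shuffle(2)] l by simp
    consider "ts ! i < t" | "ts ! i = t" | "t < ts ! i" by linarith
    thus ?case
    proof cases
      case 1
      let ?\<tau> = "(i, ts, t)"
      have \<tau>: "?\<tau> \<in> Ty" using 1 l shuffle by (simp add: Ty_def)
      have "ab_class (shuffle i a ts t) = c ?\<tau> [^]\<^bsub>A\<^esub> (1::int)"
        using small[OF shuffle] A.int_pow_1[OF cA[OF \<tau>]] by (simp add: c_def)
      from Z1[OF \<tau> _ this] show ?thesis using \<chi>shuffle[OF _ shuffle 1] by simp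
    next
      case 2
      have s: "swap_data a ts (axis_vec i (ts ! i))" "shuffle i a ts t = swap_map a ts (axis_vec i (ts ! i))" using shuffle_eq_swap_map[of i a ts] shuffle(1) 2 by simp_all
      show ?thesis unfolding s(2) by (rule Z0[OF T_comp_swap_map[OF s(1)] ab_class_swap_map[OF s(1)]])
    next
      case 3
      \<comment> \<open>The lengths are in the wrong order for \<open>Ty\<close>, but the inverse
        shuffle has a type there, so the exponent \<open>-1\<close> is recorded at that
        type.\<close>
      let ?ts = "ts[i := t]" and ?s = "ts ! i"
      let ?g = "shuffle i a ?ts ?s" and ?\<tau> = "(i, ?ts, ?s)"
      have sd: "shuffle_data i a ?ts ?s" by (rule shuffle_data_inverse[OF shuffle(1)])
      have tsE: "set ?ts \<subseteq> E" using shuffle(2,3) set_update_subset_insert[of ts i t] by blast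
      have lt: "?ts ! i < ?s" using 3 l by simp
      have \<tau>: "?\<tau> \<in> Ty" using lt l tsE sE by (simp add: Ty_def)
      have gc: "?g \<circ> shuffle i a ts t = id" by (rule shuffle_comp[OF shuffle(1)])
      have rg: "is_rec ?g" "is_rec (shuffle i a ts t)" using shuffle_is_rec[OF sd] shuffle_is_rec[OF shuffle(1)] .
      have qg: "ab_class ?g = c ?\<tau>" using small[OF sd tsE sE] by (simp add: c_def)
      have "ab_class ?g \<otimes>\<^bsub>A\<^esub> ab_class (shuffle i a ts t) = \<one>\<^bsub>A\<^esub>" using ab_class_comp[OF rg] unfolding gc ab_class_id by simp
      hence "ab_class (shuffle i a ts t) = inv\<^bsub>A\<^esub> c ?\<tau>" unfolding qg
        using A.inv_equality[OF _ cA[OF \<tau>] ab_class_carrier[OF rg(2)]] A.m_comm[OF cA[OF \<tau>] ab_class_carrier[OF rg(2)]] by simp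
      also have "\<dots> = c ?\<tau> [^]\<^bsub>A\<^esub> (-1::int)" using A.int_pow_neg[OF cA[OF \<tau>], of 1] A.int_pow_1[OF cA[OF \<tau>]] by simp
      finally have qf: "ab_class (shuffle i a ts t) = c ?\<tau> [^]\<^bsub>A\<^esub> (-1::int)" .
      show ?thesis
      proof (rule Z1[OF \<tau> _ qf])
        fix \<tau>' assume \<tau>': "\<tau>' \<in> Ty"
        have "\<chi> \<tau>' ?g + \<chi> \<tau>' (shuffle i a ts t) = \<chi> \<tau>' id" using \<chi>comp[OF \<tau>' rg] unfolding gc by (rule sym)
        also have "\<dots> = 0" by (rule \<chi>one[OF \<tau>' T_comp_id[OF es(3)[OF \<tau>']]])
        finally show "\<chi> \<tau>' (shuffle i a ts t) = (if \<tau>' = ?\<tau> then of_int (-1) else 0)"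
          using \<chi>shuffle[OF \<tau>' sd tsE sE lt] by (simp split: if_splits)
      qed
    qed
  next
    case (comp g h)
    then obtain n m where n: "\<forall>\<tau>\<in>Ty. \<chi> \<tau> g = of_int (n \<tau>)" "ab_class g = finprod A (\<lambda>\<tau>. c \<tau> [^]\<^bsub>A\<^esub> (n \<tau> :: int)) Ty"
      and m: "\<forall>\<tau>\<in>Ty. \<chi> \<tau> h = of_int (m \<tau>)" "ab_class h = finprod A (\<lambda>\<tau>. c \<tau> [^]\<^bsub>A\<^esub> (m \<tau> :: int)) Ty" unfolding Z_def by blast
    show ?case unfolding Z_def
    proof (intro exI[of _ "\<lambda>\<tau>. n \<tau> + m \<tau>"] conjI ballI)
      show "\<chi> \<tau> (g \<circ> h) = of_int (n \<tau> + m \<tau>)" if "\<tau> \<in> Ty" for \<tau>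
        unfolding \<chi>comp[OF that comp(1,2)] using n(1) m(1) that by simp
      have "ab_class (g \<circ> h) = finprod A (\<lambda>\<tau>. c \<tau> [^]\<^bsub>A\<^esub> n \<tau> \<otimes>\<^bsub>A\<^esub> c \<tau> [^]\<^bsub>A\<^esub> m \<tau>) Ty"
        unfolding ab_class_comp[OF comp(1,2)] n(2) m(2) by (rule A.finprod_multf[symmetric]) (use cA A.int_pow_closed in auto)
      also have "\<dots> = finprod A (\<lambda>\<tau>. c \<tau> [^]\<^bsub>A\<^esub> (n \<tau> + m \<tau>)) Ty"
      proof (rule A.finprod_cong'[OF refl])
        show "(\<lambda>\<tau>. c \<tau> [^]\<^bsub>A\<^esub> (n \<tau> + m \<tau>)) \<in> Ty \<rightarrow> carrier A" using cA A.int_pow_closed by auto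
        fix \<tau> assume "\<tau> \<in> Ty"
        thus "c \<tau> [^]\<^bsub>A\<^esub> n \<tau> \<otimes>\<^bsub>A\<^esub> c \<tau> [^]\<^bsub>A\<^esub> m \<tau> = c \<tau> [^]\<^bsub>A\<^esub> (n \<tau> + m \<tau>)" using A.int_pow_mult[OF cA] by simp
      qed
      finally show "ab_class (g \<circ> h) = finprod A (\<lambda>\<tau>. c \<tau> [^]\<^bsub>A\<^esub> (n \<tau> + m \<tau>)) Ty" .
    qed
  qed
  then obtain n where n: "\<forall>\<tau>\<in>Ty. \<chi> \<tau> f = of_int (n \<tau>)" "ab_class f = finprod A (\<lambda>\<tau>. c \<tau> [^]\<^bsub>A\<^esub> (n \<tau> :: int)) Ty"
    unfolding Z_def by blast
  have "n \<tau> = 0" if "\<tau> \<in> Ty" for \<tau>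
    using bspec[OF n(1) that] \<chi>one[OF that T1[rule_format, OF es(3)[OF that]]] by simp
  hence "ab_class f = finprod A (\<lambda>\<tau>. \<one>\<^bsub>A\<^esub>) Ty" unfolding n(2)
    by (intro A.finprod_cong'[OF refl]) (auto simp del: one_FactGroup)
  hence "ab_class f = \<one>\<^bsub>A\<^esub>" by (simp only: A.finprod_one)
  thus ?thesis using ab_class_one_iff[OF f] by blast
qed

lemma T_kernel: "kernel G PG (T_map d M) = DG"
proof -
  have iff: "T_map d M f = \<one>\<^bsub>PG\<^esub> \<longleftrightarrow> (\<forall>i<d. T_comp d M f i = \<one>\<^bsub>TP (Suc d)\<^esub>)" for f
    unfolding one_product_group T_map_def by (auto simp: fun_eq_iff restrict_def)
  have "f \<in> DG \<Longrightarrow> is_rec f" for f using subgroup.mem_carrier[OF DG_subgroup] G_carrier by blast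
  thus ?thesis unfolding kernel_def iff G_carrier using kernel_DG T_comp_DG by blast
qed

abbreviation WG where "WG \<equiv> product_group {..<d} (\<lambda>_. (TP (Suc d))\<lparr>carrier := wedge_sub d\<rparr>)"

text \<open>The first isomorphism theorem, applied after cutting the codomain of T down to its
  image.\<close>

lemma abelianization: "A \<cong> WG"
proof -
  have W: "group WG" by (rule product_group) (rule subgroup.subgroup_is_group[OF wedge_subgroup TP_group])
  have m: "(\<otimes>\<^bsub>WG\<^esub>) = (\<otimes>\<^bsub>PG\<^esub>)" by simp
  have h: "T_map d M \<in> hom G WG"
  proof (rule homI)
    fix f assume "f \<in> carrier G"
    from imageI[OF this, of "T_map d M"] have "T_map d M f \<in> (\<Pi>\<^sub>E i\<in>{..<d}. wedge_sub d)" unfolding T_image .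
    thus "T_map d M f \<in> carrier WG" by simp
  next
    fix f g assume "f \<in> carrier G" "g \<in> carrier G"
    from hom_mult[OF T_hom this] show "T_map d M (f \<otimes>\<^bsub>G\<^esub> g) = T_map d M f \<otimes>\<^bsub>WG\<^esub> T_map d M g"
      unfolding m .
  qed
  interpret group_hom G WG "T_map d M" using h W G_group by (simp add: group_hom_def group_hom_axioms_def)
  have "kernel G WG (T_map d M) = kernel G PG (T_map d M)" by (simp add: kernel_def)
  hence "kernel G WG (T_map d M) = DG" using T_kernel by simp
  moreover have "T_map d M ` carrier G = carrier WG" using T_image by simp
  ultimately show ?thesis using FactGroup_iso by simp
qed

end

theorem mainTheorem6:
  fixes d :: nat and M :: "real list set"
  assumes "d \<ge> 1" and "multirectangle d M" and "M \<noteq> {}"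
  shows "T_map d M \<in> hom (Rec_group d M) (product_group {..<d} (\<lambda>_. TP (Suc d)))
    \<and> T_map d M ` carrier (Rec_group d M) = (\<Pi>\<^sub>E i\<in>{..<d}. wedge_sub d)
    \<and> kernel (Rec_group d M) (product_group {..<d} (\<lambda>_. TP (Suc d))) (T_map d M)
        = derived (Rec_group d M) (carrier (Rec_group d M))
    \<and> Rec_group d M Mod derived (Rec_group d M) (carrier (Rec_group d M))
        \<cong> product_group {..<d} (\<lambda>_. (TP (Suc d))\<lparr>carrier := wedge_sub d\<rparr>)"
proof -
  interpret mrect d M by standard fact+
  show ?thesis using T_hom T_image T_kernel abelianization by blast
qed

end
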